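(* Let $N\ge2$ and let $g:\mathbb R^N\setminus\{0\}\to\mathbb R^+$ be an admissible decreasing function. For every $\varepsilon>0$ there exists a minimiser of $\widetilde{\mathfrak F}_\varepsilon$ in the class $\mathcal A$. More precisely, there exist a set $E\in\mathcal A$, an integer $H\ge 1$ and a partition $E=\bigcup_{i=1}^H E^i$ into pairwise disjoint sets $E^i$ such that $$\widetilde{\mathfrak F}_\varepsilon(E)=\sum_{i=1}^H\mathfrak F_\varepsilon(E^i)=\inf\big\{\widetilde{\mathfrak F}_\varepsilon(\Omega):\ \Omega\in\mathcal A\big\}.$$ Moreover, for each $1\le\bar i\le H$ the set $E^{\bar i}$ is a minimiser of both the standard and the generalised energy for its volume, i.e. $$\widetilde{\mathfrak F}_\varepsilon(E^{\bar i})=\mathfrak F_\varepsilon(E^{\bar i})=\min\big\{\widetilde{\mathfrak F}_\varepsilon(\Omega):\ \Omega\subseteq\mathbb R^N,\ |\Omega|=|E^{\bar i}|\big\}.$$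
   Context: All sets are Lebesgue measurable subsets of $\mathbb R^N$; $|\cdot|$ is Lebesgue measure, $B$ is the unit ball centred at the origin, $\omega_N=|B|$, $P$ is the De Giorgi perimeter ($+\infty$ if the perimeter is not finite), $\mathbb R^+=(0,+\infty)$. For $g:\mathbb R^N\setminus\{0\}\to\mathbb R^+$ measurable and $\varepsilon>0$, $$\mathfrak F_\varepsilon(\Omega)=P(\Omega)+\varepsilon\iint_{\Omega\times\Omega}g(y-x)\,dy\,dx,$$ $$\widetilde{\mathfrak F}_{\varepsilon,H}(\Omega)=\inf\Big\{\sum_{i=1}^H\mathfrak F_\varepsilon(\Omega^i):\ \Omega=\bigcup_{i=1}^H\Omega^i,\ \Omega^i\cap\Omega^j=\emptyset\ \text{for } i\ne j\Big\},\qquad \widetilde{\mathfrak F}_\varepsilon(\Omega)=\inf_{H\ge1}\widetilde{\mathfrak F}_{\varepsilon,H}(\Omega).$$ The class is $\mathcal A=\{\Omega\subseteq\mathbb R^N\text{ measurable}:|\Omega|=\omega_N\}$. The function $g$ is admissible if $\int_B\int_B g(y-x)\,dy\,dx<+\infty$; an admissible $g$ is decreasing if $g(\lambda x)\le g(x)$ for every $x\in\mathbb R^N\setminus\{0\}$ and every $\lambda>1$. *)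

theory Defs
  imports "HOL-Analysis.Analysis"
begin

definition divergence :: "('a::euclidean_space \<Rightarrow> 'a) \<Rightarrow> 'a \<Rightarrow> real" where
  "divergence \<phi> x = (\<Sum>b\<in>Basis. frechet_derivative \<phi> (at x) b \<bullet> b)"

definition C1_compact_support :: "('a::euclidean_space \<Rightarrow> 'a) \<Rightarrow> bool" where
  "C1_compact_support \<phi> \<longleftrightarrow>
     (\<exists>\<phi>' :: 'a \<Rightarrow> 'a \<Rightarrow>\<^sub>L 'a.
        (\<forall>x. (\<phi> has_derivative blinfun_apply (\<phi>' x)) (at x)) \<and> continuous_on UNIV \<phi>') \<and>
     compact (closure {x. \<phi> x \<noteq> 0})"

text \<open>
  The De Giorgi perimeter of a Lebesgue measurable set. Negative integrals are truncated to \<open>0\<close> by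
  \<^const>\<open>ennreal\<close>; since \<open>\<phi> = 0\<close> is a competitor this does not change the supremum.
\<close>

definition perimeter :: "'a::euclidean_space set \<Rightarrow> ennreal" where
  "perimeter \<Omega> =
     (SUP \<phi> \<in> {\<phi>. C1_compact_support \<phi> \<and> (\<forall>x. norm (\<phi> x) \<le> 1)}.
        ennreal (set_lebesgue_integral lebesgue \<Omega> (divergence \<phi>)))"

text \<open>
  A kernel \<open>g\<close> is only meaningful off the origin, but is a total function here. Its value
  at \<open>0\<close> does not matter: in the inner integral it is only taken at the single point \<open>y = x\<close>.
\<close>

definition interaction :: "('a::euclidean_space \<Rightarrow> real) \<Rightarrow> 'a set \<Rightarrow> ennreal" where
  "interaction g \<Omega> =
     (\<integral>\<^sup>+ x\<in>\<Omega>. (\<integral>\<^sup>+ y\<in>\<Omega>. ennreal (g (y - x)) \<partial>lebesgue) \<partial>lebesgue)"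

definition energy :: "('a::euclidean_space \<Rightarrow> real) \<Rightarrow> real \<Rightarrow> 'a set \<Rightarrow> ennreal" where
  "energy g \<epsilon> \<Omega> = perimeter \<Omega> + ennreal \<epsilon> * interaction g \<Omega>"

text \<open>The pieces are allowed to be empty.\<close>

definition is_partition :: "nat \<Rightarrow> (nat \<Rightarrow> 'a::euclidean_space set) \<Rightarrow> 'a set \<Rightarrow> bool" where
  "is_partition H D \<Omega> \<longleftrightarrow>
     (\<forall>i\<in>{1..H}. D i \<in> sets lebesgue) \<and>
     \<Omega> = (\<Union>i\<in>{1..H}. D i) \<and>
     disjoint_family_on D {1..H}"

definition gen_energy_pieces ::
  "('a::euclidean_space \<Rightarrow> real) \<Rightarrow> real \<Rightarrow> nat \<Rightarrow> 'a set \<Rightarrow> ennreal" where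
  "gen_energy_pieces g \<epsilon> H \<Omega> =
     (INF D \<in> {D. is_partition H D \<Omega>}. \<Sum>i\<in>{1..H}. energy g \<epsilon> (D i))"

definition gen_energy :: "('a::euclidean_space \<Rightarrow> real) \<Rightarrow> real \<Rightarrow> 'a set \<Rightarrow> ennreal" where
  "gen_energy g \<epsilon> \<Omega> = (INF H \<in> {1..}. gen_energy_pieces g \<epsilon> H \<Omega>)"

definition volume_class :: "ennreal \<Rightarrow> 'a::euclidean_space set set" where
  "volume_class m = {\<Omega> \<in> sets lebesgue. emeasure lebesgue \<Omega> = m}"

definition unit_class :: "'a::euclidean_space set set" where
  "unit_class = volume_class (emeasure lebesgue (ball (0::'a) 1))"

definition admissible :: "('a::euclidean_space \<Rightarrow> real) \<Rightarrow> bool" where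
  "admissible g \<longleftrightarrow> interaction g (ball 0 1) < \<infinity>"

definition radially_decreasing :: "('a::euclidean_space \<Rightarrow> real) \<Rightarrow> bool" where
  "radially_decreasing g \<longleftrightarrow> (\<forall>x. x \<noteq> 0 \<longrightarrow> (\<forall>c>1. g (c *\<^sub>R x) \<le> g x))"

end

theory Submission imports Defs "HOL-Library.Diagonal_Subsequence"
begin

text \<open>
  The proof is the direct method, organised around one function of the volume. Let \<open>j m\<close> be the
  infimum of \<open>F A\<^sub>1 + \<dots> + F A\<^sub>n\<close> over finite lists of sets of total volume \<open>m\<close>, where \<open>F\<close> is the
  energy of a single set and the sets of a list may overlap; \<open>N\<close> is the dimension. A partition of \<open>\<Omega>\<close> is such a list, so
  \<open>j\<close> bounds the generalised energy from below, and it remains to find, for the volume of the unit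
  ball, an optimal list whose members can be placed disjointly: a bounded set can be translated
  out of the way of the others without changing its energy.

  Five properties of \<open>j\<close> carry the argument. Lists can be concatenated, so \<open>j\<close> is subadditive.
  Cutting by a half-space does not increase the energy, so \<open>j\<close> is nondecreasing. Dilating by a
  factor \<open>\<lambda> \<ge> 1\<close> multiplies the interaction by at most \<open>\<lambda> ^ (2 * N)\<close>, because the kernel decreases
  along rays, so \<open>j (t * m) \<le> t\<^sup>2 * j m\<close> for \<open>t \<ge> 1\<close>. The isoperimetric inequality gives
  \<open>c * m powr (1 - 1 / N) \<le> j m\<close>. Finally \<open>j 0 = 0\<close>. In an optimal splitting of the volume a very
  small part is impossible: absorbing it into a larger part by a dilation costs an amount linear in
  its volume, while keeping it costs at least a power of its volume with exponent less than one. Hence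
  the number of parts is bounded, and a splitting with the most parts consists of indecomposable
  volumes, those with \<open>j m < j a + j b\<close> whenever \<open>m = a + b\<close> with \<open>a, b > 0\<close>
  (\<open>indecomposable_splitting\<close>).

  For an indecomposable volume \<open>m\<close> the number \<open>j m\<close> is the energy of a single set
  (\<open>indecomposable_attained\<close>). In a minimising sequence of lists the largest sets have volumes
  bounded below, and by indecomposability these volumes tend to \<open>m\<close>. Translated so that a fixed
  amount of mass stays near the origin, they have a limit \<open>E\<close> of positive volume. If \<open>E\<close> had volume
  less than \<open>m\<close>, cutting the sequence by large spheres would give
  \<open>j (vol E) + j (m - vol E) \<le> j m\<close>, which indecomposability excludes. The minimiser is bounded up
  to a null set (\<open>minimiser_bounded\<close>): cutting off its part outside a large ball and dilating the
  rest back to volume \<open>m\<close> shows that the volume outside the ball satisfies an inequality that forces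
  it to vanish at a finite radius.

  The facts on the perimeter that this needs are derived from its definition by test fields.
  Blending two fields with a radial cutoff bounds the perimeters of the two parts of a set cut by a
  sphere (\<open>perimeter_cut\<close>). Blending with a constant field outside a half-space shows that cutting
  by a half-space does not increase the perimeter. Transporting a bump function along \<open>h\<close> gives
  \<open>vol (A - (A - h)) \<le> norm h * perimeter A\<close> (\<open>measure_translation_Diff_le_perimeter\<close>), and
  integrating this over a ball of vectors \<open>h\<close> yields the isoperimetric inequality, the concentration
  of mass, and the compactness of sequences of sets with bounded perimeter.
\<close>

abbreviation vol :: "'a::euclidean_space set \<Rightarrow> real" where
  "vol \<equiv> measure lebesgue"

section \<open>Continuously differentiable maps\<close>

text \<open>
  The derivative is an explicit parameter because the estimates below need bounds for it.
\<close>

definition C1 :: "('a::euclidean_space \<Rightarrow> 'b::real_normed_vector) \<Rightarrow> ('a \<Rightarrow> 'a \<Rightarrow>\<^sub>L 'b) \<Rightarrow> bool" where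
  "C1 f f' \<longleftrightarrow> (\<forall>x. (f has_derivative blinfun_apply (f' x)) (at x)) \<and> continuous_on UNIV f'"

lemma C1_continuous_on: "C1 f f' \<Longrightarrow> continuous_on S f"
  unfolding C1_def by (meson continuous_at_imp_continuous_on has_derivative_continuous)

lemma C1_const: "C1 (\<lambda>_. c) (\<lambda>_. 0)"
  by (simp add: C1_def zero_blinfun.rep_eq)

lemma C1_scaleR_const: "C1 f f' \<Longrightarrow> C1 (\<lambda>x. c *\<^sub>R f x) (\<lambda>x. c *\<^sub>R f' x)"
  unfolding C1_def by (auto intro!: derivative_eq_intros continuous_intros simp: scaleR_blinfun.rep_eq)

lemma C1_add: "C1 f f' \<Longrightarrow> C1 h h' \<Longrightarrow> C1 (\<lambda>x. f x + h x) (\<lambda>x. f' x + h' x)"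
  unfolding C1_def by (auto intro!: has_derivative_add continuous_intros simp: plus_blinfun.rep_eq)

lemma C1_diff: "C1 f f' \<Longrightarrow> C1 h h' \<Longrightarrow> C1 (\<lambda>x. f x - h x) (\<lambda>x. f' x - h' x)"
  unfolding C1_def by (auto intro!: has_derivative_diff continuous_intros simp: minus_blinfun.rep_eq)

lemma C1_scaleR:
  fixes \<eta> :: "'a::euclidean_space \<Rightarrow> real" and \<phi> :: "'a \<Rightarrow> 'b::real_normed_vector"
  assumes "C1 \<eta> \<eta>'" "C1 \<phi> \<phi>'"
  shows "C1 (\<lambda>x. \<eta> x *\<^sub>R \<phi> x) (\<lambda>x. \<eta> x *\<^sub>R \<phi>' x + (blinfun_scaleR_left (\<phi> x) o\<^sub>L \<eta>' x))"
  unfolding C1_def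
proof (intro conjI allI)
  fix x
  have "((\<lambda>x. \<eta> x *\<^sub>R \<phi> x) has_derivative (\<lambda>h. \<eta> x *\<^sub>R \<phi>' x h + \<eta>' x h *\<^sub>R \<phi> x)) (at x)"
    using assms unfolding C1_def by (intro has_derivative_scaleR) auto
  then show "((\<lambda>x. \<eta> x *\<^sub>R \<phi> x) has_derivative
      blinfun_apply (\<eta> x *\<^sub>R \<phi>' x + (blinfun_scaleR_left (\<phi> x) o\<^sub>L \<eta>' x))) (at x)"
    by (simp add: plus_blinfun.rep_eq scaleR_blinfun.rep_eq)
next
  show "continuous_on UNIV (\<lambda>x. \<eta> x *\<^sub>R \<phi>' x + (blinfun_scaleR_left (\<phi> x) o\<^sub>L \<eta>' x))"
    using assms C1_continuous_on[OF assms(1)] C1_continuous_on[OF assms(2)] unfolding C1_def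
    by (auto intro!: continuous_intros)
qed

lemma C1_compose_real:
  fixes f :: "'a::euclidean_space \<Rightarrow> real" and s :: "real \<Rightarrow> real"
  assumes "C1 f f'" "\<And>t. (s has_real_derivative s' t) (at t)" "continuous_on UNIV s'"
  shows "C1 (\<lambda>x. s (f x)) (\<lambda>x. s' (f x) *\<^sub>R f' x)"
  unfolding C1_def
proof (intro conjI allI)
  fix x
  have "((\<lambda>x. s (f x)) has_derivative (\<lambda>h. s' (f x) * f' x h)) (at x)"
    using has_derivative_compose[of f "f' x" x UNIV s "\<lambda>h. s' (f x) * h"] assms(1) assms(2)[of "f x"]
    unfolding C1_def has_field_derivative_def by blast
  then show "((\<lambda>x. s (f x)) has_derivative blinfun_apply (s' (f x) *\<^sub>R f' x)) (at x)"
    by (simp add: scaleR_blinfun.rep_eq)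
next
  have "continuous_on UNIV (\<lambda>x. s' (f x))"
    using continuous_on_compose2[OF assms(3) C1_continuous_on[OF assms(1), of UNIV]] by auto
  then show "continuous_on UNIV (\<lambda>x. s' (f x) *\<^sub>R f' x)"
    using assms(1) unfolding C1_def by (auto intro!: continuous_intros)
qed

lemma C1_shift:
  fixes f :: "'a::euclidean_space \<Rightarrow> 'b::real_normed_vector"
  assumes "C1 f f'"
  shows "C1 (\<lambda>x. f (t + c *\<^sub>R x)) (\<lambda>x. c *\<^sub>R f' (t + c *\<^sub>R x))"
  unfolding C1_def
proof (intro conjI allI)
  fix x
  have "((\<lambda>x. f (t + c *\<^sub>R x)) has_derivative (\<lambda>h. f' (t + c *\<^sub>R x) (c *\<^sub>R h))) (at x)"
    using assms unfolding C1_def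
    by (intro has_derivative_compose[of "\<lambda>x. t + c *\<^sub>R x" _ x UNIV f]) (auto intro!: derivative_eq_intros)
  then show "((\<lambda>x. f (t + c *\<^sub>R x)) has_derivative blinfun_apply (c *\<^sub>R f' (t + c *\<^sub>R x))) (at x)"
    by (simp add: scaleR_blinfun.rep_eq blinfun.scaleR_right)
next
  have "continuous_on UNIV f'" using assms C1_def by blast
  then have "continuous_on UNIV (\<lambda>x. f' (t + c *\<^sub>R x))"
    by (rule continuous_on_compose2) (auto intro!: continuous_intros)
  then show "continuous_on UNIV (\<lambda>x. c *\<^sub>R f' (t + c *\<^sub>R x))"
    by (auto intro!: continuous_intros)
qed

lemma C1_inner_self: "C1 (\<lambda>x::'a::euclidean_space. x \<bullet> x) (\<lambda>x. 2 *\<^sub>R blinfun_inner_right x)"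
  unfolding C1_def by (auto intro!: derivative_eq_intros continuous_intros simp: scaleR_blinfun.rep_eq inner_commute)

lemma C1_inner_const: "C1 (\<lambda>x::'a::euclidean_space. e \<bullet> x) (\<lambda>x. blinfun_inner_right e)"
  unfolding C1_def by (auto intro!: derivative_eq_intros continuous_intros)

section \<open>A quadratic step function and a smooth radius\<close>

text \<open>
  Three squared positive parts glue the parabolas \<open>2 * s\<^sup>2\<close> and \<open>1 - 2 * (1 - s)\<^sup>2\<close> at \<open>s = 1/2\<close>. The
  result is \<open>0\<close> for \<open>s \<le> 0\<close> and \<open>1\<close> for \<open>s \<ge> 1\<close>, and its derivative takes values between \<open>0\<close> and \<open>2\<close>.
\<close>

definition smooth_step :: "real \<Rightarrow> real" where
  "smooth_step s = 2 * (max 0 s)\<^sup>2 - 4 * (max 0 (s - 1/2))\<^sup>2 + 2 * (max 0 (s - 1))\<^sup>2"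

definition smooth_step' :: "real \<Rightarrow> real" where
  "smooth_step' s = 4 * max 0 s - 8 * max 0 (s - 1/2) + 4 * max 0 (s - 1)"

lemma pos_part_square_derivative: "((\<lambda>s::real. (max 0 (s - c))\<^sup>2) has_real_derivative 2 * max 0 (s - c)) (at s)"
proof -
  consider "s < c" | "s > c" | "s = c" by linarith
  then show ?thesis
  proof cases
    case 1
    have "((\<lambda>s::real. 0) has_real_derivative 2 * max 0 (s - c)) (at s)" using 1 by simp
    then show ?thesis
      by (rule has_field_derivative_transform_within_open[where S="{..<c}"]) (use 1 in auto)
  next
    case 2
    have "((\<lambda>s::real. (s - c)\<^sup>2) has_real_derivative 2 * max 0 (s - c)) (at s)"
      using 2 by (auto intro!: derivative_eq_intros)
    then show ?thesis
      by (rule has_field_derivative_transform_within_open[where S="{c<..}"]) (use 2 in auto)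
  next
    case 3
    have "((\<lambda>h. (max 0 (c + h - c))\<^sup>2 / h) \<longlongrightarrow> 0) (at 0)"
    proof (rule Lim_null_comparison)
      show "\<forall>\<^sub>F h in at 0. norm ((max 0 (c + h - c))\<^sup>2 / h) \<le> \<bar>h\<bar>"
        by (rule always_eventually) (auto simp: max_def power2_eq_square)
    qed (auto intro!: tendsto_eq_intros)
    then show ?thesis using 3 by (simp add: has_field_derivative_def DERIV_def field_has_derivative_at)
  qed
qed

lemma smooth_step_derivative: "(smooth_step has_real_derivative smooth_step' s) (at s)"
proof -
  have "((\<lambda>s. 2 * (max 0 (s - 0))\<^sup>2 - 4 * (max 0 (s - 1/2))\<^sup>2 + 2 * (max 0 (s - 1))\<^sup>2)
    has_real_derivative 2 * (2 * max 0 (s - 0)) - 4 * (2 * max 0 (s - 1/2)) + 2 * (2 * max 0 (s - 1))) (at s)"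
    by (intro DERIV_add DERIV_diff DERIV_cmult pos_part_square_derivative)
  then show ?thesis by (simp add: smooth_step_def[abs_def] smooth_step'_def)
qed

lemma continuous_smooth_step': "continuous_on S smooth_step'"
  unfolding smooth_step'_def[abs_def] by (intro continuous_intros)

lemma smooth_step_bounds: "0 \<le> smooth_step s" "smooth_step s \<le> 1"
proof -
  have *: "s \<le> 0 \<or> (0 \<le> s \<and> s \<le> 1/2) \<or> (1/2 \<le> s \<and> s \<le> 1) \<or> 1 \<le> s" by linarith
  have 1: "0 \<le> s \<Longrightarrow> s \<le> 1/2 \<Longrightarrow> smooth_step s = 2 * s\<^sup>2" by (auto simp: smooth_step_def max_def)
  have 2: "1/2 \<le> s \<Longrightarrow> s \<le> 1 \<Longrightarrow> smooth_step s = 1 - 2 * (1 - s)\<^sup>2"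
    by (auto simp: smooth_step_def max_def power2_eq_square algebra_simps)
  have 3: "1 \<le> s \<Longrightarrow> smooth_step s = 1" by (auto simp: smooth_step_def max_def power2_eq_square algebra_simps)
  have 4: "s \<le> 0 \<Longrightarrow> smooth_step s = 0" by (auto simp: smooth_step_def)
  have 5: "s\<^sup>2 \<le> (1/2)\<^sup>2" if "0 \<le> s" "s \<le> 1/2" using that by (intro power_mono) auto
  have 6: "(1-s)\<^sup>2 \<le> (1/2)\<^sup>2" if "1/2 \<le> s" "s \<le> 1" using that by (intro power_mono) auto
  show "0 \<le> smooth_step s" using * 1 2 3 4 6 by (auto simp: power2_eq_square)
  show "smooth_step s \<le> 1" using * 1 2 3 4 5 by (auto simp: power2_eq_square)
qed

lemma smooth_step_0: "s \<le> 0 \<Longrightarrow> smooth_step s = 0"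
  by (simp add: smooth_step_def)

lemma smooth_step_1: "s \<ge> 1 \<Longrightarrow> smooth_step s = 1"
  by (auto simp: smooth_step_def max_def power2_eq_square algebra_simps)

lemma smooth_step'_0: "s \<le> 0 \<or> s \<ge> 1 \<Longrightarrow> smooth_step' s = 0"
  by (auto simp: smooth_step'_def max_def)

lemma smooth_step'_bounds: "0 \<le> smooth_step' s" "smooth_step' s \<le> 2"
  by (auto simp: smooth_step'_def max_def)

text \<open>
  A replacement for the norm that is differentiable at the origin as well and whose sublevel sets are
  the balls around the origin.
\<close>

definition soft_norm :: "'a::euclidean_space \<Rightarrow> real" where
  "soft_norm x = sqrt (1 + x \<bullet> x)"

definition soft_norm' :: "'a::euclidean_space \<Rightarrow> 'a \<Rightarrow>\<^sub>L real" where
  "soft_norm' x = (1 / soft_norm x) *\<^sub>R blinfun_inner_right x"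

lemma soft_norm_ge_1: "soft_norm x \<ge> 1"
  by (simp add: soft_norm_def)

lemma norm_le_soft_norm: "norm x \<le> soft_norm x"
  by (auto simp: soft_norm_def norm_eq_sqrt_inner)

lemma soft_norm_le: "soft_norm x \<le> 1 + norm x"
  unfolding soft_norm_def by (rule real_le_lsqrt) (auto simp: power2_eq_square algebra_simps dot_square_norm)

lemma continuous_soft_norm: "continuous_on S soft_norm"
  unfolding soft_norm_def by (intro continuous_intros)

lemma C1_soft_norm: "C1 soft_norm (soft_norm' :: 'a::euclidean_space \<Rightarrow> _)"
  unfolding C1_def
proof (intro conjI allI)
  fix x :: 'a
  have "0 < 1 + x \<bullet> x" using inner_ge_zero[of x] by linarith
  then show "(soft_norm has_derivative blinfun_apply (soft_norm' x)) (at x)"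
    unfolding soft_norm_def[abs_def] soft_norm'_def
    by (auto intro!: derivative_eq_intros simp: scaleR_blinfun.rep_eq inner_commute field_simps)
next
  have "soft_norm (x::'a) \<noteq> 0" for x using soft_norm_ge_1[of x] by linarith
  then show "continuous_on UNIV (soft_norm' :: 'a \<Rightarrow> _)"
    unfolding soft_norm'_def[abs_def] by (intro continuous_intros continuous_soft_norm) auto
qed

lemma norm_soft_norm': "norm (soft_norm' x) \<le> 1"
proof -
  have "norm (soft_norm' x v) \<le> 1 * norm v" for v
  proof -
    have "norm (x \<bullet> v) \<le> soft_norm x * norm v"
      using Cauchy_Schwarz_ineq2[of x v] mult_right_mono[OF norm_le_soft_norm[of x] norm_ge_zero[of v]] by simp
    then show ?thesis using soft_norm_ge_1[of x]
      by (simp add: soft_norm'_def scaleR_blinfun.rep_eq divide_simps abs_mult mult.commute)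
  qed
  then show ?thesis by (intro norm_blinfun_bound) auto
qed

lemma bounded_soft_norm_less: "bounded {x::'a::euclidean_space. soft_norm x < r}"
  by (rule bounded_subset[OF bounded_cball[of 0 "r"]]) (auto intro: order.trans[OF norm_le_soft_norm less_imp_le])

lemma negligible_soft_norm_level: "negligible {x::'a::euclidean_space. soft_norm x = t}"
proof (rule negligible_subset[OF negligible_sphere[of 0 "sqrt (t\<^sup>2 - 1)"]])
  show "{x::'a. soft_norm x = t} \<subseteq> sphere 0 (sqrt (t\<^sup>2 - 1))"
    by (auto simp: soft_norm_def norm_eq_sqrt_inner real_sqrt_pow2)
qed

section \<open>Affine changes of variables\<close>

lemma lebesgue_affine:
  fixes t :: "'a::euclidean_space"
  assumes "c \<noteq> 0"
  shows "lebesgue = density (distr lebesgue lebesgue (\<lambda>x. t + c *\<^sub>R x)) (\<lambda>_. \<bar>c\<bar>^DIM('a))"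
    and measurable_affine: "(\<lambda>x. t + c *\<^sub>R x) \<in> lebesgue \<rightarrow>\<^sub>M lebesgue"
  using lebesgue_affine_euclidean[where c="\<lambda>_::'a. c" and t=t] lebesgue_affine_measurable[where c="\<lambda>_::'a. c" and t=t] assms
  unfolding scaleR_scaleR[symmetric] scaleR_sum_right[symmetric] euclidean_representation prod_constant by auto

lemma nn_integral_affine:
  fixes f :: "'a::euclidean_space \<Rightarrow> ennreal"
  assumes "f \<in> borel_measurable lebesgue" "c \<noteq> 0"
  shows "(\<integral>\<^sup>+x. f x \<partial>lebesgue) = ennreal (\<bar>c\<bar>^DIM('a)) * (\<integral>\<^sup>+x. f (t + c *\<^sub>R x) \<partial>lebesgue)"
proof -
  note [measurable] = measurable_affine[OF assms(2), of t] assms(1)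
  show ?thesis
    by (subst lebesgue_affine[OF assms(2), of t])
      (simp add: nn_integral_density nn_integral_distr nn_integral_cmult)
qed

lemma integral_affine:
  fixes f :: "'a::euclidean_space \<Rightarrow> real"
  assumes "f \<in> borel_measurable lebesgue" "c \<noteq> 0"
  shows "(\<integral>x. f x \<partial>lebesgue) = \<bar>c\<bar>^DIM('a) * (\<integral>x. f (t + c *\<^sub>R x) \<partial>lebesgue)"
proof -
  note [measurable] = measurable_affine[OF assms(2), of t] assms(1)
  show ?thesis
    by (subst lebesgue_affine[OF assms(2), of t])
      (simp add: integral_density integral_distr)
qed

lemma affine_image_lebesgue:
  fixes A :: "'a::euclidean_space set"
  assumes "A \<in> sets lebesgue" "c \<noteq> 0"
  shows "(\<lambda>x. t + c *\<^sub>R x) ` A \<in> sets lebesgue"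
proof -
  have "(\<lambda>x. t + c *\<^sub>R x) ` A = (\<lambda>x. (- (1/c) *\<^sub>R t) + (1/c) *\<^sub>R x) -` A \<inter> space lebesgue"
  proof (intro set_eqI iffI)
    fix y assume "y \<in> (\<lambda>x. (- (1/c) *\<^sub>R t) + (1/c) *\<^sub>R x) -` A \<inter> space lebesgue"
    then have "(1/c) *\<^sub>R (y - t) \<in> A" by (simp add: algebra_simps)
    then show "y \<in> (\<lambda>x. t + c *\<^sub>R x) ` A"
      by (rule rev_image_eqI) (use assms in \<open>simp add: algebra_simps\<close>)
  qed (use assms(2) in \<open>auto simp: algebra_simps\<close>)
  then show ?thesis
    using measurable_sets[OF measurable_affine[of "1/c" "- (1/c) *\<^sub>R t"] assms(1)] assms(2) by simp
qed

lemma indicator_affine_image: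
  fixes A :: "'a::euclidean_space set"
  assumes "c \<noteq> 0"
  shows "indicator ((\<lambda>x. t + c *\<^sub>R x) ` A) (t + c *\<^sub>R x) = indicator A x"
  using assms by (auto simp: indicator_def)

lemma continuous_compact_support_integrable:
  fixes f :: "'a::euclidean_space \<Rightarrow> real"
  assumes "continuous_on UNIV f" "\<And>x. x \<notin> cball 0 R \<Longrightarrow> f x = 0"
  shows "integrable lebesgue f"
proof -
  have "integrable lborel (\<lambda>x. indicator (cball 0 R) x *\<^sub>R f x)"
    by (intro borel_integrable_compact continuous_on_subset[OF assms(1)]) auto
  also have "(\<lambda>x. indicator (cball 0 R) x *\<^sub>R f x) = f"
    using assms(2) by (intro ext) (auto simp: indicator_def)
  finally show ?thesis by (simp add: integrable_completion borel_measurable_integrable)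
qed

lemma continuous_compact_support_bounded:
  fixes f :: "'a::euclidean_space \<Rightarrow> 'b::real_normed_vector"
  assumes "continuous_on UNIV f" "\<And>x. x \<notin> cball 0 R \<Longrightarrow> f x = 0"
  obtains M where "M \<ge> 0" "\<And>x. norm (f x) \<le> M"
proof -
  have "bounded (f ` cball 0 R)"
    by (intro compact_imp_bounded compact_continuous_image continuous_on_subset[OF assms(1)]) auto
  then obtain M where M: "\<And>x. x \<in> cball 0 R \<Longrightarrow> norm (f x) \<le> M" unfolding bounded_iff by blast
  have "norm (f x) \<le> \<bar>M\<bar>" for x using M[of x] assms(2)[of x] by (cases "x \<in> cball 0 R") auto
  then show ?thesis using that[of "\<bar>M\<bar>"] by simp
qed

text \<open>
  Compact support enters everywhere in the form "zero outside a ball around the origin"; the complement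
  of a closed ball is open, so the derivative vanishes there too.
\<close>

lemma C1_zero_derivative:
  assumes "C1 f f'" "\<And>x. x \<notin> cball 0 R \<Longrightarrow> f x = 0" "x \<notin> cball 0 R"
  shows "f' x = 0"
proof -
  have "((\<lambda>_. 0) has_derivative (\<lambda>_. 0)) (at x)" by simp
  then have "(f has_derivative (\<lambda>_. 0)) (at x)"
    by (rule has_derivative_transform_within_open[where s="- cball 0 R"]) (use assms(2,3) in \<open>auto\<close>)
  moreover have "(f has_derivative blinfun_apply (f' x)) (at x)" using assms(1) C1_def by blast
  ultimately have "blinfun_apply (f' x) = (\<lambda>_. 0)" by (rule has_derivative_unique[symmetric])
  then show ?thesis by (simp add: blinfun_eqI)
qed

section \<open>Test fields and elementary properties of the perimeter\<close>

lemma divergence_eq: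
  assumes "C1 \<phi> \<phi>'"
  shows "divergence \<phi> x = (\<Sum>b\<in>Basis. \<phi>' x b \<bullet> b)"
proof -
  have "(\<phi> has_derivative blinfun_apply (\<phi>' x)) (at x)" using assms C1_def by blast
  then have "frechet_derivative \<phi> (at x) = blinfun_apply (\<phi>' x)" by (rule frechet_derivative_at[symmetric])
  then show ?thesis by (simp add: divergence_def)
qed

lemma C1_compact_supportI:
  assumes "C1 \<phi> \<phi>'" "\<And>x. x \<notin> cball 0 R \<Longrightarrow> \<phi> x = 0"
  shows "C1_compact_support \<phi>"
proof -
  have "bounded {x. \<phi> x \<noteq> 0}" by (rule bounded_subset[OF bounded_cball[of 0 R]]) (use assms(2) in blast)
  then show ?thesis using assms(1) unfolding C1_compact_support_def C1_def compact_closure by blast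
qed

lemma C1_compact_supportE:
  assumes "C1_compact_support \<phi>"
  obtains \<phi>' R where "C1 \<phi> \<phi>'" "\<And>x. x \<notin> cball 0 R \<Longrightarrow> \<phi> x = 0" "\<And>x. x \<notin> cball 0 R \<Longrightarrow> \<phi>' x = 0" "R > 0"
proof -
  obtain \<phi>' where 1: "C1 \<phi> \<phi>'" and b: "bounded {x. \<phi> x \<noteq> 0}"
    using assms unfolding C1_compact_support_def C1_def compact_closure by blast
  obtain R where "\<forall>x\<in>{x. \<phi> x \<noteq> 0}. norm x \<le> R" using b unfolding bounded_iff by blast
  then have 2: "\<And>x. x \<notin> cball 0 (\<bar>R\<bar>+1) \<Longrightarrow> \<phi> x = 0" by force
  show ?thesis using that[OF 1 2 C1_zero_derivative[OF 1 2]] by force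
qed

lemma divergence_props:
  fixes \<phi> :: "'a::euclidean_space \<Rightarrow> 'a"
  assumes "C1_compact_support \<phi>"
  shows continuous_divergence: "continuous_on UNIV (divergence \<phi>)"
    and integrable_divergence: "integrable lebesgue (divergence \<phi>)"
proof -
  obtain \<phi>' R where *: "C1 \<phi> \<phi>'" "\<And>x. x \<notin> cball 0 R \<Longrightarrow> \<phi>' x = 0"
    using C1_compact_supportE[OF assms] by metis
  have eq: "divergence \<phi> = (\<lambda>x. (\<Sum>b\<in>Basis. \<phi>' x b \<bullet> b))" using divergence_eq[OF *(1)] by auto
  show c: "continuous_on UNIV (divergence \<phi>)"
    using *(1) unfolding eq C1_def by (auto intro!: continuous_intros)
  show "integrable lebesgue (divergence \<phi>)"
    by (rule continuous_compact_support_integrable[OF c, of R]) (auto simp: eq *(2))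
qed

abbreviation flux :: "'a::euclidean_space set \<Rightarrow> ('a \<Rightarrow> 'a) \<Rightarrow> real" where
  "flux A \<phi> \<equiv> set_lebesgue_integral lebesgue A (divergence \<phi>)"

abbreviation test_field :: "('a::euclidean_space \<Rightarrow> 'a) \<Rightarrow> bool" where
  "test_field \<phi> \<equiv> C1_compact_support \<phi> \<and> (\<forall>x. norm (\<phi> x) \<le> 1)"

lemma flux_le_perimeter:
  assumes "perimeter A \<le> ennreal P" "P \<ge> 0" "test_field \<phi>"
  shows "flux A \<phi> \<le> P"
proof -
  have "ennreal (flux A \<phi>) \<le> perimeter A"
    unfolding perimeter_def by (rule SUP_upper) (use assms in auto)
  then have "ennreal (flux A \<phi>) \<le> ennreal P" using assms(1) by order
  then show ?thesis using assms(2) ennreal_le_iff by blast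
qed

lemma perimeter_leI:
  assumes "\<And>\<phi>. test_field \<phi> \<Longrightarrow> flux A \<phi> \<le> P"
  shows "perimeter A \<le> ennreal P"
  unfolding perimeter_def by (rule SUP_least) (use assms in \<open>auto intro!: ennreal_leI\<close>)

text \<open>
  The perimeter is a supremum of fluxes, and each flux is continuous under almost everywhere
  convergence of indicators because the divergence of a test field is integrable.
\<close>

lemma perimeter_lower_semicontinuous:
  fixes A :: "nat \<Rightarrow> 'a::euclidean_space set"
  assumes A: "\<And>n. A n \<in> sets lebesgue" "B \<in> sets lebesgue"
    and conv: "AE x in lebesgue. (\<lambda>n. indicator (A n) x :: real) \<longlonglongrightarrow> indicator B x"
    and P: "\<And>n. perimeter (A n) \<le> ennreal (p n)" "\<And>n. p n \<ge> 0" "p \<longlonglongrightarrow> q"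
  shows "perimeter B \<le> ennreal q"
proof (rule perimeter_leI)
  fix \<phi> :: "'a \<Rightarrow> 'a" assume \<phi>: "test_field \<phi>"
  note int = integrable_divergence[of \<phi>]
  have "(\<lambda>n. flux (A n) \<phi>) \<longlonglongrightarrow> flux B \<phi>"
    unfolding set_lebesgue_integral_def
  proof (rule integral_dominated_convergence[where w="\<lambda>x. \<bar>divergence \<phi> x\<bar>"])
    show "AE x in lebesgue. (\<lambda>n. indicator (A n) x *\<^sub>R divergence \<phi> x) \<longlonglongrightarrow> indicator B x *\<^sub>R divergence \<phi> x"
      using conv by eventually_elim (intro tendsto_intros)
  qed (use int \<phi> A in \<open>auto simp: indicator_def borel_measurable_integrable\<close>)
  then show "flux B \<phi> \<le> q"
    by (rule LIMSEQ_le[OF _ P(3)]) (use flux_le_perimeter[OF P(1,2) \<phi>] in auto)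
qed

lemma perimeter_cong_AE:
  fixes A B :: "'a::euclidean_space set"
  assumes "A \<in> sets lebesgue" "B \<in> sets lebesgue" "AE x in lebesgue. x \<in> A \<longleftrightarrow> x \<in> B"
  shows "perimeter A = perimeter B"
proof -
  have "flux A \<phi> = flux B \<phi>" if "test_field \<phi>" for \<phi> :: "'a \<Rightarrow> 'a"
    unfolding set_lebesgue_integral_def
  proof (rule integral_cong_AE)
    show "AE x in lebesgue. indicator A x *\<^sub>R divergence \<phi> x = indicator B x *\<^sub>R divergence \<phi> x"
      using assms(3) by eventually_elim (auto simp: indicator_def)
  qed (use assms borel_measurable_integrable[OF integrable_divergence[of \<phi>]] that in auto)
  then show ?thesis unfolding perimeter_def by (intro SUP_cong) auto
qed

lemma test_field_affine:
  assumes "test_field \<phi>" "c \<noteq> 0"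
  shows "test_field (\<lambda>x. \<phi> (t + c *\<^sub>R x))"
    and "divergence (\<lambda>x. \<phi> (t + c *\<^sub>R x)) x = c * divergence \<phi> (t + c *\<^sub>R x)"
proof -
  obtain \<phi>' R where *: "C1 \<phi> \<phi>'" "\<And>x. x \<notin> cball 0 R \<Longrightarrow> \<phi> x = 0"
    using C1_compact_supportE assms(1) by metis
  note C = C1_shift[OF *(1), of t c]
  have "\<phi> (t + c *\<^sub>R x) = 0" if "x \<notin> cball 0 ((R + norm t) / \<bar>c\<bar>)" for x
  proof (rule *(2))
    have "norm (c *\<^sub>R x) > R + norm t" using that assms(2) by (auto simp: divide_simps mult.commute)
    then have "norm (t + c *\<^sub>R x) > R" using norm_triangle_ineq2[of "c *\<^sub>R x" "-t"] by (simp add: add.commute)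
    then show "t + c *\<^sub>R x \<notin> cball 0 R" by auto
  qed
  then have "C1_compact_support (\<lambda>x. \<phi> (t + c *\<^sub>R x))" by (rule C1_compact_supportI[OF C])
  then show "test_field (\<lambda>x. \<phi> (t + c *\<^sub>R x))" using assms(1) by simp
  show "divergence (\<lambda>x. \<phi> (t + c *\<^sub>R x)) x = c * divergence \<phi> (t + c *\<^sub>R x)"
    unfolding divergence_eq[OF *(1)] divergence_eq[OF C]
    by (simp add: scaleR_blinfun.rep_eq sum_distrib_left)
qed

text \<open>
  A field on the image pulls back to a test field on the original set. The change of variables
  contributes a factor \<open>c ^ DIM('a)\<close>, and the chain rule takes one factor back.
\<close>

lemma perimeter_affine_le:
  fixes A :: "'a::euclidean_space set"
  assumes "A \<in> sets lebesgue" "c > 0" "perimeter A \<le> ennreal P" "P \<ge> 0"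
  shows "perimeter ((\<lambda>x. t + c *\<^sub>R x) ` A) \<le> ennreal (c ^ (DIM('a) - 1) * P)"
proof (rule perimeter_leI)
  fix \<phi> :: "'a \<Rightarrow> 'a" assume \<phi>: "test_field \<phi>"
  let ?T = "\<lambda>x. t + c *\<^sub>R x"
  have c: "c \<noteq> 0" using assms by simp
  have "c ^ DIM('a) = c * c ^ (DIM('a) - 1)"
    by (metis DIM_positive Suc_pred' power_Suc)
  note T = test_field_affine[OF \<phi> c, of t]
  have "flux (?T ` A) \<phi> = \<bar>c\<bar>^DIM('a) * (\<integral>x. indicator (?T ` A) (?T x) *\<^sub>R divergence \<phi> (?T x) \<partial>lebesgue)"
    unfolding set_lebesgue_integral_def
    using borel_measurable_integrable[OF integrable_divergence[of \<phi>]] affine_image_lebesgue[OF assms(1) c] \<phi>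
    by (intro integral_affine c) auto
  also have "\<dots> = \<bar>c\<bar>^DIM('a) * (1 / c) * flux A (\<lambda>x. \<phi> (?T x))"
  proof -
    have "flux A (\<lambda>x. \<phi> (?T x)) = (\<integral>x. c * (indicator A x * divergence \<phi> (?T x)) \<partial>lebesgue)"
      unfolding set_lebesgue_integral_def T(2) by (simp add: mult_ac)
    then show ?thesis
      using c unfolding set_lebesgue_integral_def indicator_affine_image[OF c] by simp
  qed
  also have "\<dots> = c ^ (DIM('a) - 1) * flux A (\<lambda>x. \<phi> (?T x))"
    using assms(2) \<open>c ^ DIM('a) = _\<close> by simp
  also have "\<dots> \<le> c ^ (DIM('a) - 1) * P"
    using flux_le_perimeter[OF assms(3,4) T(1)] assms(2) by simp
  finally show "flux (?T ` A) \<phi> \<le> c ^ (DIM('a) - 1) * P" .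
qed

section \<open>Differentiation along translations\<close>

lemma C1_lipschitz:
  assumes "C1 f f'" "\<And>x. norm (f' x) \<le> M"
  shows "norm (f x - f y) \<le> M * norm (x - y)"
proof (rule differentiable_bound[of UNIV f "\<lambda>x. blinfun_apply (f' x)"])
  show "onorm (blinfun_apply (f' x)) \<le> M" for x using assms(2)[of x] by (simp add: norm_blinfun.rep_eq)
qed (use assms(1) in \<open>auto simp: C1_def\<close>)

text \<open>
  The difference quotients of \<open>f\<close> along \<open>e\<close> converge pointwise, are bounded by the Lipschitz constant
  of \<open>f\<close>, and vanish outside a fixed ball as long as the increments stay bounded.
\<close>

lemma translation_derivative:
  fixes f :: "'a::euclidean_space \<Rightarrow> real"
  assumes f: "C1 f f'" "\<And>x. x \<notin> cball 0 R \<Longrightarrow> f x = 0" and A: "A \<in> sets lebesgue"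
  shows "((\<lambda>t. LINT x:A|lebesgue. f (x + t *\<^sub>R e)) has_real_derivative
          (LINT x:A|lebesgue. f' (x + t *\<^sub>R e) e)) (at t)"
proof -
  have f'0: "f' x = 0" if "x \<notin> cball 0 R" for x
    using C1_zero_derivative[OF f(1) _ that] f(2) by blast
  have cf: "continuous_on UNIV f" using C1_continuous_on[OF f(1)] .
  have cf': "continuous_on UNIV f'" using f(1) C1_def by blast
  obtain M where M: "M \<ge> 0" "\<And>x. norm (f' x) \<le> M"
    using continuous_compact_support_bounded[OF cf', of R] f'0 by metis
  have outside: "x + s *\<^sub>R e \<notin> cball 0 R" if "x \<notin> cball 0 (R + k * norm e)" "\<bar>s\<bar> \<le> k" for x s k
  proof -
    have "norm (s *\<^sub>R e) \<le> k * norm e" using that(2) by (simp add: mult_right_mono)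
    then show ?thesis using that(1) norm_triangle_ineq2[of x "- s *\<^sub>R e"] by simp
  qed
  have cs: "continuous_on UNIV (\<lambda>x. f (x + s *\<^sub>R e))" for s
    by (intro continuous_on_compose2[OF cf] continuous_intros) auto
  have cs': "continuous_on UNIV (\<lambda>x. f' (x + s *\<^sub>R e) e)" for s
    by (intro continuous_intros continuous_on_compose2[OF cf']) auto
  have int: "integrable lebesgue (\<lambda>x. f (x + s *\<^sub>R e))" for s
    by (rule continuous_compact_support_integrable[OF cs, where R="R + \<bar>s\<bar> * norm e"]) (use f(2) outside[of _ "\<bar>s\<bar>" s] in blast)
  have int': "integrable lebesgue (\<lambda>x. f' (x + s *\<^sub>R e) e)" for s
    using f'0 outside
    by (intro continuous_compact_support_integrable[OF cs', where R="R + \<bar>s\<bar> * norm e"]) force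
  let ?G = "\<lambda>t. LINT x:A|lebesgue. f (x + t *\<^sub>R e)"
  have "(\<lambda>h. (?G (t + h) - ?G t) / h) \<midarrow>0\<rightarrow> (LINT x:A|lebesgue. f' (x + t *\<^sub>R e) e)"
    unfolding tendsto_at_iff_sequentially
  proof (intro allI impI)
    fix X :: "nat \<Rightarrow> real" assume X: "\<forall>i. X i \<in> UNIV - {0}" "X \<longlonglongrightarrow> 0"
    obtain K where K: "\<And>n. \<bar>X n\<bar> \<le> K" using Bseq_conv_Bfun[THEN iffD1] convergent_imp_Bseq[of X] X(2)
      by (metis BseqE convergentI real_norm_def)
    define q where "q n x = (f (x + (t + X n) *\<^sub>R e) - f (x + t *\<^sub>R e)) / X n" for n x
    let ?R = "R + (\<bar>t\<bar> + K) * norm e"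
    have eq: "(?G (t + X n) - ?G t) / X n = (\<integral>x. indicator A x * q n x \<partial>lebesgue)" for n
    proof -
      have "?G (t + X n) - ?G t = (\<integral>x. indicator A x * f (x + (t + X n) *\<^sub>R e) - indicator A x * f (x + t *\<^sub>R e) \<partial>lebesgue)"
        unfolding set_lebesgue_integral_def using integrable_mult_indicator[OF A int]
        by (subst Bochner_Integration.integral_diff) auto
      then show ?thesis by (simp add: q_def diff_divide_distrib right_diff_distrib flip: integral_divide_zero)
    qed
    have "(\<lambda>n. \<integral>x. indicator A x * q n x \<partial>lebesgue) \<longlonglongrightarrow> (\<integral>x. indicator A x * f' (x + t *\<^sub>R e) e \<partial>lebesgue)"
    proof (rule integral_dominated_convergence[where w="\<lambda>x. indicator (cball 0 ?R) x * (M * norm e)"])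
      show "AE x in lebesgue. (\<lambda>n. indicator A x * q n x) \<longlonglongrightarrow> indicator A x * f' (x + t *\<^sub>R e) e"
      proof (intro always_eventually allI tendsto_intros)
        fix x
        have "((\<lambda>h. f (x + t *\<^sub>R e + h *\<^sub>R e)) has_derivative (\<lambda>h. f' (x + t *\<^sub>R e) (h *\<^sub>R e))) (at 0)"
        proof (rule has_derivative_compose[of "\<lambda>h. x + t *\<^sub>R e + h *\<^sub>R e" _ 0 UNIV f])
          show "((\<lambda>h. x + t *\<^sub>R e + h *\<^sub>R e) has_derivative (\<lambda>h. h *\<^sub>R e)) (at 0)"
            by (auto intro!: derivative_eq_intros)
          show "(f has_derivative blinfun_apply (f' (x + t *\<^sub>R e))) (at (x + t *\<^sub>R e + 0 *\<^sub>R e))"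
            using f(1) by (simp add: C1_def)
        qed
        then have "((\<lambda>h. f (x + t *\<^sub>R e + h *\<^sub>R e)) has_real_derivative f' (x + t *\<^sub>R e) e) (at 0)"
          unfolding has_field_derivative_def by (simp add: blinfun.scaleR_right mult_commute_abs)
        then have "(\<lambda>h. (f (x + t *\<^sub>R e + h *\<^sub>R e) - f (x + t *\<^sub>R e)) / h) \<midarrow>0\<rightarrow> f' (x + t *\<^sub>R e) e"
          by (simp add: DERIV_def)
        then have "(\<lambda>n. (f (x + t *\<^sub>R e + X n *\<^sub>R e) - f (x + t *\<^sub>R e)) / X n) \<longlonglongrightarrow> f' (x + t *\<^sub>R e) e"
          using X unfolding tendsto_at_iff_sequentially comp_def by blast
        then show "(\<lambda>n. q n x) \<longlonglongrightarrow> f' (x + t *\<^sub>R e) e"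
          by (simp add: q_def scaleR_add_left add.assoc)
      qed
      show "AE x in lebesgue. norm (indicator A x * q n x) \<le> indicator (cball 0 ?R) x * (M * norm e)" for n
      proof (intro always_eventually allI)
        fix x
        have "\<bar>q n x\<bar> \<le> indicator (cball 0 ?R) x * (M * norm e)"
        proof (cases "x \<in> cball 0 ?R")
          case True
          have "\<bar>f (x + (t + X n) *\<^sub>R e) - f (x + t *\<^sub>R e)\<bar> \<le> M * norm ((x + (t + X n) *\<^sub>R e) - (x + t *\<^sub>R e))"
            by (rule C1_lipschitz[OF f(1) M(2), unfolded real_norm_def])
          also have "\<dots> = (M * norm e) * \<bar>X n\<bar>" by (simp add: scaleR_add_left)
          finally show ?thesis using True X(1) by (simp add: q_def divide_simps)
        next
          case False
          have "\<bar>t + X n\<bar> \<le> \<bar>t\<bar> + K" "\<bar>t\<bar> \<le> \<bar>t\<bar> + K" using K[of n] by auto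
          then show ?thesis using f(2)[OF outside[OF False]] False by (simp add: q_def)
        qed
        then show "norm (indicator A x * q n x) \<le> indicator (cball 0 ?R) x * (M * norm e)"
          by (auto simp: indicator_def)
      qed
      have "emeasure lebesgue (cball 0 ?R :: 'a set) < \<infinity>" using emeasure_lborel_cball_finite[of 0 ?R] by simp
      then show "integrable lebesgue (\<lambda>x::'a. indicator (cball 0 ?R) x * (M * norm e))"
        by (intro integrable_mult_left integrable_real_indicator) auto
      show "(\<lambda>x. indicator A x * q n x) \<in> borel_measurable lebesgue" for n
        unfolding q_def using borel_measurable_integrable[OF int] A by auto
      show "(\<lambda>x. indicator A x * f' (x + t *\<^sub>R e) e) \<in> borel_measurable lebesgue"
        using borel_measurable_integrable[OF int'] A by auto
    qed
    then show "((\<lambda>h. (?G (t + h) - ?G t) / h) \<circ> X) \<longlonglongrightarrow> (LINT x:A|lebesgue. f' (x + t *\<^sub>R e) e)"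
      unfolding comp_def eq by (simp add: set_lebesgue_integral_def)
  qed
  then show ?thesis by (simp add: DERIV_def)
qed

text \<open>
  The integral of a translate of \<open>f\<close> does not depend on the translation. Applied to the components of a
  test field, this makes the perimeter of the whole space vanish.
\<close>

lemma integral_C1_derivative_eq_0:
  fixes f :: "'a::euclidean_space \<Rightarrow> real"
  assumes f: "C1 f f'" "\<And>x. x \<notin> cball 0 R \<Longrightarrow> f x = 0"
  shows "(\<integral>x. f' x e \<partial>lebesgue) = 0"
proof -
  let ?G = "\<lambda>t. LINT x:UNIV|lebesgue. f (x + t *\<^sub>R e)"
  have m: "f \<in> borel_measurable lebesgue"
    using continuous_compact_support_integrable[OF C1_continuous_on[OF f(1)] f(2)] by auto
  have "?G t = (\<integral>x. f x \<partial>lebesgue)" for t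
    using integral_affine[OF m, of 1 "t *\<^sub>R e"] by (simp add: set_lebesgue_integral_def add.commute)
  then have "((\<lambda>t. \<integral>x. f x \<partial>lebesgue) has_real_derivative (LINT x:UNIV|lebesgue. f' (x + 0 *\<^sub>R e) e)) (at 0)"
    using translation_derivative[OF f, where A=UNIV and e=e and t=0] by simp
  then show ?thesis
    using DERIV_unique[OF _ DERIV_const] by (simp add: set_lebesgue_integral_def)
qed

lemma C1_inner_left:
  assumes "C1 \<phi> \<phi>'"
  shows "C1 (\<lambda>x. \<phi> x \<bullet> b) (\<lambda>x. blinfun_inner_left b o\<^sub>L \<phi>' x)"
  unfolding C1_def
proof (intro conjI allI)
  show "((\<lambda>x. \<phi> x \<bullet> b) has_derivative blinfun_apply (blinfun_inner_left b o\<^sub>L \<phi>' x)) (at x)" for x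
    using assms unfolding C1_def by (auto intro!: derivative_eq_intros)
  show "continuous_on UNIV (\<lambda>x. blinfun_inner_left b o\<^sub>L \<phi>' x)"
    using assms unfolding C1_def by (auto intro!: continuous_intros)
qed

lemma perimeter_UNIV: "perimeter (UNIV :: 'a::euclidean_space set) = 0"
proof -
  have "flux UNIV \<phi> \<le> 0" if \<phi>: "test_field \<phi>" for \<phi> :: "'a \<Rightarrow> 'a"
  proof -
    obtain \<phi>' R where *: "C1 \<phi> \<phi>'" "\<And>x. x \<notin> cball 0 R \<Longrightarrow> \<phi> x = 0" "\<And>x. x \<notin> cball 0 R \<Longrightarrow> \<phi>' x = 0" "R > 0"
      by (rule C1_compact_supportE[OF conjunct1[OF \<phi>]]) (rule that)
    have c: "continuous_on UNIV (\<lambda>x. \<phi>' x b \<bullet> b)" for b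
      using *(1) unfolding C1_def by (intro continuous_intros) blast
    have int: "integrable lebesgue (\<lambda>x. \<phi>' x b \<bullet> b)" for b
      by (rule continuous_compact_support_integrable[OF c, of R]) (simp add: *(3))
    have "(\<integral>x. (blinfun_inner_left b o\<^sub>L \<phi>' x) b \<partial>lebesgue) = 0" for b
      by (rule integral_C1_derivative_eq_0[OF C1_inner_left[OF *(1)], of R b b]) (simp add: *(2))
    then have "(\<integral>x. \<phi>' x b \<bullet> b \<partial>lebesgue) = 0" for b by simp
    then have "flux UNIV \<phi> = 0"
      using int by (simp add: set_lebesgue_integral_def divergence_eq[OF *(1)])
    then show ?thesis by simp
  qed
  then have "perimeter (UNIV :: 'a set) \<le> ennreal 0" by (intro perimeter_leI) auto
  then show ?thesis by simp
qed

lemma test_field_0: "test_field (\<lambda>_::'a::euclidean_space. 0::'a)" "divergence (\<lambda>_::'a::euclidean_space. 0 :: 'a) x = 0"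
  using C1_compact_supportI[OF C1_const, of 0 "0::'a"] by (auto simp: divergence_eq[OF C1_const])

lemma perimeter_empty: "perimeter ({} :: 'a::euclidean_space set) = 0"
  using perimeter_leI[of "{} :: 'a set" 0] by (simp add: set_lebesgue_integral_def)

section \<open>Blending test fields and cutting by spheres\<close>

lemma divergence_scaleR:
  assumes "C1 \<eta> \<eta>'" "C1 \<phi> \<phi>'"
  shows "divergence (\<lambda>x. \<eta> x *\<^sub>R \<phi> x) x = \<eta> x * divergence \<phi> x + \<eta>' x (\<phi> x)"
proof -
  have "\<eta>' x (\<phi> x) = \<eta>' x (\<Sum>b\<in>Basis. (\<phi> x \<bullet> b) *\<^sub>R b)" by (simp add: euclidean_representation)
  also have "\<dots> = (\<Sum>b\<in>Basis. \<eta>' x b * (\<phi> x \<bullet> b))"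
    by (simp add: blinfun.sum_right blinfun.scaleR_right mult.commute)
  finally show ?thesis
    unfolding divergence_eq[OF C1_scaleR[OF assms]] divergence_eq[OF assms(2)]
    by (simp add: plus_blinfun.rep_eq scaleR_blinfun.rep_eq inner_add_left sum.distrib sum_distrib_left)
qed

lemma test_field_blend:
  fixes \<phi> \<psi> :: "'a::euclidean_space \<Rightarrow> 'a"
  assumes \<eta>: "C1 \<eta> \<eta>'" "\<And>x. 0 \<le> \<eta> x" "\<And>x. \<eta> x \<le> 1" and "test_field \<phi>" "test_field \<psi>"
  shows "test_field (\<lambda>x. \<eta> x *\<^sub>R \<phi> x + (1 - \<eta> x) *\<^sub>R \<psi> x)" (is ?A)
    and "divergence (\<lambda>x. \<eta> x *\<^sub>R \<phi> x + (1 - \<eta> x) *\<^sub>R \<psi> x) x =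
      \<eta> x * divergence \<phi> x + (1 - \<eta> x) * divergence \<psi> x + \<eta>' x (\<phi> x - \<psi> x)" (is ?B)
proof -
  obtain \<phi>' R where \<phi>: "C1 \<phi> \<phi>'" "\<And>x. x \<notin> cball 0 R \<Longrightarrow> \<phi> x = 0"
    using C1_compact_supportE assms by metis
  obtain \<psi>' S where \<psi>: "C1 \<psi> \<psi>'" "\<And>x. x \<notin> cball 0 S \<Longrightarrow> \<psi> x = 0"
    using C1_compact_supportE assms by metis
  have \<eta>1: "C1 (\<lambda>x. 1 - \<eta> x) (\<lambda>x. 0 - \<eta>' x)" by (rule C1_diff[OF C1_const \<eta>(1)])
  note 1 = C1_scaleR[OF \<eta>(1) \<phi>(1)]
  note 2 = C1_scaleR[OF \<eta>1 \<psi>(1)]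
  note 3 = C1_add[OF 1 2]
  have "C1_compact_support (\<lambda>x. \<eta> x *\<^sub>R \<phi> x + (1 - \<eta> x) *\<^sub>R \<psi> x)"
    by (rule C1_compact_supportI[OF 3, of "max R S"]) (use \<phi>(2) \<psi>(2) in auto)
  moreover have "norm (\<eta> x *\<^sub>R \<phi> x + (1 - \<eta> x) *\<^sub>R \<psi> x) \<le> 1" for x
  proof -
    have "norm (\<eta> x *\<^sub>R \<phi> x + (1 - \<eta> x) *\<^sub>R \<psi> x) \<le> \<eta> x * norm (\<phi> x) + (1 - \<eta> x) * norm (\<psi> x)"
      using norm_triangle_ineq[of "\<eta> x *\<^sub>R \<phi> x" "(1 - \<eta> x) *\<^sub>R \<psi> x"] \<eta>(2,3)[of x] by simp
    also have "\<dots> \<le> \<eta> x * 1 + (1 - \<eta> x) * 1"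
      using assms(4,5) \<eta>(2,3)[of x] by (intro add_mono mult_left_mono) auto
    finally show ?thesis by simp
  qed
  ultimately show ?A by blast
  have "divergence (\<lambda>x. \<eta> x *\<^sub>R \<phi> x + (1 - \<eta> x) *\<^sub>R \<psi> x) x =
      divergence (\<lambda>x. \<eta> x *\<^sub>R \<phi> x) x + divergence (\<lambda>x. (1 - \<eta> x) *\<^sub>R \<psi> x) x"
    unfolding divergence_eq[OF 1] divergence_eq[OF 2] divergence_eq[OF 3]
    by (simp add: plus_blinfun.rep_eq inner_add_left sum.distrib)
  then show ?B
    unfolding divergence_scaleR[OF \<eta>(1) \<phi>(1)] divergence_scaleR[OF \<eta>1 \<psi>(1)]
    by (simp add: blinfun.diff_right minus_blinfun.rep_eq uminus_blinfun.rep_eq)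
qed

lemma set_integrable_bounded_mult:
  fixes f g :: "'a::euclidean_space \<Rightarrow> real"
  assumes "integrable lebesgue f" "continuous_on UNIV g" "\<And>x. \<bar>g x\<bar> \<le> 1" "A \<in> sets lebesgue"
  shows "integrable lebesgue (\<lambda>x. indicator A x * (g x * f x))"
proof (rule Bochner_Integration.integrable_bound[OF assms(1)])
  have "g \<in> borel_measurable lebesgue"
    using assms(2) by (simp add: borel_measurable_continuous_onI measurable_completion)
  then show "(\<lambda>x. indicator A x * (g x * f x)) \<in> borel_measurable lebesgue" using assms(1,4) by auto
  show "AE x in lebesgue. norm (indicator A x * (g x * f x)) \<le> norm (f x)"
    using assms(3) by (intro always_eventually) (auto simp: indicator_def abs_mult intro: mult_left_le_one_le)
qed

lemma annulus_lmeasurable: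
  fixes A :: "'a::euclidean_space set"
  assumes "A \<in> sets lebesgue"
  shows "A \<inter> {x. soft_norm x < b} \<in> lmeasurable" "A \<inter> {x. a \<le> soft_norm x \<and> soft_norm x < b} \<in> lmeasurable"
    "A - {x. soft_norm x < b} \<in> sets lebesgue"
proof -
  have 1: "{x::'a. soft_norm x < b} = soft_norm -` {..<b}" "{x::'a. a \<le> soft_norm x \<and> soft_norm x < b} = soft_norm -` {a..<b}" by auto
  have m: "soft_norm \<in> borel_measurable (borel :: 'a measure)"
    by (intro borel_measurable_continuous_onI continuous_soft_norm)
  have 2: "{x::'a. soft_norm x < b} \<in> sets lebesgue" "{x::'a. a \<le> soft_norm x \<and> soft_norm x < b} \<in> sets lebesgue"
    unfolding 1 using measurable_sets[OF m, of "{..<b}"] measurable_sets[OF m, of "{a..<b}"] by auto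
  show "A - {x. soft_norm x < b} \<in> sets lebesgue" using 2 assms by auto
  show "A \<inter> {x. soft_norm x < b} \<in> lmeasurable" "A \<inter> {x. a \<le> soft_norm x \<and> soft_norm x < b} \<in> lmeasurable"
    using 2 assms by (auto intro!: bounded_set_imp_lmeasurable intro: bounded_subset[OF bounded_soft_norm_less])
qed

text \<open>
  Smooth weights that converge to an indicator turn weighted fluxes through \<open>A\<close> into the flux through a
  part of \<open>A\<close>. The cuts by spheres and by half-spaces both arise in this way.
\<close>

lemma flux_weighted_tendsto:
  fixes \<phi> :: "'a::euclidean_space \<Rightarrow> 'a"
  assumes A: "A \<in> sets lebesgue" "A \<inter> S \<in> sets lebesgue" and \<phi>: "C1_compact_support \<phi>"
    and w: "\<And>n. continuous_on UNIV (w n)" "\<And>n x. 0 \<le> w n x" "\<And>n x. w n x \<le> 1"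
    and lim: "AE x in lebesgue. (\<lambda>n. w n x) \<longlonglongrightarrow> (indicator S x :: real)"
  shows "(\<lambda>n. \<integral>x. indicator A x * (w n x * divergence \<phi> x) \<partial>lebesgue) \<longlonglongrightarrow> flux (A \<inter> S) \<phi>"
  unfolding set_lebesgue_integral_def
proof (rule integral_dominated_convergence[where w="\<lambda>x. \<bar>divergence \<phi> x\<bar>"])
  note int = integrable_divergence[OF \<phi>]
  show "(\<lambda>x. indicator (A \<inter> S) x *\<^sub>R divergence \<phi> x) \<in> borel_measurable lebesgue"
    using A(2) int by (intro borel_measurable_scaleR borel_measurable_indicator borel_measurable_integrable)
  show "integrable lebesgue (\<lambda>x. \<bar>divergence \<phi> x\<bar>)" using int by (rule integrable_abs)
  show "(\<lambda>x. indicator A x * (w n x * divergence \<phi> x)) \<in> borel_measurable lebesgue" for n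
    using w by (intro borel_measurable_integrable set_integrable_bounded_mult int A(1)) auto
  show "AE x in lebesgue. norm (indicator A x * (w n x * divergence \<phi> x)) \<le> \<bar>divergence \<phi> x\<bar>" for n
    using w by (intro always_eventually) (auto simp: indicator_def abs_mult intro: mult_left_le_one_le)
  show "AE x in lebesgue. (\<lambda>n. indicator A x * (w n x * divergence \<phi> x)) \<longlonglongrightarrow> indicator (A \<inter> S) x *\<^sub>R divergence \<phi> x"
    using lim
  proof eventually_elim
    case (elim x)
    then have "(\<lambda>n. indicator A x * (w n x * divergence \<phi> x)) \<longlonglongrightarrow> indicator A x * (indicator S x * divergence \<phi> x)"
      by (intro tendsto_intros)
    then show ?case by (simp add: indicator_inter_arith mult.assoc)
  qed
qed

text \<open>
  The blended field \<open>\<eta> \<phi> + (1 - \<eta>) \<psi>\<close> is again a test field, and its divergence differs from the blend of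
  the divergences by the derivative of \<open>\<eta>\<close> in direction \<open>\<phi> - \<psi>\<close>.
\<close>

lemma flux_blend_le:
  fixes \<phi> \<psi> :: "'a::euclidean_space \<Rightarrow> 'a"
  assumes A: "A \<in> sets lebesgue" and P: "perimeter A \<le> ennreal P" "P \<ge> 0"
    and \<phi>: "test_field \<phi>" and \<psi>: "test_field \<psi>"
    and \<eta>: "C1 \<eta> \<eta>'" "\<And>x. 0 \<le> \<eta> x" "\<And>x. \<eta> x \<le> 1"
    and h: "\<And>x. - \<eta>' x (\<phi> x - \<psi> x) \<le> h x" "set_integrable lebesgue A h"
  shows "(\<integral>x. indicator A x * (\<eta> x * divergence \<phi> x) \<partial>lebesgue)
     + (\<integral>x. indicator A x * ((1 - \<eta> x) * divergence \<psi> x) \<partial>lebesgue)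
     \<le> P + (LINT x:A|lebesgue. h x)"
proof -
  let ?\<theta> = "\<lambda>x. \<eta> x *\<^sub>R \<phi> x + (1 - \<eta> x) *\<^sub>R \<psi> x"
  have c: "continuous_on UNIV \<eta>" by (rule C1_continuous_on[OF \<eta>(1)])
  have i1: "integrable lebesgue (\<lambda>x. indicator A x * (\<eta> x * divergence \<phi> x))"
    using \<phi> \<eta> A c by (intro set_integrable_bounded_mult integrable_divergence) auto
  have i2: "integrable lebesgue (\<lambda>x. indicator A x * ((1 - \<eta> x) * divergence \<psi> x))"
    using \<psi> \<eta> A c by (intro set_integrable_bounded_mult integrable_divergence continuous_intros) auto
  note T = test_field_blend[OF \<eta> \<phi> \<psi>]
  have i3: "integrable lebesgue (\<lambda>x. indicator A x * divergence ?\<theta> x)"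
    using integrable_mult_indicator[OF A integrable_divergence[of ?\<theta>]] T(1) by simp
  have i4: "integrable lebesgue (\<lambda>x. indicator A x * h x)" using h(2) by (simp add: set_integrable_def)
  have "(\<integral>x. indicator A x * (\<eta> x * divergence \<phi> x) \<partial>lebesgue)
     + (\<integral>x. indicator A x * ((1 - \<eta> x) * divergence \<psi> x) \<partial>lebesgue)
     = (\<integral>x. indicator A x * (\<eta> x * divergence \<phi> x) + indicator A x * ((1 - \<eta> x) * divergence \<psi> x) \<partial>lebesgue)"
    using i1 i2 by simp
  also have "\<dots> \<le> (\<integral>x. indicator A x * divergence ?\<theta> x + indicator A x * h x \<partial>lebesgue)"
  proof (rule integral_mono)
    show "indicator A x * (\<eta> x * divergence \<phi> x) + indicator A x * ((1 - \<eta> x) * divergence \<psi> x)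
        \<le> indicator A x * divergence ?\<theta> x + indicator A x * h x" for x
      unfolding T(2) using h(1)[of x] by (auto simp: indicator_def)
  qed (use i1 i2 i3 i4 in auto)
  also have "\<dots> = flux A ?\<theta> + (LINT x:A|lebesgue. h x)"
    using i3 i4 by (simp add: set_lebesgue_integral_def)
  also have "\<dots> \<le> P + (LINT x:A|lebesgue. h x)"
    using flux_le_perimeter[OF P T(1)] by simp
  finally show ?thesis .
qed

text \<open>
  Two test fields \<open>\<phi>\<close> inside and \<open>\<psi>\<close> outside are blended by a cutoff that drops from \<open>1\<close> to \<open>0\<close> across a
  thin slab. The error is at most \<open>4 / \<delta>\<close> times the volume of \<open>A\<close> in a slab of width \<open>\<delta>\<close>, since
  \<open>norm (\<phi> - \<psi>) \<le> 2\<close> and the derivative of the cutoff is at most \<open>2 / \<delta>\<close>. Among the slabs between \<open>a\<close>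
  and \<open>b\<close> one carries no more than its share of the volume, and for that one the error does not
  depend on \<open>\<delta>\<close>. This replaces the slicing formula for almost every radius.
\<close>

lemma perimeter_cut:
  fixes A :: "'a::euclidean_space set"
  assumes A: "A \<in> sets lebesgue" and P: "perimeter A \<le> ennreal P" "P \<ge> 0" and ab: "a < b"
  shows "\<exists>t\<in>{a..b}. perimeter (A \<inter> {x. soft_norm x < t}) + perimeter (A - {x. soft_norm x < t})
    \<le> ennreal (P + 4 * vol (A \<inter> {x. a \<le> soft_norm x \<and> soft_norm x < b}) / (b - a))"
proof -
  define M where "M = vol (A \<inter> {x. a \<le> soft_norm x \<and> soft_norm x < b})"
  define Q where "Q = P + 4 * M / (b - a)"
  define \<delta> where "\<delta> n = (b - a) / real (Suc n)" for n
  have \<delta>: "\<delta> n > 0" "real (Suc n) * \<delta> n = b - a" for n using ab by (auto simp: \<delta>_def)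
  \<comment> \<open>Of \<open>n + 1\<close> disjoint slabs of equal width, one contains at most the average volume.\<close>
  have "\<exists>t\<in>{a..b}. vol (A \<inter> {x. t \<le> soft_norm x \<and> soft_norm x < t + \<delta> n}) \<le> M / real (Suc n)" for n
  proof -
    define S where "S j = A \<inter> {x. a + real j * \<delta> n \<le> soft_norm x \<and> soft_norm x < a + real j * \<delta> n + \<delta> n}" for j
    have S: "S j \<in> lmeasurable" for j unfolding S_def using annulus_lmeasurable(2)[OF A] by blast
    have "S i \<inter> S j = {}" if "i < j" for i j
    proof -
      have "real (Suc i) * \<delta> n \<le> real j * \<delta> n" using that \<delta>(1)[of n] by (intro mult_right_mono) auto
      then show ?thesis unfolding S_def by (auto simp: distrib_right)
    qed
    then have disj: "disjoint_family_on S {..n}" unfolding disjoint_family_on_def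
      by (metis Int_commute linorder_neqE_nat)
    have "(\<Sum>j\<le>n. vol (S j)) = vol (\<Union>j\<le>n. S j)"
      using fmeasurableD[OF S] fmeasurableD2[OF S] disj by (intro measure_finite_Union[symmetric]) auto
    also have "\<dots> \<le> M"
      unfolding M_def
    proof (rule measure_mono_fmeasurable)
      show "(\<Union>j\<le>n. S j) \<subseteq> A \<inter> {x. a \<le> soft_norm x \<and> soft_norm x < b}"
      proof
        fix x assume "x \<in> (\<Union>j\<le>n. S j)"
        then obtain j where j: "j \<le> n" "x \<in> S j" by auto
        have "real (Suc j) * \<delta> n \<le> real (Suc n) * \<delta> n" using j \<delta>(1)[of n] by (intro mult_right_mono) auto
        moreover have "0 \<le> real j * \<delta> n" using \<delta>(1)[of n] by simp
        moreover have "real (Suc j) * \<delta> n = real j * \<delta> n + \<delta> n" by (simp add: algebra_simps)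
        ultimately have zero: "0 \<le> real j * \<delta> n" and "real j * \<delta> n + \<delta> n \<le> b - a" using \<delta>(2)[of n] by linarith+
        with zero show "x \<in> A \<inter> {x. a \<le> soft_norm x \<and> soft_norm x < b}"
          using j(2) unfolding S_def by (auto simp del: mult_nonneg_nonneg zero_le_mult_iff)
      qed
      show "(\<Union>j\<le>n. S j) \<in> sets lebesgue" using fmeasurableD[OF S] by (intro sets.finite_UN) auto
      show "A \<inter> {x. a \<le> soft_norm x \<and> soft_norm x < b} \<in> lmeasurable" by (rule annulus_lmeasurable(2)[OF A])
    qed
    finally have sum: "(\<Sum>j\<le>n. vol (S j)) \<le> M" .
    have "\<exists>j\<le>n. vol (S j) \<le> M / real (Suc n)"
    proof (rule ccontr)
      assume "\<not> ?thesis"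
      then have "(\<Sum>j\<le>n. M / real (Suc n)) < (\<Sum>j\<le>n. vol (S j))"
        by (intro sum_strict_mono) auto
      then show False using sum by simp
    qed
    then obtain j where j: "j \<le> n" "vol (S j) \<le> M / real (Suc n)" by blast
    have "real j * \<delta> n \<le> real (Suc n) * \<delta> n" using j \<delta>(1)[of n] by (intro mult_right_mono) auto
    moreover have "0 \<le> real j * \<delta> n" using \<delta>(1)[of n] by simp
    ultimately have "a + real j * \<delta> n \<in> {a..b}" unfolding \<delta>(2) atLeastAtMost_iff by linarith
    then show ?thesis using j(2) unfolding S_def by blast
  qed
  then have "\<forall>n. \<exists>t. t \<in> {a..b} \<and> vol (A \<inter> {x. t \<le> soft_norm x \<and> soft_norm x < t + \<delta> n}) \<le> M / real (Suc n)"
    by blast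
  from choice[OF this] obtain T where T: "\<And>n. T n \<in> {a..b}"
    "\<And>n. vol (A \<inter> {x. T n \<le> soft_norm x \<and> soft_norm x < T n + \<delta> n}) \<le> M / real (Suc n)" by blast
  \<comment> \<open>The thin slabs found for different \<open>n\<close> may lie anywhere between \<open>a\<close> and \<open>b\<close>; their positions
    accumulate at the level \<open>t\<close> of the cut.\<close>
  obtain t r where t: "t \<in> {a..b}" "strict_mono r" "(T \<circ> r) \<longlonglongrightarrow> t"
    using seq_compactE[OF compact_imp_seq_compact[OF compact_Icc[of a b]], of T] T(1) by blast
  have \<delta>0: "(\<lambda>n. \<delta> (r n)) \<longlonglongrightarrow> 0"
  proof -
    have "\<delta> \<longlonglongrightarrow> 0" unfolding \<delta>_def
      by (rule LIMSEQ_Suc[OF lim_const_over_n])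
    then show ?thesis using LIMSEQ_subseq_LIMSEQ[OF _ t(2), of \<delta> 0] by (simp add: comp_def)
  qed
  define \<eta> where "\<eta> n x = 1 - smooth_step ((soft_norm (x::'a) - T n) / \<delta> n)" for n x
  have \<eta>01: "0 \<le> \<eta> n x" "\<eta> n x \<le> 1" for n x using smooth_step_bounds by (auto simp: \<eta>_def)
  let ?\<eta>' = "\<lambda>n x. (- (1 / \<delta> n) * smooth_step' ((soft_norm x - T n) / \<delta> n)) *\<^sub>R soft_norm' (x::'a)"
  have \<eta>C1: "C1 (\<eta> n) (?\<eta>' n)" for n
  proof -
    have "C1 (\<lambda>x::'a. (1 / \<delta> n) *\<^sub>R (soft_norm x - T n)) (\<lambda>x. (1 / \<delta> n) *\<^sub>R (soft_norm' x - 0))"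
      by (intro C1_scaleR_const C1_diff C1_soft_norm C1_const)
    from C1_diff[OF C1_const[of 1] C1_compose_real[OF this smooth_step_derivative continuous_smooth_step']]
    show ?thesis by (simp add: \<eta>_def[abs_def] algebra_simps diff_divide_distrib)
  qed
  have \<eta>lim1: "(\<lambda>n. \<eta> (r n) x) \<longlonglongrightarrow> 1" if "soft_norm x < t" for x
  proof -
    have "\<forall>\<^sub>F n in sequentially. T (r n) > soft_norm x" using t(3) that by (auto simp: comp_def order_tendsto_iff)
    then have "\<forall>\<^sub>F n in sequentially. \<eta> (r n) x = 1"
      by eventually_elim (use \<delta>(1) in \<open>auto simp: \<eta>_def divide_nonpos_pos intro!: smooth_step_0\<close>)
    then show ?thesis by (rule tendsto_eventually)
  qed
  have \<eta>lim0: "(\<lambda>n. \<eta> (r n) x) \<longlonglongrightarrow> 0" if "soft_norm x > t" for x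
  proof -
    have "(\<lambda>n. T (r n) + \<delta> (r n)) \<longlonglongrightarrow> t + 0" using t(3) \<delta>0 by (intro tendsto_add) (auto simp: comp_def)
    then have "\<forall>\<^sub>F n in sequentially. T (r n) + \<delta> (r n) < soft_norm x" using that by (auto simp: order_tendsto_iff)
    then have "\<forall>\<^sub>F n in sequentially. \<eta> (r n) x = 0"
    proof eventually_elim
      case (elim n)
      then have "(soft_norm x - T (r n)) / \<delta> (r n) \<ge> 1" using \<delta>(1)[of "r n"] by (simp add: divide_simps)
      then show ?case by (simp add: \<eta>_def smooth_step_1)
    qed
    then show ?thesis by (rule tendsto_eventually)
  qed
  have nolevel: "AE x::'a in lebesgue. soft_norm x \<noteq> t"
    using AE_not_in[of "{x::'a. soft_norm x = t}" lebesgue] negligible_soft_norm_level[of t] by (simp add: negligible_iff_null_sets)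
  have \<eta>lim: "AE x in lebesgue. (\<lambda>n. \<eta> (r n) x) \<longlonglongrightarrow> indicator {x. soft_norm x < t} x"
    using nolevel
  proof eventually_elim
    case (elim x)
    then show ?case using \<eta>lim1[of x] \<eta>lim0[of x] by (cases "soft_norm x < t") auto
  qed
  let ?B = "A \<inter> {x. soft_norm x < t}" and ?C = "A - {x. soft_norm x < t}"
  have key: "flux ?B \<phi> + flux ?C \<psi> \<le> Q" if \<phi>: "test_field \<phi>" and \<psi>: "test_field \<psi>" for \<phi> \<psi>
  proof (rule LIMSEQ_le_const2)
    show "(\<lambda>n. (\<integral>x. indicator A x * (\<eta> (r n) x * divergence \<phi> x) \<partial>lebesgue)
      + (\<integral>x. indicator A x * ((1 - \<eta> (r n) x) * divergence \<psi> x) \<partial>lebesgue)) \<longlonglongrightarrow> flux ?B \<phi> + flux ?C \<psi>"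
    proof (rule tendsto_add)
      have c: "continuous_on UNIV (\<eta> n)" for n by (rule C1_continuous_on[OF \<eta>C1])
      show "(\<lambda>n. \<integral>x. indicator A x * (\<eta> (r n) x * divergence \<phi> x) \<partial>lebesgue) \<longlonglongrightarrow> flux ?B \<phi>"
        using \<eta>lim by (intro flux_weighted_tendsto A \<eta>01 c conjunct1[OF \<phi>] fmeasurableD[OF annulus_lmeasurable(1)[OF A]]) auto
      show "(\<lambda>n. \<integral>x. indicator A x * ((1 - \<eta> (r n) x) * divergence \<psi> x) \<partial>lebesgue) \<longlonglongrightarrow> flux ?C \<psi>"
        unfolding Diff_eq
      proof (rule flux_weighted_tendsto[OF A _ conjunct1[OF \<psi>]])
        show "A \<inter> - {x. soft_norm x < t} \<in> sets lebesgue" using annulus_lmeasurable(3)[OF A, of t] by (simp add: Diff_eq)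
        show "AE x in lebesgue. (\<lambda>n. 1 - \<eta> (r n) x) \<longlonglongrightarrow> indicator (- {x. soft_norm x < t}) x"
          using \<eta>lim
        proof eventually_elim
          case (elim x)
          then show ?case using tendsto_diff[OF tendsto_const, of "\<lambda>n. \<eta> (r n) x" _ sequentially 1]
            by (simp add: indicator_compl)
        qed
      qed (use \<eta>01 in \<open>auto intro!: continuous_intros c\<close>)
    qed
    have "(\<integral>x. indicator A x * (\<eta> n x * divergence \<phi> x) \<partial>lebesgue)
      + (\<integral>x. indicator A x * ((1 - \<eta> n x) * divergence \<psi> x) \<partial>lebesgue) \<le> Q" for n
    proof -
      let ?S = "{x. T n \<le> soft_norm x \<and> soft_norm x < T n + \<delta> n}"
      let ?h = "\<lambda>x. (4 / \<delta> n) * indicator ?S x"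
      have hi: "(\<lambda>x. indicator A x * ?h x) = (\<lambda>x. (4 / \<delta> n) * indicator (A \<inter> ?S) x)"
        by (auto simp: indicator_def)
      have Sm: "A \<inter> ?S \<in> lmeasurable" using annulus_lmeasurable(2)[OF A] .
      have h1: "- ?\<eta>' n x (\<phi> x - \<psi> x) \<le> ?h x" for x
      proof (cases "x \<in> ?S")
        case True
        have n: "norm (\<phi> x - \<psi> x) \<le> 2"
          using norm_triangle_ineq4[of "\<phi> x" "\<psi> x"] add_mono[of "norm (\<phi> x)" 1 "norm (\<psi> x)" 1] \<phi> \<psi> by simp
        have "\<bar>soft_norm' x (\<phi> x - \<psi> x)\<bar> \<le> 1 * 2"
          using norm_blinfun[of "soft_norm' x" "\<phi> x - \<psi> x"] mult_mono[OF norm_soft_norm'[of x] n] by auto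
        then have "\<bar>smooth_step' ((soft_norm x - T n) / \<delta> n) * soft_norm' x (\<phi> x - \<psi> x)\<bar> \<le> 2 * 2"
          unfolding abs_mult using smooth_step'_bounds[of "(soft_norm x - T n) / \<delta> n"]
          by (intro mult_mono) auto
        then have "\<bar>(1 / \<delta> n) * (smooth_step' ((soft_norm x - T n) / \<delta> n) * soft_norm' x (\<phi> x - \<psi> x))\<bar> \<le> (1 / \<delta> n) * 4"
          unfolding abs_mult[of "1 / \<delta> n"] using \<delta>(1)[of n] by (intro mult_mono) auto
        from abs_le_D1[OF this] show ?thesis using True by (simp add: scaleR_blinfun.rep_eq uminus_blinfun.rep_eq)
      next
        case False
        then have "(soft_norm x - T n) / \<delta> n \<le> 0 \<or> (soft_norm x - T n) / \<delta> n \<ge> 1"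
          using \<delta>(1)[of n] by (auto simp: divide_simps)
        then have "smooth_step' ((soft_norm x - T n) / \<delta> n) = 0" by (rule smooth_step'_0)
        then show ?thesis using False by (simp add: scaleR_blinfun.rep_eq uminus_blinfun.rep_eq)
      qed
      have "set_integrable lebesgue A ?h"
        unfolding set_integrable_def real_scaleR_def hi using Sm
        by (intro integrable_mult_right integrable_real_indicator) (auto simp: fmeasurable_def)
      from flux_blend_le[OF A P \<phi> \<psi> \<eta>C1 \<eta>01 h1 this]
      have "(\<integral>x. indicator A x * (\<eta> n x * divergence \<phi> x) \<partial>lebesgue)
        + (\<integral>x. indicator A x * ((1 - \<eta> n x) * divergence \<psi> x) \<partial>lebesgue) \<le> P + (4 / \<delta> n) * vol (A \<inter> ?S)"
        unfolding set_lebesgue_integral_def real_scaleR_def hi using Sm by simp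
      also have "\<dots> \<le> P + (4 / \<delta> n) * (M / real (Suc n))"
        using T(2)[of n] \<delta>(1)[of n] by (intro add_mono mult_left_mono) auto
      also have "(4 / \<delta> n) * (M / real (Suc n)) = 4 * M / (real (Suc n) * \<delta> n)"
        by (simp add: mult.commute del: of_nat_Suc)
      also have "P + \<dots> = Q" unfolding \<delta>(2) Q_def ..
      finally show ?thesis .
    qed
    then show "\<exists>N. \<forall>n\<ge>N. (\<integral>x. indicator A x * (\<eta> (r n) x * divergence \<phi> x) \<partial>lebesgue)
      + (\<integral>x. indicator A x * ((1 - \<eta> (r n) x) * divergence \<psi> x) \<partial>lebesgue) \<le> Q" by blast
  qed
  have zero: "flux S (\<lambda>_::'a. 0::'a) = 0" for S by (simp add: set_lebesgue_integral_def test_field_0(2))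
  \<comment> \<open>The supremum over \<open>\<phi>\<close> is taken first, with \<open>\<psi>\<close> fixed.\<close>
  have B: "perimeter ?B \<le> ennreal (Q - flux ?C \<psi>)" if "test_field \<psi>" for \<psi>
    using key[OF _ that] by (intro perimeter_leI) (auto simp: algebra_simps)
  from B[OF test_field_0(1)] have "perimeter ?B \<le> ennreal Q" by (simp only: zero) simp
  then obtain p where p: "perimeter ?B = ennreal p" "p \<ge> 0"
    by (metis ennreal_cases ennreal_less_top infinity_ennreal_def linorder_not_less)
  have "flux ?C \<psi> \<le> Q - p" if "test_field \<psi>" for \<psi>
  proof -
    have "Q - flux ?C \<psi> \<ge> 0" using key[OF test_field_0(1) that] unfolding zero by simp
    moreover have "ennreal p \<le> ennreal (Q - flux ?C \<psi>)" using B[OF that] p by simp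
    ultimately have "p \<le> Q - flux ?C \<psi>" by (simp add: ennreal_le_iff)
    then show ?thesis by simp
  qed
  then have "perimeter ?C \<le> ennreal (Q - p)" by (rule perimeter_leI)
  moreover have "Q \<ge> p" using \<open>\<And>\<psi>. test_field \<psi> \<Longrightarrow> flux ?C \<psi> \<le> Q - p\<close>[OF test_field_0(1)] unfolding zero by simp
  ultimately have "perimeter ?B + perimeter ?C \<le> ennreal p + ennreal (Q - p)" using p by (intro add_mono) auto
  also have "\<dots> = ennreal Q" using p \<open>Q \<ge> p\<close> by (simp flip: ennreal_plus)
  finally show ?thesis using t(1) unfolding Q_def M_def by blast
qed

section \<open>Cutting by half-spaces\<close>

text \<open>
  Dominated convergence for volumes.
\<close>

lemma measure_tendsto_AE:
  fixes A :: "nat \<Rightarrow> 'a::euclidean_space set"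
  assumes "\<And>n. A n \<in> sets lebesgue" "B \<in> sets lebesgue" "D \<in> lmeasurable" "\<And>n. A n \<subseteq> D"
    and "AE x in lebesgue. (\<lambda>n. indicator (A n) x :: real) \<longlonglongrightarrow> indicator B x"
  shows "(\<lambda>n. vol (A n)) \<longlonglongrightarrow> vol B"
proof -
  have "(\<lambda>n. \<integral>x. indicator (A n) x \<partial>lebesgue) \<longlonglongrightarrow> (\<integral>x. (indicator B x :: real) \<partial>lebesgue)"
  proof (rule integral_dominated_convergence[where w="indicator D"])
    show "integrable lebesgue (indicator D :: 'a \<Rightarrow> real)"
      using assms(3) by (intro integrable_real_indicator) (auto simp: fmeasurable_def)
    show "AE x in lebesgue. norm (indicator (A n) x :: real) \<le> indicator D x" for n
      using assms(4)[of n] by (intro always_eventually) (auto simp: indicator_def)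
  qed (use assms in auto)
  then show ?thesis by simp
qed

lemma measure_truncation_tendsto:
  fixes A :: "'a::euclidean_space set"
  assumes A: "A \<in> lmeasurable" and r: "filterlim r at_top sequentially"
  shows "(\<lambda>n. vol (A \<inter> {x. soft_norm x < r n})) \<longlonglongrightarrow> vol A"
proof (rule measure_tendsto_AE[OF _ _ A])
  show "AE x in lebesgue. (\<lambda>n. indicator (A \<inter> {x. soft_norm x < r n}) x :: real) \<longlonglongrightarrow> indicator A x"
  proof (rule always_eventually, rule allI, rule tendsto_eventually)
    fix x :: 'a
    have "\<forall>\<^sub>F n in sequentially. r n > soft_norm x" using r by (simp add: filterlim_at_top_dense)
    then show "\<forall>\<^sub>F n in sequentially. indicator (A \<inter> {x. soft_norm x < r n}) x = (indicator A x :: real)"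
      by eventually_elim (auto simp: indicator_def)
  qed
qed (use annulus_lmeasurable(1) A in auto)

lemma lmeasurable_inner_compact:
  fixes A :: "'a::euclidean_space set"
  assumes A: "A \<in> lmeasurable" "e > 0"
  obtains K where "compact K" "K \<subseteq> A" "vol A \<le> vol K + e"
proof -
  obtain T where T: "closed T" "T \<subseteq> A" "A - T \<in> lmeasurable" "emeasure lebesgue (A - T) < ennreal (e/2)"
    using sets_lebesgue_inner_closed[of A "e/2"] A by auto
  have Tm: "T \<in> lmeasurable" using A T by (intro fmeasurableI2[OF A(1) T(2)]) auto
  have "vol A = vol T + vol (A - T)"
    using measurable_measure_Diff[OF A(1) fmeasurableD[OF Tm] T(2)] by simp
  moreover have "vol (A - T) \<le> e/2"
    using T(3,4) A(2) by (simp add: emeasure_eq_measure2 ennreal_less_iff)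
  ultimately have 1: "vol A \<le> vol T + e/2" by simp
  have "(\<lambda>n. vol (T \<inter> {x. soft_norm x < real n})) \<longlonglongrightarrow> vol T"
    by (rule measure_truncation_tendsto[OF Tm filterlim_real_sequentially])
  then have "\<forall>\<^sub>F n in sequentially. vol (T \<inter> {x. soft_norm x < real n}) > vol T - e/2"
    using A(2) by (simp add: order_tendsto_iff)
  then obtain n where n: "vol (T \<inter> {x. soft_norm x < real n}) > vol T - e/2"
    using eventually_happens by fastforce
  have "vol (T \<inter> {x. soft_norm x < real n}) \<le> vol (T \<inter> cball 0 (real n))"
  proof (rule measure_mono_fmeasurable)
    show "T \<inter> {x. soft_norm x < real n} \<subseteq> T \<inter> cball 0 (real n)"
      by (auto intro: order.trans[OF norm_le_soft_norm less_imp_le])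
    show "T \<inter> {x. soft_norm x < real n} \<in> sets lebesgue" using annulus_lmeasurable(1)[of T "real n"] T(1) by auto
    show "T \<inter> cball 0 (real n) \<in> lmeasurable" using Tm by (intro fmeasurable_Int_fmeasurable) auto
  qed
  then have 2: "vol A \<le> vol (T \<inter> cball 0 (real n)) + e" using 1 n by linarith
  show ?thesis by (rule that[OF _ _ 2]) (use T in \<open>auto intro: closed_Int_compact\<close>)
qed

text \<open>
  The given field is blended with the constant field \<open>e\<close>, the outer normal of the half-space. Since
  \<open>e \<bullet> \<phi> \<le> 1 = e \<bullet> e\<close>, the error term of the blending has a favourable sign. The constant field has no
  compact support, so it is cut off at distance \<open>R\<close>; this costs a divergence of size \<open>2 / R\<close>,
  which disappears in the limit because \<open>A\<close> has finite volume.
\<close>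

lemma perimeter_Int_halfspace:
  fixes A :: "'a::euclidean_space set"
  assumes A: "A \<in> lmeasurable" and P: "perimeter A \<le> ennreal P" "P \<ge> 0" and e: "norm e = 1"
  shows "perimeter (A \<inter> {x. e \<bullet> x \<le> t}) \<le> ennreal P"
proof (rule perimeter_leI)
  fix \<phi> :: "'a \<Rightarrow> 'a" assume \<phi>: "test_field \<phi>"
  obtain R0 where R0: "\<And>x. x \<notin> cball 0 R0 \<Longrightarrow> \<phi> x = 0" "R0 > 0"
    using C1_compact_supportE[OF conjunct1[OF \<phi>]] by metis
  define R where "R n = 1 + R0 + real n" for n
  have R: "R n > 0" for n using R0(2) by (simp add: R_def)
  define \<eta> where "\<eta> n x = 1 - smooth_step (real (Suc n) * (e \<bullet> (x::'a) - t))" for n x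
  let ?\<eta>' = "\<lambda>n x. - ((smooth_step' (real (Suc n) * (e \<bullet> (x::'a) - t)) * real (Suc n)) *\<^sub>R blinfun_inner_right e)"
  have \<eta>01: "0 \<le> \<eta> n x" "\<eta> n x \<le> 1" for n x using smooth_step_bounds by (auto simp: \<eta>_def)
  have \<eta>C1: "C1 (\<eta> n) (?\<eta>' n)" for n
  proof -
    have "C1 (\<lambda>x::'a. real (Suc n) *\<^sub>R (e \<bullet> x - t)) (\<lambda>x. real (Suc n) *\<^sub>R (blinfun_inner_right e - 0))"
      by (intro C1_scaleR_const C1_diff C1_inner_const C1_const)
    from C1_diff[OF C1_const[of 1] C1_compose_real[OF this smooth_step_derivative continuous_smooth_step']]
    show ?thesis by (simp add: \<eta>_def[abs_def] del: of_nat_Suc)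
  qed
  define \<zeta> where "\<zeta> n x = 1 - smooth_step (soft_norm (x::'a) / R n - 1)" for n x
  let ?\<zeta>' = "\<lambda>n x. - ((smooth_step' (soft_norm (x::'a) / R n - 1) / R n) *\<^sub>R soft_norm' x)"
  have \<zeta>01: "0 \<le> \<zeta> n x" "\<zeta> n x \<le> 1" for n x using smooth_step_bounds by (auto simp: \<zeta>_def)
  have \<zeta>C1: "C1 (\<zeta> n) (?\<zeta>' n)" for n
  proof -
    have "C1 (\<lambda>x::'a. (1 / R n) *\<^sub>R soft_norm x - 1) (\<lambda>x. (1 / R n) *\<^sub>R soft_norm' x - 0)"
      by (intro C1_scaleR_const C1_diff C1_soft_norm C1_const)
    from C1_diff[OF C1_const[of 1] C1_compose_real[OF this smooth_step_derivative continuous_smooth_step']]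
    show ?thesis by (simp add: \<zeta>_def[abs_def])
  qed
  let ?\<psi> = "\<lambda>n x. \<zeta> n x *\<^sub>R e"
  have \<zeta>0: "\<zeta> n x = 0" if "x \<notin> cball 0 (2 * R n)" for n x
  proof -
    have "soft_norm x > 2 * R n" using that norm_le_soft_norm[of x] by auto
    then have "soft_norm x / R n - 1 \<ge> 1" using R[of n] by (simp add: divide_simps)
    then show ?thesis by (simp add: \<zeta>_def smooth_step_1)
  qed
  have \<zeta>1: "\<zeta> n x = 1" if "\<phi> x \<noteq> 0" for n x
  proof -
    have "norm x \<le> R0" using R0(1)[of x] that by force
    then have "soft_norm x \<le> R n" using soft_norm_le[of x] by (simp add: R_def)
    then have "soft_norm x / R n - 1 \<le> 0" using R[of n] by (simp add: divide_simps)
    then show ?thesis by (simp add: \<zeta>_def smooth_step_0)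
  qed
  have \<psi>: "test_field (?\<psi> n)" for n
  proof
    show "C1_compact_support (?\<psi> n)"
      by (rule C1_compact_supportI[OF C1_scaleR[OF \<zeta>C1 C1_const], where R="2 * R n"]) (simp add: \<zeta>0)
    show "\<forall>x. norm (?\<psi> n x) \<le> 1" using \<zeta>01[of n] e by simp
  qed
  have div\<psi>: "divergence (?\<psi> n) x = ?\<zeta>' n x e" for n x
    by (subst divergence_scaleR[OF \<zeta>C1 C1_const]) (simp add: divergence_eq[OF C1_const])
  have div\<psi>_le: "\<bar>divergence (?\<psi> n) x\<bar> \<le> 2 / R n" for n x
  proof -
    have "\<bar>soft_norm' x e\<bar> \<le> 1"
      using norm_blinfun[of "soft_norm' x" e] norm_soft_norm'[of x] e by simp
    then have "\<bar>smooth_step' (soft_norm x / R n - 1) * soft_norm' x e\<bar> \<le> 2 * 1"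
      unfolding abs_mult using smooth_step'_bounds[of "soft_norm x / R n - 1"]
      by (intro mult_mono) auto
    then show ?thesis unfolding div\<psi> using R[of n]
      by (simp add: uminus_blinfun.rep_eq scaleR_blinfun.rep_eq abs_mult divide_simps)
  qed
  have As: "A \<in> sets lebesgue" using A by auto
  have main: "(\<integral>x. indicator A x * (\<eta> n x * divergence \<phi> x) \<partial>lebesgue) \<le> P + 2 / R n * vol A" for n
  proof -
    have h: "- ?\<eta>' n x (\<phi> x - ?\<psi> n x) \<le> 0" for x
    proof -
      have "e \<bullet> (\<phi> x - ?\<psi> n x) \<le> 0"
      proof (cases "\<phi> x = 0")
        case True
        then show ?thesis using \<zeta>01[of n x] e by (simp add: dot_square_norm)
      next
        case False
        have "e \<bullet> \<phi> x \<le> 1" using norm_cauchy_schwarz[of e "\<phi> x"] e conjunct2[OF \<phi>, rule_format, of x] by simp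
        then show ?thesis using \<zeta>1[OF False] e by (simp add: inner_diff_right dot_square_norm)
      qed
      then have "(smooth_step' (real (Suc n) * (e \<bullet> x - t)) * real (Suc n)) * (e \<bullet> (\<phi> x - ?\<psi> n x)) \<le> 0"
        using smooth_step'_bounds(1) by (intro mult_nonneg_nonpos mult_nonneg_nonneg) auto
      then show ?thesis by (simp add: uminus_blinfun.rep_eq scaleR_blinfun.rep_eq)
    qed
    have "set_integrable lebesgue A (\<lambda>_. 0::real)" by (simp add: set_integrable_def)
    from flux_blend_le[OF As P \<phi> \<psi> \<eta>C1 \<eta>01 h this]
    have 1: "(\<integral>x. indicator A x * (\<eta> n x * divergence \<phi> x) \<partial>lebesgue)
     + (\<integral>x. indicator A x * ((1 - \<eta> n x) * divergence (?\<psi> n) x) \<partial>lebesgue) \<le> P"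
      by (simp add: set_lebesgue_integral_def)
    have "\<bar>\<integral>x. indicator A x * ((1 - \<eta> n x) * divergence (?\<psi> n) x) \<partial>lebesgue\<bar> \<le> (\<integral>x. indicator A x * (2 / R n) \<partial>lebesgue)"
    proof (rule integral_abs_bound_integral)
      have c: "continuous_on UNIV (\<lambda>x. 1 - \<eta> n x)" using C1_continuous_on[OF \<eta>C1] by (intro continuous_intros)
      show "integrable lebesgue (\<lambda>x. indicator A x * ((1 - \<eta> n x) * divergence (?\<psi> n) x))"
        using \<eta>01[of n] by (intro set_integrable_bounded_mult integrable_divergence conjunct1[OF \<psi>] c As) auto
      show "integrable lebesgue (\<lambda>x. indicator A x * (2 / R n))"
        using A by (intro integrable_mult_left integrable_real_indicator) (auto simp: fmeasurable_def)
      show "\<bar>indicator A x * ((1 - \<eta> n x) * divergence (?\<psi> n) x)\<bar> \<le> indicator A x * (2 / R n)" for x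
        using \<eta>01[of n x] div\<psi>_le[of n x] mult_mono[of "1 - \<eta> n x" 1 "\<bar>divergence (?\<psi> n) x\<bar>" "2 / R n"]
        by (auto simp: indicator_def abs_mult)
    qed
    moreover have "(\<integral>x. indicator A x * (2 / R n) \<partial>lebesgue) = 2 / R n * vol A" using A by simp
    ultimately show ?thesis using 1 by linarith
  qed
  have "(\<lambda>n. \<integral>x. indicator A x * (\<eta> n x * divergence \<phi> x) \<partial>lebesgue) \<longlonglongrightarrow> flux (A \<inter> {x. e \<bullet> x \<le> t}) \<phi>"
  proof (rule flux_weighted_tendsto[OF As _ conjunct1[OF \<phi>] C1_continuous_on[OF \<eta>C1] \<eta>01])
    have "closed {x. e \<bullet> x \<le> t}" by (rule closed_halfspace_le)
    then show "A \<inter> {x. e \<bullet> x \<le> t} \<in> sets lebesgue" using As by auto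
    show "AE x in lebesgue. (\<lambda>n. \<eta> n x) \<longlonglongrightarrow> indicator {x. e \<bullet> x \<le> t} x"
    proof (intro always_eventually allI)
      fix x
      show "(\<lambda>n. \<eta> n x) \<longlonglongrightarrow> indicator {x. e \<bullet> x \<le> t} x"
      proof (cases "e \<bullet> x \<le> t")
        case True
        then have "\<eta> n x = 1" for n by (auto simp: \<eta>_def mult_le_0_iff intro!: smooth_step_0)
        then show ?thesis using True by simp
      next
        case False
        then obtain m where m: "1 < real m * (e \<bullet> x - t)"
          using reals_Archimedean3[of "e \<bullet> x - t"] by auto
        have "\<eta> n x = 0" if "n \<ge> m" for n
        proof -
          have "real m * (e \<bullet> x - t) \<le> real (Suc n) * (e \<bullet> x - t)" using False that by (intro mult_right_mono) auto
          then have "real (Suc n) * (e \<bullet> x - t) \<ge> 1" using m by linarith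
          then show ?thesis by (simp add: \<eta>_def smooth_step_1 del: of_nat_Suc)
        qed
        then have "(\<lambda>n. \<eta> n x) \<longlonglongrightarrow> 0"
          by (intro tendsto_eventually) (auto simp: eventually_sequentially)
        then show ?thesis using False by simp
      qed
    qed
  qed
  moreover have "(\<lambda>n. P + 2 / R n * vol A) \<longlonglongrightarrow> P + 0 * vol A"
  proof (intro tendsto_intros)
    show "(\<lambda>n. 2 / R n) \<longlonglongrightarrow> 0" unfolding R_def
      by (intro tendsto_divide_0[OF tendsto_const] filterlim_at_top_imp_at_infinity
          filterlim_tendsto_add_at_top[OF tendsto_const] filterlim_real_sequentially)
  qed
  ultimately show "flux (A \<inter> {x. e \<bullet> x \<le> t}) \<phi> \<le> P"
    using LIMSEQ_le[OF _ _ , of _ _ "\<lambda>n. P + 2 / R n * vol A"] main by fastforce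
qed

section \<open>Translates of a set of finite perimeter\<close>

text \<open>
  Finitely many balls cover \<open>K\<close> such that the balls of twice the radius stay in \<open>U\<close>. Each of them has a
  step function that is \<open>0\<close> on the ball and \<open>1\<close> outside the larger one; one minus their product is the
  bump.
\<close>

lemma C1_bump:
  fixes K U :: "'a::euclidean_space set"
  assumes K: "compact K" and U: "open U" "K \<subseteq> U"
  obtains \<psi> :: "'a \<Rightarrow> real" and \<psi>' R where "C1 \<psi> \<psi>'" "\<And>x. x \<notin> cball 0 R \<Longrightarrow> \<psi> x = 0"
    "\<And>x. 0 \<le> \<psi> x" "\<And>x. \<psi> x \<le> 1" "\<And>x. x \<in> K \<Longrightarrow> \<psi> x = 1" "\<And>x. x \<notin> U \<Longrightarrow> \<psi> x = 0"
proof -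
  obtain R where R: "\<And>x. x \<in> K \<Longrightarrow> norm x < R"
    using compact_imp_bounded[OF K] unfolding bounded_pos_less by blast
  have "\<exists>r>0. ball x (2 * r) \<subseteq> U \<inter> ball 0 R" if "x \<in> K" for x
  proof -
    have "open (U \<inter> ball 0 R)" "x \<in> U \<inter> ball 0 R" using U R that by auto
    then obtain d where "d > 0" "ball x d \<subseteq> U \<inter> ball 0 R" unfolding open_contains_ball by blast
    then show ?thesis by (intro exI[of _ "d/2"]) auto
  qed
  then obtain r where r: "\<And>x. x \<in> K \<Longrightarrow> r x > 0" "\<And>x. x \<in> K \<Longrightarrow> ball x (2 * r x) \<subseteq> U \<inter> ball 0 R" by metis
  have "K \<subseteq> (\<Union>c\<in>K. ball c (r c))" using r(1) by force
  from compactE_image[OF K open_ball this]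
  obtain D where D: "D \<subseteq> K" "finite D" "K \<subseteq> (\<Union>c\<in>D. ball c (r c))" .
  define s where "s c x = smooth_step (((x - c) \<bullet> (x - c)) / (r c)\<^sup>2 - 1)" for c x :: 'a
  have sC1: "\<exists>s'. C1 (s c) s'" for c
  proof -
    have "C1 (\<lambda>x::'a. (x - c) \<bullet> (x - c)) (\<lambda>x. 2 *\<^sub>R blinfun_inner_right (x - c))"
      using C1_shift[OF C1_inner_self, of "-c" 1] by simp
    then have "C1 (\<lambda>x::'a. (1 / (r c)\<^sup>2) *\<^sub>R ((x - c) \<bullet> (x - c)) - 1) (\<lambda>x. (1 / (r c)\<^sup>2) *\<^sub>R (2 *\<^sub>R blinfun_inner_right (x - c)) - 0)"
      by (intro C1_scaleR_const C1_diff C1_const)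
    from C1_compose_real[OF this smooth_step_derivative continuous_smooth_step']
    show ?thesis unfolding s_def[abs_def] by auto
  qed
  have "\<exists>f'. C1 (\<lambda>x. \<Prod>c\<in>D. s c x) f'" using D(2)
  proof (induction D rule: finite_induct)
    case empty
    then show ?case using C1_const[of 1] by auto
  next
    case (insert c D)
    then show ?case using sC1[of c] C1_scaleR[of "s c" _ "\<lambda>x. \<Prod>c\<in>D. s c x"] by auto
  qed
  then obtain f' where f': "C1 (\<lambda>x. \<Prod>c\<in>D. s c x) f'" by blast
  have s01: "0 \<le> s c x" "s c x \<le> 1" for c x by (auto simp: s_def smooth_step_bounds)
  have out: "(\<Prod>c\<in>D. s c x) = 1" if "x \<notin> U \<inter> ball 0 R" for x
  proof (rule prod.neutral, rule ballI)
    fix c assume "c \<in> D"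
    then have c: "r c > 0" "x \<notin> ball c (2 * r c)" using r D(1) that by blast+
    then have "norm (x - c) \<ge> 2 * r c" by (simp add: dist_norm norm_minus_commute)
    then have "(x - c) \<bullet> (x - c) \<ge> (2 * r c)\<^sup>2" unfolding dot_square_norm using c(1) by (intro power_mono) auto
    moreover have "(2 * r c)\<^sup>2 = 4 * (r c)\<^sup>2" by (simp add: power2_eq_square)
    ultimately have "(x - c) \<bullet> (x - c) \<ge> 2 * (r c)\<^sup>2" using zero_le_power2[of "r c"] by linarith
    then show "s c x = 1" unfolding s_def using c(1) by (intro smooth_step_1) (simp add: field_simps)
  qed
  have ins: "(\<Prod>c\<in>D. s c x) = 0" if xK: "x \<in> K" for x
  proof -
    obtain c where c: "c \<in> D" "x \<in> ball c (r c)" using D(3) xK by blast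
    then have "norm (x - c) < r c" by (simp add: dist_norm norm_minus_commute)
    then have "(x - c) \<bullet> (x - c) \<le> (r c)\<^sup>2" unfolding dot_square_norm by (intro power_mono) auto
    then have "s c x = 0" unfolding s_def using r(1)[of c] c(1) D(1) by (intro smooth_step_0) (auto simp: field_simps)
    then show ?thesis using c(1) D(2) by auto
  qed
  show ?thesis
  proof (rule that[of "\<lambda>x. 1 - (\<Prod>c\<in>D. s c x)" "\<lambda>x. 0 - f' x" R])
    show "C1 (\<lambda>x. 1 - (\<Prod>c\<in>D. s c x)) (\<lambda>x. 0 - f' x)" by (rule C1_diff[OF C1_const f'])
    show "0 \<le> 1 - (\<Prod>c\<in>D. s c x)" for x using prod_le_1[of D "\<lambda>c. s c x"] s01 by simp
    show "1 - (\<Prod>c\<in>D. s c x) \<le> 1" for x using s01 by (simp add: prod_nonneg)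
  qed (use out ins in auto)
qed

lemma C1_test_field:
  fixes \<psi> :: "'a::euclidean_space \<Rightarrow> real"
  assumes "C1 \<psi> \<psi>'" "\<And>x. x \<notin> cball 0 R \<Longrightarrow> \<psi> x = 0" "\<And>x. \<bar>\<psi> x\<bar> \<le> 1" "norm e \<le> 1"
  shows "test_field (\<lambda>x. \<psi> x *\<^sub>R e)" "divergence (\<lambda>x. \<psi> x *\<^sub>R e) x = \<psi>' x e"
proof -
  have "norm (\<psi> x *\<^sub>R e) \<le> 1" for x using mult_mono[of "\<bar>\<psi> x\<bar>" 1 "norm e" 1] assms(3)[of x] assms(4) by simp
  then show "test_field (\<lambda>x. \<psi> x *\<^sub>R e)"
    using C1_compact_supportI[OF C1_scaleR[OF assms(1) C1_const], of R e] assms(2) by auto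
  show "divergence (\<lambda>x. \<psi> x *\<^sub>R e) x = \<psi>' x e"
    by (subst divergence_scaleR[OF assms(1) C1_const]) (simp add: divergence_eq[OF C1_const])
qed

lemma translation_vimage_lebesgue:
  fixes A :: "'a::euclidean_space set"
  assumes "A \<in> sets lebesgue"
  shows "{x. x + h \<in> A} \<in> sets lebesgue"
    and "vol {x. x + h \<in> A} = vol A"
    and "emeasure lebesgue {x. x + h \<in> A} = emeasure lebesgue A"
proof -
  have eq: "{x. x + h \<in> A} = (\<lambda>x. - h + 1 *\<^sub>R x) ` A"
    by (auto simp: image_def intro: bexI[of _ "_ + h"])
  show "{x. x + h \<in> A} \<in> sets lebesgue" unfolding eq by (rule affine_image_lebesgue[OF assms]) simp
  show e: "emeasure lebesgue {x. x + h \<in> A} = emeasure lebesgue A"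
    using emeasure_lebesgue_affine[of 1 "-h" A] unfolding eq by simp
  then show "vol {x. x + h \<in> A} = vol A" by (simp add: measure_def)
qed

text \<open>
  For a bump \<open>\<psi>\<close> close to the indicator of \<open>A\<close>, the function \<open>t \<mapsto> \<integral>\<^sub>A \<psi> (x + t h) dx\<close> has as derivative
  the flux through \<open>A\<close> of a field parallel to \<open>h\<close> with norm at most \<open>norm h\<close>, so it decreases
  with speed at most \<open>norm h * P\<close>. Its values at \<open>0\<close> and \<open>1\<close> are close to the volume of \<open>A\<close> and to
  the volume of the part of \<open>A\<close> that stays in \<open>A\<close> under the translation by \<open>h\<close>.
\<close>

lemma measure_translation_Diff_le_perimeter:
  fixes A :: "'a::euclidean_space set"
  assumes A: "A \<in> lmeasurable" and P: "perimeter A \<le> ennreal P" "P \<ge> 0"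
  shows "vol {x \<in> A. x + h \<notin> A} \<le> norm h * P"
proof (rule field_le_epsilon)
  fix \<delta> :: real assume \<delta>: "\<delta> > 0"
  have As: "A \<in> sets lebesgue" using A by auto
  obtain K where K: "compact K" "K \<subseteq> A" "vol A \<le> vol K + \<delta>/2"
    using lmeasurable_inner_compact[OF A, of "\<delta>/2"] \<delta> by auto
  obtain U where U: "open U" "A \<subseteq> U" "U - A \<in> lmeasurable" "emeasure lebesgue (U - A) < ennreal (\<delta>/2)"
    using sets_lebesgue_outer_open[OF As, of "\<delta>/2"] \<delta> by auto
  have "K \<subseteq> U" using K U by blast
  obtain \<psi> :: "'a \<Rightarrow> real" and \<psi>' R where \<psi>: "C1 \<psi> \<psi>'" "\<And>x. x \<notin> cball 0 R \<Longrightarrow> \<psi> x = 0"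
    "\<And>x. 0 \<le> \<psi> x" "\<And>x. \<psi> x \<le> 1" "\<And>x. x \<in> K \<Longrightarrow> \<psi> x = 1" "\<And>x. x \<notin> U \<Longrightarrow> \<psi> x = 0"
    by (rule C1_bump[OF K(1) U(1) \<open>K \<subseteq> U\<close>]) (rule that)
  let ?G = "\<lambda>t. LINT x:A|lebesgue. \<psi> (x + t *\<^sub>R h)"
  have deriv: "(?G has_real_derivative (LINT x:A|lebesgue. \<psi>' (x + t *\<^sub>R h) h)) (at t)" for t
    by (rule translation_derivative[OF \<psi>(1) _ As], erule \<psi>(2))
  \<comment> \<open>For \<open>h = 0\<close> this is the zero vector, whose norm is at most \<open>1\<close> as well.\<close>
  define e where "e = - (1 / norm h) *\<^sub>R h"
  have e: "norm e \<le> 1" by (simp add: e_def)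
  have G': "(LINT x:A|lebesgue. \<psi>' (x + t *\<^sub>R h) h) \<ge> - (norm h * P)" for t
  proof -
    let ?\<psi>t = "\<lambda>x. \<psi> (t *\<^sub>R h + 1 *\<^sub>R x)"
    note C = C1_shift[OF \<psi>(1), of "t *\<^sub>R h" 1]
    have z: "?\<psi>t x = 0" if "x \<notin> cball 0 (R + norm (t *\<^sub>R h))" for x
    proof (rule \<psi>(2))
      show "t *\<^sub>R h + 1 *\<^sub>R x \<notin> cball 0 R" using that norm_triangle_ineq2[of x "- t *\<^sub>R h"] by (simp add: add.commute)
    qed
    have b: "\<bar>?\<psi>t x\<bar> \<le> 1" for x using \<psi>(3,4) by simp
    have T: "test_field (\<lambda>x. ?\<psi>t x *\<^sub>R e)"
      "divergence (\<lambda>x. ?\<psi>t x *\<^sub>R e) x = (1 *\<^sub>R \<psi>' (t *\<^sub>R h + 1 *\<^sub>R x)) e" for x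
      by (rule C1_test_field[OF C _ b e], erule z)+
    have "flux A (\<lambda>x. ?\<psi>t x *\<^sub>R e) \<le> P" by (rule flux_le_perimeter[OF P T(1)])
    then have "norm h * flux A (\<lambda>x. ?\<psi>t x *\<^sub>R e) \<le> norm h * P" by (intro mult_left_mono) auto
    also have "norm h * flux A (\<lambda>x. ?\<psi>t x *\<^sub>R e) = - (LINT x:A|lebesgue. \<psi>' (x + t *\<^sub>R h) h)"
    proof (cases "h = 0")
      case False
      have "norm h * flux A (\<lambda>x. ?\<psi>t x *\<^sub>R e) = (LINT x:A|lebesgue. norm h * divergence (\<lambda>x. ?\<psi>t x *\<^sub>R e) x)"
        by simp
      also have "\<dots> = (LINT x:A|lebesgue. - \<psi>' (x + t *\<^sub>R h) h)"
        unfolding T(2) using False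
        by (simp add: e_def scaleR_blinfun.rep_eq blinfun.scaleR_right blinfun.minus_right add.commute)
      finally show ?thesis by (simp add: set_lebesgue_integral_def)
    qed (simp add: set_lebesgue_integral_def)
    finally show ?thesis by simp
  qed
  obtain z where "?G 1 - ?G 0 = (1 - 0) * (LINT x:A|lebesgue. \<psi>' (x + z *\<^sub>R h) h)"
    using MVT2[of 0 1 ?G, OF _ deriv] by auto
  then have G01: "?G 0 - ?G 1 \<le> norm h * P" using G'[of z] by simp
  have intg: "set_integrable lebesgue A (\<lambda>x. \<psi> (x + t *\<^sub>R h))" for t
  proof -
    have "integrable lebesgue (\<lambda>x. indicator A x * (\<psi> (x + t *\<^sub>R h)))"
    proof (rule Bochner_Integration.integrable_bound[of _ "indicator A :: _ \<Rightarrow> real"])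
      show "integrable lebesgue (indicator A :: _ \<Rightarrow> real)"
        using A by (intro integrable_real_indicator) (auto simp: fmeasurable_def)
      have "continuous_on UNIV (\<lambda>x. \<psi> (x + t *\<^sub>R h))"
        by (rule continuous_on_compose2[OF C1_continuous_on[OF \<psi>(1), of UNIV]]) (auto intro!: continuous_intros)
      then have "(\<lambda>x. \<psi> (x + t *\<^sub>R h)) \<in> borel_measurable lebesgue"
        by (simp add: borel_measurable_continuous_onI measurable_completion)
      then show "(\<lambda>x. indicator A x * (\<psi> (x + t *\<^sub>R h))) \<in> borel_measurable lebesgue" using As by auto
    qed (use \<psi>(3,4) in \<open>auto simp: indicator_def\<close>)
    then show ?thesis by (simp add: set_integrable_def)
  qed
  have Km: "K \<in> lmeasurable" using K(1) by (rule lmeasurable_compact)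
  have "vol K = (\<integral>x. indicator K x \<partial>lebesgue)" using Km by simp
  also have "\<dots> \<le> ?G 0"
    unfolding set_lebesgue_integral_def
  proof (rule integral_mono)
    show "integrable lebesgue (indicator K :: _ \<Rightarrow> real)"
      using Km by (intro integrable_real_indicator) (auto simp: fmeasurable_def)
    show "integrable lebesgue (\<lambda>x. indicator A x *\<^sub>R \<psi> (x + 0 *\<^sub>R h))" using intg[of 0] by (simp add: set_integrable_def)
    show "indicator K x \<le> indicator A x *\<^sub>R \<psi> (x + 0 *\<^sub>R h)" for x
      using \<psi>(3,5)[of x] K(2) by (auto simp: indicator_def)
  qed
  finally have G0: "vol K \<le> ?G 0" .
  have mU: "{x. x + h \<in> U - A} \<in> sets lebesgue" "vol {x. x + h \<in> U - A} \<le> \<delta>/2" "{x. x + h \<in> U - A} \<in> lmeasurable"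
  proof -
    note t = translation_vimage_lebesgue[OF fmeasurableD[OF U(3)], of h]
    show "{x. x + h \<in> U - A} \<in> sets lebesgue" by (rule t(1))
    show "{x. x + h \<in> U - A} \<in> lmeasurable" using t(1,3) U(3) by (auto simp: fmeasurable_def)
    show "vol {x. x + h \<in> U - A} \<le> \<delta>/2"
      unfolding t(2) using U(3,4) \<delta> by (simp add: emeasure_eq_measure2 ennreal_less_iff)
  qed
  have mAh: "{x \<in> A. x + h \<in> A} \<in> lmeasurable"
  proof -
    have "{x \<in> A. x + h \<in> A} = A \<inter> {x. x + h \<in> A}" by auto
    then show ?thesis using A translation_vimage_lebesgue(1)[OF As, of h] by (auto intro: fmeasurable_Int_fmeasurable)
  qed
  have "?G 1 \<le> (\<integral>x. indicator {x \<in> A. x + h \<in> A} x + indicator {x. x + h \<in> U - A} x \<partial>lebesgue)"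
    unfolding set_lebesgue_integral_def
  proof (rule integral_mono)
    show "integrable lebesgue (\<lambda>x. indicator A x *\<^sub>R \<psi> (x + 1 *\<^sub>R h))" using intg[of 1] by (simp add: set_integrable_def)
    show "integrable lebesgue (\<lambda>x. indicator {x \<in> A. x + h \<in> A} x + indicator {x. x + h \<in> U - A} x :: real)"
      using mAh mU(3) by (intro Bochner_Integration.integrable_add integrable_real_indicator) (auto simp: fmeasurable_def)
    show "indicator A x *\<^sub>R \<psi> (x + 1 *\<^sub>R h) \<le> indicator {x \<in> A. x + h \<in> A} x + indicator {x. x + h \<in> U - A} x" for x
      using \<psi>(4,6)[of "x + h"] by (auto simp: indicator_def)
  qed
  also have "\<dots> = vol {x \<in> A. x + h \<in> A} + vol {x. x + h \<in> U - A}"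
    using mAh mU(3) by (subst Bochner_Integration.integral_add) (auto simp: fmeasurable_def)
  finally have G1: "?G 1 \<le> vol {x \<in> A. x + h \<in> A} + \<delta>/2" using mU(2) by simp
  have "{x \<in> A. x + h \<notin> A} = A - {x \<in> A. x + h \<in> A}" by auto
  then have "vol {x \<in> A. x + h \<notin> A} = vol A - vol {x \<in> A. x + h \<in> A}"
    using measurable_measure_Diff[OF A fmeasurableD[OF mAh]] by auto
  then show "vol {x \<in> A. x + h \<notin> A} \<le> norm h * P + \<delta>"
    using G0 G1 G01 K(3) by linarith
qed

section \<open>Isoperimetric inequality and concentration of mass\<close>

text \<open>
  Tonelli's theorem is applied to Borel sets, for which sets such as \<open>{(x, h). x + h \<in> B}\<close> are measurable
  in the product.
\<close>

lemma lebesgue_borel_version: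
  fixes A :: "'a::euclidean_space set"
  assumes "A \<in> sets lebesgue"
  obtains B where "B \<in> sets borel" "AE x in lebesgue. x \<in> A \<longleftrightarrow> x \<in> B"
proof -
  obtain B N where B: "B \<in> sets borel" "negligible N" "B \<union> N = A"
    using sets_lebesgue_almost_borel[OF assms] by metis
  have "AE x in lebesgue. x \<notin> N" using B(2) by (intro AE_not_in) (simp add: negligible_iff_null_sets)
  then have "AE x in lebesgue. x \<in> A \<longleftrightarrow> x \<in> B" by eventually_elim (use B(3) in blast)
  then show ?thesis using that B(1) by blast
qed

lemma emeasure_Int_borel_version:
  fixes A B C :: "'a::euclidean_space set"
  assumes "A \<in> sets lebesgue" "B \<in> sets borel" "AE x in lebesgue. x \<in> A \<longleftrightarrow> x \<in> B" "C \<in> sets borel"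
  shows "emeasure lebesgue (C \<inter> A) = emeasure lborel (C \<inter> B)"
proof -
  have "emeasure lebesgue (C \<inter> A) = emeasure lebesgue (C \<inter> B)"
    using assms by (intro emeasure_eq_AE) auto
  then show ?thesis using assms by simp
qed

lemma ball_overlap_measurable:
  fixes B :: "'a::euclidean_space set"
  assumes "B \<in> sets lebesgue"
  shows "(\<lambda>x. emeasure lebesgue (ball x r \<inter> B)) \<in> borel_measurable borel"
proof -
  obtain B' where B'[measurable]: "B' \<in> sets borel" and eq: "AE x in lebesgue. x \<in> B \<longleftrightarrow> x \<in> B'"
    using lebesgue_borel_version[OF assms] by metis
  have "emeasure lebesgue (ball x r \<inter> B) = (\<integral>\<^sup>+y. indicator B' y * indicator {y. dist x y < r} y \<partial>lborel)" for x
    by (subst emeasure_Int_borel_version[OF assms B' eq])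
      (auto simp: indicator_inter_arith mult.commute ball_def Int_def simp flip: nn_integral_indicator intro!: nn_integral_cong split: split_indicator)
  moreover have "(\<lambda>x. \<integral>\<^sup>+y. indicator B' y * indicator {y. dist x y < r} y \<partial>lborel) \<in> borel_measurable borel"
    by (rule lborel.borel_measurable_nn_integral) measurable
  ultimately show ?thesis by simp
qed

text \<open>
  Both sides compute the measure of the pairs \<open>(x, y)\<close> in \<open>B \<times> C\<close> at distance less than \<open>r\<close>.
\<close>

lemma ball_overlap_symmetric:
  fixes B C :: "'a::euclidean_space set"
  assumes "B \<in> sets lebesgue" "C \<in> sets lebesgue"
  shows "(\<integral>\<^sup>+x\<in>B. emeasure lebesgue (ball x r \<inter> C) \<partial>lebesgue) = (\<integral>\<^sup>+y\<in>C. emeasure lebesgue (ball y r \<inter> B) \<partial>lebesgue)"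
proof -
  obtain B' where B'[measurable]: "B' \<in> sets borel" and B: "AE x in lebesgue. x \<in> B \<longleftrightarrow> x \<in> B'"
    using lebesgue_borel_version[OF assms(1)] by metis
  obtain C' where C'[measurable]: "C' \<in> sets borel" and C: "AE x in lebesgue. x \<in> C \<longleftrightarrow> x \<in> C'"
    using lebesgue_borel_version[OF assms(2)] by metis
  let ?k = "\<lambda>x y. indicator B' x * indicator C' y * indicator {z. dist x z < r} y :: ennreal"
  have 1: "(\<integral>\<^sup>+x\<in>B. emeasure lebesgue (ball x r \<inter> C) \<partial>lebesgue) = (\<integral>\<^sup>+x. \<integral>\<^sup>+y. ?k x y \<partial>lborel \<partial>lborel)"
  proof -
    have "(\<integral>\<^sup>+x\<in>B. emeasure lebesgue (ball x r \<inter> C) \<partial>lebesgue) = (\<integral>\<^sup>+x\<in>B'. emeasure lborel (ball x r \<inter> C') \<partial>lebesgue)"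
      by (rule nn_integral_cong_AE) (use B in eventually_elim, auto simp: indicator_def emeasure_Int_borel_version[OF assms(2) C' C])
    also have "\<dots> = (\<integral>\<^sup>+x. \<integral>\<^sup>+y. ?k x y \<partial>lborel \<partial>lborel)"
      unfolding nn_integral_completion
      by (auto simp: ball_def Int_def simp flip: nn_integral_indicator nn_integral_cmult nn_integral_multc intro!: nn_integral_cong split: split_indicator)
    finally show ?thesis .
  qed
  have 2: "(\<integral>\<^sup>+y\<in>C. emeasure lebesgue (ball y r \<inter> B) \<partial>lebesgue) = (\<integral>\<^sup>+y. \<integral>\<^sup>+x. ?k x y \<partial>lborel \<partial>lborel)"
  proof -
    have "(\<integral>\<^sup>+y\<in>C. emeasure lebesgue (ball y r \<inter> B) \<partial>lebesgue) = (\<integral>\<^sup>+y\<in>C'. emeasure lborel (ball y r \<inter> B') \<partial>lebesgue)"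
      by (rule nn_integral_cong_AE) (use C in eventually_elim, auto simp: indicator_def emeasure_Int_borel_version[OF assms(1) B' B])
    also have "\<dots> = (\<integral>\<^sup>+y. \<integral>\<^sup>+x. ?k x y \<partial>lborel \<partial>lborel)"
      unfolding nn_integral_completion
      by (auto simp: ball_def Int_def dist_commute simp flip: nn_integral_indicator nn_integral_cmult nn_integral_multc intro!: nn_integral_cong split: split_indicator)
    finally show ?thesis .
  qed
  show ?thesis unfolding 1 2
    by (rule lborel_pair.Fubini') measurable
qed

text \<open>
  The left-hand side is the measure of the pairs of \<open>x \<in> A\<close> and \<open>norm h < r\<close> with \<open>x + h \<notin> A\<close>; for fixed
  \<open>h\<close> the translation estimate applies.
\<close>

lemma ball_overlap_Diff_le_perimeter:
  fixes A :: "'a::euclidean_space set"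
  assumes A: "A \<in> lmeasurable" and P: "perimeter A \<le> ennreal P" "P \<ge> 0" and r: "r > 0"
  shows "(\<integral>\<^sup>+x\<in>A. emeasure lebesgue (ball x r \<inter> - A) \<partial>lebesgue) \<le> ennreal (r * vol (ball (0::'a) r) * P)"
proof -
  have As: "A \<in> sets lebesgue" "- A \<in> sets lebesgue" using A by (auto simp: Compl_in_sets_lebesgue)
  obtain B where B[measurable]: "B \<in> sets borel" and eq: "AE x in lebesgue. x \<in> A \<longleftrightarrow> x \<in> B"
    using lebesgue_borel_version[OF As(1)] by metis
  have eq': "AE x in lebesgue. x \<in> - A \<longleftrightarrow> x \<in> - B" using eq by eventually_elim auto
  have B'[measurable]: "- B \<in> sets borel" using B by (simp add: borel_comp)
  have Bl: "B \<in> lmeasurable" "vol B = vol A"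
    using emeasure_eq_AE[OF eq As(1)] A B by (auto simp: fmeasurable_def measure_def)
  have PB: "perimeter B \<le> ennreal P" using perimeter_cong_AE[OF As(1) _ eq] P(1) B by simp
  let ?k = "\<lambda>x h. indicator B x * indicator (ball 0 r) h * indicator (- B) (x + h) :: ennreal"
  have "(\<integral>\<^sup>+x\<in>A. emeasure lebesgue (ball x r \<inter> - A) \<partial>lebesgue) = (\<integral>\<^sup>+x\<in>B. emeasure lborel (ball x r \<inter> - B) \<partial>lebesgue)"
    by (rule nn_integral_cong_AE) (use eq in eventually_elim, auto simp: indicator_def emeasure_Int_borel_version[OF As(2) B' eq'])
  also have "\<dots> = (\<integral>\<^sup>+x. \<integral>\<^sup>+h. ?k x h \<partial>lborel \<partial>lborel)"
    unfolding nn_integral_completion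
  proof (rule nn_integral_cong)
    fix x :: 'a
    have "emeasure lborel (ball x r \<inter> - B) = (\<integral>\<^sup>+y. indicator (ball x r \<inter> - B) y \<partial>lebesgue)"
      unfolding nn_integral_completion by simp
    also have "\<dots> = (\<integral>\<^sup>+h. indicator (ball x r \<inter> - B) (x + 1 *\<^sub>R h) \<partial>lebesgue)"
    proof (subst nn_integral_affine[where c=1 and t=x])
      have "ball x r \<inter> - B \<in> sets borel" by measurable
      then show "(indicator (ball x r \<inter> - B) :: _ \<Rightarrow> ennreal) \<in> borel_measurable lebesgue"
        by (intro borel_measurable_indicator sets_completionI_sets) simp
    qed auto
    also have "\<dots> = (\<integral>\<^sup>+h. indicator (ball 0 r) h * indicator (- B) (x + h) \<partial>lborel)"
      unfolding nn_integral_completion by (intro nn_integral_cong) (auto simp: dist_norm split: split_indicator)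
    finally show "emeasure lborel (ball x r \<inter> - B) * indicator B x = (\<integral>\<^sup>+h. ?k x h \<partial>lborel)"
      by (auto split: split_indicator)
  qed
  also have "\<dots> = (\<integral>\<^sup>+h. \<integral>\<^sup>+x. ?k x h \<partial>lborel \<partial>lborel)"
  proof (rule lborel_pair.Fubini')
    have "(\<lambda>(h, x). indicator B x * indicator {h. norm h < r} h * (1 - indicator B (x + h)) :: ennreal)
        \<in> borel_measurable (borel \<Otimes>\<^sub>M borel)" by measurable
    also have "(\<lambda>(h, x). indicator B x * indicator {h. norm h < r} h * (1 - indicator B (x + h)) :: ennreal) = (\<lambda>(h, x). ?k x h)"
      by (auto simp: fun_eq_iff split: split_indicator)
    finally show "(\<lambda>(h, x). ?k x h) \<in> borel_measurable (lborel \<Otimes>\<^sub>M lborel)"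
      by (simp cong: measurable_cong_sets sets_pair_measure_cong)
  qed
  also have "\<dots> \<le> (\<integral>\<^sup>+h. ennreal (r * P) * indicator (ball (0::'a) r) h \<partial>lborel)"
  proof (rule nn_integral_mono)
    fix h :: 'a
    show "(\<integral>\<^sup>+x. ?k x h \<partial>lborel) \<le> ennreal (r * P) * indicator (ball 0 r) h"
    proof (cases "h \<in> ball 0 r")
      case True
      have m: "{x \<in> B. x + h \<notin> B} \<in> sets borel"
      proof -
        have "{x. x + h \<in> B} \<in> sets borel" by measurable
        then have "B - {x. x + h \<in> B} \<in> sets borel" using B by auto
        then show ?thesis by (auto simp: set_diff_eq)
      qed
      then have fm: "{x \<in> B. x + h \<notin> B} \<in> lmeasurable" by (intro fmeasurableI2[OF Bl(1)]) auto
      have "(\<integral>\<^sup>+x. ?k x h \<partial>lborel) = (\<integral>\<^sup>+x. indicator {x \<in> B. x + h \<notin> B} x \<partial>lborel)"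
        using True by (intro nn_integral_cong) (auto split: split_indicator)
      also have "\<dots> = emeasure lebesgue {x \<in> B. x + h \<notin> B}" using m by simp
      also have "\<dots> = ennreal (vol {x \<in> B. x + h \<notin> B})" by (rule emeasure_eq_measure2[OF fm])
      also have "\<dots> \<le> ennreal (r * P)"
      proof (rule ennreal_leI)
        have "vol {x \<in> B. x + h \<notin> B} \<le> norm h * P"
          by (rule measure_translation_Diff_le_perimeter[OF Bl(1) PB P(2)])
        also have "\<dots> \<le> r * P" using True P(2) by (intro mult_right_mono) auto
        finally show "vol {x \<in> B. x + h \<notin> B} \<le> r * P" .
      qed
      finally show ?thesis using True by simp
    qed simp
  qed
  also have "\<dots> = ennreal (r * P) * emeasure lborel (ball (0::'a) r)"
    by (simp add: nn_integral_cmult_indicator)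
  also have "\<dots> = ennreal (r * P) * ennreal (vol (ball (0::'a) r))"
    using emeasure_lborel_ball_finite[of "0::'a" r] by (simp add: emeasure_eq_ennreal_measure)
  also have "\<dots> = ennreal (r * vol (ball (0::'a) r) * P)"
    using r P by (simp add: mult_ac flip: ennreal_mult)
  finally show ?thesis .
qed

lemma measure_ball_translate: "vol (ball (x::'a::euclidean_space) r) = vol (ball (0::'a) r)"
proof (cases "r \<ge> 0")
  case True
  then show ?thesis by (simp add: content_ball_conv_unit_ball[of r x] content_ball_conv_unit_ball[of r "0::'a"])
next
  case False
  then show ?thesis by (simp add: ball_empty)
qed

text \<open>
  If \<open>A\<close> fills at most half of every ball of radius \<open>r\<close>, then the complement fills at least half of every
  ball centred in \<open>A\<close>, and the preceding estimate bounds the volume of \<open>A\<close>.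
\<close>

lemma measure_le_of_ball_overlap:
  fixes A :: "'a::euclidean_space set"
  assumes A: "A \<in> lmeasurable" and P: "perimeter A \<le> ennreal P" "P \<ge> 0" and r: "r > 0"
    and small: "\<And>x. vol (A \<inter> ball x r) \<le> vol (ball (0::'a) r) / 2"
  shows "vol A \<le> 2 * r * P"
proof -
  let ?V = "vol (ball (0::'a) r)"
  have V: "?V > 0" using content_ball_pos[OF r] by simp
  have As: "A \<in> sets lebesgue" using A by auto
  have low: "ennreal (?V / 2) \<le> emeasure lebesgue (ball x r \<inter> - A)" for x
  proof -
    have b: "ball x r \<in> lmeasurable" by simp
    have "ball x r \<inter> - A = ball x r - A \<inter> ball x r" by auto
    then have eq: "vol (ball x r \<inter> - A) = ?V - vol (A \<inter> ball x r)"
      using measurable_measure_Diff[OF b, of "A \<inter> ball x r"] sets.Int[OF As fmeasurableD[OF b]] measure_ball_translate[of x r] by auto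
    have "ball x r \<inter> - A \<in> lmeasurable" using As by (intro fmeasurable_Int_fmeasurable b) (auto simp: Compl_in_sets_lebesgue)
    moreover have "?V / 2 \<le> vol (ball x r \<inter> - A)" unfolding eq using small[of x] by simp
    ultimately show ?thesis by (simp add: emeasure_eq_measure2 ennreal_leI)
  qed
  have "ennreal (?V / 2 * vol A) = ennreal (?V/2) * emeasure lebesgue A"
    using V by (subst emeasure_eq_measure2[OF A], subst ennreal_mult[symmetric]) auto
  also have "\<dots> = (\<integral>\<^sup>+x\<in>A. ennreal (?V/2) \<partial>lebesgue)" using As by (simp add: nn_integral_cmult_indicator)
  also have "\<dots> \<le> (\<integral>\<^sup>+x\<in>A. emeasure lebesgue (ball x r \<inter> - A) \<partial>lebesgue)"
    by (intro nn_integral_mono mult_right_mono low) auto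
  also have "\<dots> \<le> ennreal (r * ?V * P)" by (rule ball_overlap_Diff_le_perimeter[OF A P r])
  finally have "?V / 2 * vol A \<le> r * ?V * P" using r V P by (simp add: ennreal_le_iff)
  then have "?V * vol A \<le> ?V * (2 * r * P)" by (simp add: mult_ac)
  then show ?thesis using V by simp
qed

lemma concentration:
  fixes A :: "'a::euclidean_space set"
  assumes A: "A \<in> lmeasurable" and P: "perimeter A \<le> ennreal P" "P \<ge> 0" and r: "r > 0"
    and "2 * r * P < vol A"
  obtains x where "vol (A \<inter> ball x r) > vol (ball (0::'a) r) / 2"
  using measure_le_of_ball_overlap[OF A P r] assms(5) by (meson linorder_not_less)

text \<open>
  A ball with twice the volume of \<open>A\<close> is never more than half filled by \<open>A\<close>. The constant is not the sharp
  one.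
\<close>

lemma isoperimetric_inequality:
  obtains c :: real where "c > 0"
    "\<And>(A :: 'a::euclidean_space set) P. A \<in> lmeasurable \<Longrightarrow> perimeter A \<le> ennreal P \<Longrightarrow> P \<ge> 0 \<Longrightarrow>
      c * vol A powr (1 - 1 / DIM('a)) \<le> P"
proof
  define \<omega> where "\<omega> = vol (ball (0::'a) 1)"
  have \<omega>: "\<omega> > 0" unfolding \<omega>_def using content_ball_pos[of 1 "0::'a"] by simp
  define c where "c = (\<omega> / 2) powr (1 / DIM('a)) / 2"
  show "c > 0" using \<omega> by (simp add: c_def)
  fix A :: "'a set" and P assume A: "A \<in> lmeasurable" "perimeter A \<le> ennreal P" "P \<ge> 0"
  let ?m = "vol A"
  show "c * ?m powr (1 - 1 / DIM('a)) \<le> P"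
  proof (cases "?m = 0")
    case True
    then show ?thesis using A by simp
  next
    case False
    then have m: "?m > 0" by (simp add: less_le)
    \<comment> \<open>The radius of a ball with volume \<open>2 * vol A\<close>.\<close>
    define r where "r = (2 * ?m / \<omega>) powr (1 / DIM('a))"
    have r: "r > 0" using m \<omega> by (simp add: r_def)
    have "r ^ DIM('a) = r powr (real DIM('a))" using r by (simp add: powr_realpow)
    also have "\<dots> = 2 * ?m / \<omega>" using m \<omega> by (simp add: r_def powr_powr)
    finally have "vol (ball (0::'a) r) = 2 * ?m"
      using content_ball_conv_unit_ball[of r "0::'a"] r \<omega> by (simp add: \<omega>_def)
    moreover have "vol (A \<inter> ball x r) \<le> ?m" for x
      using A(1) by (intro measure_mono_fmeasurable) auto
    ultimately have "?m \<le> 2 * r * P" by (intro measure_le_of_ball_overlap[OF A r]) simp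
    then have "?m / (2 * r) \<le> P" using r by (simp add: divide_simps mult.commute)
    moreover have "c * ?m powr (1 - 1 / DIM('a)) = ?m / (2 * r)"
    proof -
      have "c * ?m powr (1 - 1 / DIM('a)) = (\<omega> / 2) powr (1 / DIM('a)) / 2 * (?m / ?m powr (1 / DIM('a)))"
        using m by (simp add: c_def powr_diff)
      also have "(\<omega> / 2) powr (1 / DIM('a)) = ?m powr (1 / DIM('a)) / r"
        using m \<omega> by (simp add: r_def powr_divide powr_mult divide_simps)
      finally show ?thesis using m r by simp
    qed
    ultimately show ?thesis by simp
  qed
qed

section \<open>Compactness of sets of bounded perimeter\<close>

lemma ball_overlap_diff_le:
  fixes A :: "'a::euclidean_space set"
  assumes A: "A \<in> sets lebesgue" and "dist x y < \<eta>" "r \<ge> 0"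
  shows "vol (A \<inter> ball x r) - vol (A \<inter> ball y r)
    \<le> vol (ball (0::'a) (r + \<eta>)) - vol (ball (0::'a) r)"
proof -
  have lm: "A \<inter> ball z s \<in> lmeasurable" for z s using A by (metis Int_commute fmeasurable_Int_fmeasurable lmeasurable_ball)
  have "A \<inter> ball x r \<subseteq> (A \<inter> ball y r) \<union> (ball y (r + \<eta>) - ball y r)"
  proof
    fix z assume "z \<in> A \<inter> ball x r"
    moreover have "dist y z \<le> dist x y + dist x z" by (metis dist_commute dist_triangle)
    ultimately show "z \<in> (A \<inter> ball y r) \<union> (ball y (r + \<eta>) - ball y r)" using assms(2) by auto
  qed
  then have "vol (A \<inter> ball x r) \<le> vol ((A \<inter> ball y r) \<union> (ball y (r + \<eta>) - ball y r))"
    using fmeasurableD[OF lm] by (intro measure_mono_fmeasurable fmeasurable.Un fmeasurable.Diff lm lmeasurable_ball)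
  also have "\<dots> \<le> vol (A \<inter> ball y r) + vol (ball y (r + \<eta>) - ball y r)"
    using lm by (intro measure_Un_le) auto
  also have "vol (ball y (r + \<eta>) - ball y r) = vol (ball y (r + \<eta>)) - vol (ball y r)"
  proof (rule measurable_measure_Diff)
    have "\<eta> > 0" using assms(2) zero_le_dist[of x y] by linarith
    then show "ball y r \<subseteq> ball y (r + \<eta>)" by (intro subset_ball) simp
  qed auto
  finally show ?thesis by (simp add: measure_ball_translate[of y])
qed

text \<open>
  A diagonal sequence makes the overlaps with countably many balls converge. Overlaps are equicontinuous
  in the centre of the ball, so they converge for all centres.
\<close>

lemma ball_overlap_convergent:
  fixes A :: "nat \<Rightarrow> 'a::euclidean_space set"
  assumes A: "\<And>n. A n \<in> sets lebesgue"
  obtains s :: "nat \<Rightarrow> nat" where "strict_mono s"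
    "\<And>x k. convergent (\<lambda>n. vol (A (s n) \<inter> ball x (1 / real (Suc k))))"
proof -
  let ?a = "\<lambda>n x k. vol (A n \<inter> ball x (1 / real (Suc k)))"
  obtain D :: "'a set" where D: "countable D" "\<And>X. open X \<Longrightarrow> X \<noteq> {} \<Longrightarrow> \<exists>d\<in>D. d \<in> X"
    using countable_dense_setE by metis
  have Dne: "D \<noteq> {}" using D(2)[of UNIV] by auto
  define d where "d i = from_nat_into D (fst (prod_decode i))" for i
  define k where "k i = snd (prod_decode i)" for i
  have dk: "\<exists>i. d i = q \<and> k i = j" if q: "q \<in> D" for q j
  proof -
    obtain m where "from_nat_into D m = q" using from_nat_into_surj[OF D(1) q] by blast
    then show ?thesis by (intro exI[of _ "prod_encode (m, j)"]) (simp add: d_def k_def)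
  qed
  let ?P = "\<lambda>i s. convergent (\<lambda>n. ?a (s n) (d i) (k i))"
  interpret subseqs ?P
  proof
    fix i and s :: "nat \<Rightarrow> nat" assume "strict_mono s"
    have "bounded (range (\<lambda>n. ?a (s n) (d i) (k i)))"
    proof (rule boundedI)
      fix y assume "y \<in> range (\<lambda>n. ?a (s n) (d i) (k i))"
      then obtain n where y: "y = ?a (s n) (d i) (k i)" by auto
      have "?a (s n) (d i) (k i) \<le> vol (ball (d i) (1 / real (Suc (k i))))"
        using A by (intro measure_mono_fmeasurable) auto
      then show "norm y \<le> vol (ball (d i) (1 / real (Suc (k i))))" using y by simp
    qed
    from bounded_imp_convergent_subsequence[OF this]
    obtain l r where "strict_mono r" "((\<lambda>n. ?a (s n) (d i) (k i)) \<circ> r) \<longlonglongrightarrow> l" by metis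
    then show "\<exists>r'. strict_mono r' \<and> ?P i (s \<circ> r')" unfolding comp_def convergent_def by blast
  qed
  have conv: "convergent (\<lambda>n. ?a (diagseq n) (d i) (k i))" for i
  proof -
    have "?P i (diagseq \<circ> (+) (Suc i))"
    proof (rule diagseq_holds)
      show "?P n (s \<circ> r)" if "strict_mono r" "?P n s" for r s n
        using convergent_subseq_convergent[OF that(2) that(1)] by (simp add: comp_def)
    qed
    then have "convergent (\<lambda>n. ?a (diagseq (n + Suc i)) (d i) (k i))" by (simp add: comp_def add.commute)
    then show ?thesis using convergent_ignore_initial_segment[of "\<lambda>n. ?a (diagseq n) (d i) (k i)" "Suc i"] by simp
  qed
  show ?thesis
  proof (rule that[OF subseq_diagseq])
    fix x :: 'a and j :: nat
    define r where "r = 1 / real (Suc j)"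
    have r: "r \<ge> 0" by (simp add: r_def)
    have "Cauchy (\<lambda>n. ?a (diagseq n) x j)"
    proof (rule metric_CauchyI)
      fix e :: real assume e: "e > 0"
      define V where "V t = vol (ball (0::'a) t)" for t
      have Vt: "V t = t ^ DIM('a) * vol (ball (0::'a) 1)" if "t \<ge> 0" for t
        unfolding V_def using content_ball_conv_unit_ball[OF that, of "0::'a"] by simp
      have "((\<lambda>t. t ^ DIM('a) * vol (ball (0::'a) 1)) \<longlongrightarrow> r ^ DIM('a) * vol (ball (0::'a) 1)) (at_right r)"
        by (intro tendsto_intros)
      then have "\<forall>\<^sub>F t in at_right r. t ^ DIM('a) * vol (ball (0::'a) 1) < V r + e/3"
        using e Vt[OF r] by (simp add: order_tendsto_iff)
      then obtain b where b: "b > r" "\<And>t. r < t \<Longrightarrow> t < b \<Longrightarrow> t ^ DIM('a) * vol (ball (0::'a) 1) < V r + e/3"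
        unfolding eventually_at_right_field by blast
      define \<eta> where "\<eta> = (b - r) / 2"
      have \<eta>: "\<eta> > 0" using b by (simp add: \<eta>_def)
      have "r + \<eta> < b" using b(1) by (simp add: \<eta>_def field_simps)
      then have Vb: "V (r + \<eta>) - V r < e/3" using b(2)[of "r + \<eta>"] \<eta> r Vt[of "r + \<eta>"] by simp
      obtain q where q: "q \<in> D" "dist x q < \<eta>" using D(2)[of "ball x \<eta>"] \<eta> by auto
      obtain i where i: "d i = q" "k i = j" using dk[OF q(1)] by blast
      have close: "\<bar>?a n x j - ?a n q j\<bar> < e/3" for n
      proof -
        have "?a n x j - ?a n q j \<le> V (r + \<eta>) - V r"
          unfolding V_def using ball_overlap_diff_le[OF A q(2) r, of n] by (simp add: r_def)
        moreover have "dist q x < \<eta>" using q(2) by (simp add: dist_commute)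
        then have "?a n q j - ?a n x j \<le> V (r + \<eta>) - V r"
          unfolding V_def using ball_overlap_diff_le[OF A _ r, of q x \<eta> n] by (simp add: r_def)
        ultimately show ?thesis using Vb by linarith
      qed
      have "Cauchy (\<lambda>n. ?a (diagseq n) q j)" using conv[of i] unfolding i by (rule convergent_Cauchy)
      from metric_CauchyD[OF this, of "e/3"] e
      obtain M where M: "\<forall>m\<ge>M. \<forall>n\<ge>M. dist (?a (diagseq m) q j) (?a (diagseq n) q j) < e/3" by auto
      have "dist (?a (diagseq m) x j) (?a (diagseq n) x j) < e" if "m \<ge> M" "n \<ge> M" for m n
        using M[rule_format, OF that] close[of "diagseq m"] close[of "diagseq n"] unfolding dist_real_def by linarith
      then show "\<exists>M. \<forall>m\<ge>M. \<forall>n\<ge>M. dist (?a (diagseq m) x j) (?a (diagseq n) x j) < e" by blast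
    qed
    then show "convergent (\<lambda>n. ?a (diagseq n) x j)" by (rule Cauchy_convergent)
  qed
qed

lemma ball_overlap_real_measurable:
  fixes A :: "'a::euclidean_space set"
  assumes "A \<in> sets lebesgue"
  shows "(\<lambda>x. vol (A \<inter> ball x r)) \<in> borel_measurable lebesgue"
proof -
  have "(\<lambda>x. emeasure lebesgue (ball x r \<inter> A)) \<in> borel_measurable lebesgue"
    using ball_overlap_measurable[OF assms, of r] by (intro measurable_completion) (simp only: measurable_lborel1 measurable_lborel2)
  then have "(\<lambda>x. enn2real (emeasure lebesgue (ball x r \<inter> A))) \<in> borel_measurable lebesgue"
    by measurable
  then show ?thesis by (simp add: measure_def Int_commute)
qed

text \<open>
  The overlap with a ball of radius \<open>r\<close>, divided by the volume of the ball, is a local average of the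
  indicator, and by the translation estimate it is close to the indicator in the mean. Two sets with
  close averages are therefore close to each other.
\<close>

lemma measure_Diff_le_ball_overlap:
  fixes A A' :: "'a::euclidean_space set"
  assumes A: "A \<in> lmeasurable" "perimeter A \<le> ennreal p" and A': "A' \<in> lmeasurable" "perimeter A' \<le> ennreal p"
    and p: "p \<ge> 0" and r: "r > 0" and B: "B \<in> lmeasurable"
  shows "vol (ball (0::'a) r) * vol ((A - A') \<inter> B)
    \<le> 2 * r * vol (ball (0::'a) r) * p
      + (\<integral>x. indicator B x * \<bar>vol (A \<inter> ball x r) - vol (A' \<inter> ball x r)\<bar> \<partial>lebesgue)"
proof -
  let ?V = "vol (ball (0::'a) r)"
  let ?f = "\<lambda>S x. vol (S \<inter> ball x r)"
  let ?D = "(A - A') \<inter> B"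
  have As: "A \<in> sets lebesgue" "A' \<in> sets lebesgue" "B \<in> sets lebesgue" "- A \<in> sets lebesgue" "- A' \<in> sets lebesgue"
    using A A' B by (auto simp: Compl_in_sets_lebesgue)
  have fV: "0 \<le> ?f S x" "?f S x \<le> ?V" if "S \<in> sets lebesgue" for S :: "'a set" and x
  proof -
    have "?f S x \<le> vol (ball x r)" using that by (intro measure_mono_fmeasurable) auto
    then show "?f S x \<le> ?V" by (simp add: measure_ball_translate[of x])
  qed simp
  have em: "emeasure lebesgue (ball x r \<inter> S) = ennreal (?f S x)" if "S \<in> sets lebesgue" for S :: "'a set" and x
  proof -
    have "ball x r \<inter> S \<in> lmeasurable" using that by (intro fmeasurable_Int_fmeasurable) auto
    then show ?thesis by (simp add: emeasure_eq_measure2 Int_commute)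
  qed
  have emV: "ennreal ?V = emeasure lebesgue (ball x r \<inter> - A) + ennreal (?f A x)" for x
  proof -
    have "emeasure lebesgue (ball x r \<inter> - A) + emeasure lebesgue (ball x r \<inter> A)
        = emeasure lebesgue ((ball x r \<inter> - A) \<union> (ball x r \<inter> A))"
      using As by (intro plus_emeasure sets.Int fmeasurableD[OF lmeasurable_ball]) auto
    also have "(ball x r \<inter> - A) \<union> (ball x r \<inter> A) = ball x r" by auto
    finally have "emeasure lebesgue (ball x r) = emeasure lebesgue (ball x r \<inter> - A) + emeasure lebesgue (ball x r \<inter> A)" ..
    moreover have "emeasure lebesgue (ball x r) = ennreal ?V"
      using emeasure_eq_measure2[OF lmeasurable_ball, of x r] by (simp add: measure_ball_translate[of x])
    ultimately show ?thesis by (simp add: em[OF As(1)])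
  qed
  let ?d = "\<lambda>x. \<bar>?f A x - ?f A' x\<bar>"
  have dm[measurable]: "(\<lambda>x. indicator B x * ?d x) \<in> borel_measurable lebesgue"
    using ball_overlap_real_measurable[OF As(1), of r] ball_overlap_real_measurable[OF As(2), of r] As(3) by measurable
  have dint: "integrable lebesgue (\<lambda>x. indicator B x * ?d x)"
  proof (rule Bochner_Integration.integrable_bound[OF _ dm])
    show "integrable lebesgue (\<lambda>x. indicator B x * (2 * ?V))"
      using B by (intro integrable_mult_left integrable_real_indicator) (auto simp: fmeasurable_def)
    have "?d x \<le> 2 * ?V" for x using fV[OF As(1), of x] fV[OF As(2), of x] by linarith
    then show "AE x in lebesgue. norm (indicator B x * ?d x) \<le> norm (indicator B x * (2 * ?V))"
      by (intro always_eventually) (auto simp: indicator_def)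
  qed
  have mo: "(\<lambda>x. emeasure lebesgue (ball x r \<inter> S)) \<in> borel_measurable lebesgue" if "S \<in> sets lebesgue" for S :: "'a set"
    using ball_overlap_measurable[OF that, of r] by (intro measurable_completion) (simp only: measurable_lborel1 measurable_lborel2)
  have Dm: "?D \<in> lmeasurable" by (intro fmeasurable_Int_fmeasurable fmeasurable.Diff A A' As)
  have "ennreal (?V * vol ?D) = (\<integral>\<^sup>+x. ennreal ?V * indicator ?D x \<partial>lebesgue)"
    using Dm by (simp add: nn_integral_cmult_indicator emeasure_eq_measure2 ennreal_mult')
  also have "\<dots> \<le> (\<integral>\<^sup>+x. emeasure lebesgue (ball x r \<inter> - A) * indicator A x
      + emeasure lebesgue (ball x r \<inter> A') * indicator (- A') x + ennreal (indicator B x * ?d x) \<partial>lebesgue)"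
  proof (rule nn_integral_mono)
    fix x
    have "ennreal (?f A x) \<le> ennreal (?f A' x) + ennreal (?d x)"
      unfolding ennreal_plus[OF measure_nonneg abs_ge_zero, symmetric] by (rule ennreal_leI) linarith
    then have "ennreal ?V \<le> emeasure lebesgue (ball x r \<inter> - A) + (ennreal (?f A' x) + ennreal (?d x))"
      unfolding emV[of x] by (rule add_left_mono)
    then show "ennreal ?V * indicator ?D x \<le> emeasure lebesgue (ball x r \<inter> - A) * indicator A x
      + emeasure lebesgue (ball x r \<inter> A') * indicator (- A') x + ennreal (indicator B x * ?d x)"
      by (auto simp: indicator_def em[OF As(2)] add.assoc)
  qed
  also have "\<dots> = (\<integral>\<^sup>+x\<in>A. emeasure lebesgue (ball x r \<inter> - A) \<partial>lebesgue)
      + (\<integral>\<^sup>+x\<in>- A'. emeasure lebesgue (ball x r \<inter> A') \<partial>lebesgue) + (\<integral>\<^sup>+x. ennreal (indicator B x * ?d x) \<partial>lebesgue)"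
  proof -
    have m: "(\<lambda>x. emeasure lebesgue (ball x r \<inter> - A) * indicator A x) \<in> borel_measurable lebesgue"
      "(\<lambda>x. emeasure lebesgue (ball x r \<inter> A') * indicator (- A') x) \<in> borel_measurable lebesgue"
      by (intro borel_measurable_times_ennreal mo As borel_measurable_indicator)+
    have m3: "(\<lambda>x. ennreal (indicator B x * ?d x)) \<in> borel_measurable lebesgue" using dm by simp
    show ?thesis
      by (simp only: nn_integral_add[OF borel_measurable_add[OF m] m3] nn_integral_add[OF m])
  qed
  also have "(\<integral>\<^sup>+x\<in>- A'. emeasure lebesgue (ball x r \<inter> A') \<partial>lebesgue) = (\<integral>\<^sup>+x\<in>A'. emeasure lebesgue (ball x r \<inter> - A') \<partial>lebesgue)"
    by (rule ball_overlap_symmetric[OF As(5,2)])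
  also have "(\<integral>\<^sup>+x. ennreal (indicator B x * ?d x) \<partial>lebesgue) = ennreal (\<integral>x. indicator B x * ?d x \<partial>lebesgue)"
    by (rule nn_integral_eq_integral[OF dint]) (auto simp: indicator_def)
  also have "(\<integral>\<^sup>+x\<in>A. emeasure lebesgue (ball x r \<inter> - A) \<partial>lebesgue)
      + (\<integral>\<^sup>+x\<in>A'. emeasure lebesgue (ball x r \<inter> - A') \<partial>lebesgue) + ennreal (\<integral>x. indicator B x * ?d x \<partial>lebesgue)
      \<le> ennreal (r * ?V * p) + ennreal (r * ?V * p) + ennreal (\<integral>x. indicator B x * ?d x \<partial>lebesgue)"
    by (intro add_mono ball_overlap_Diff_le_perimeter[OF A p r] ball_overlap_Diff_le_perimeter[OF A' p r]) auto
  also have "\<dots> = ennreal (2 * r * ?V * p + (\<integral>x. indicator B x * ?d x \<partial>lebesgue))"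
    using r p by (simp add: algebra_simps integral_nonneg_AE flip: ennreal_plus)
  finally show ?thesis using r p by (subst (asm) ennreal_le_iff) (auto intro!: add_nonneg_nonneg integral_nonneg_AE)
qed

text \<open>
  Along the diagonal sequence the averages at each scale converge, so on every bounded set the sequence is
  Cauchy in measure. A subsequence with summable differences converges almost everywhere by the
  Borel-Cantelli lemma.
\<close>

lemma perimeter_compactness:
  fixes A :: "nat \<Rightarrow> 'a::euclidean_space set"
  assumes A: "\<And>n. A n \<in> lmeasurable" and P: "\<And>n. perimeter (A n) \<le> ennreal p" "p \<ge> 0"
  obtains s :: "nat \<Rightarrow> nat" and B where "strict_mono s" "B \<in> sets lebesgue"
    "AE x in lebesgue. (\<lambda>n. indicator (A (s n)) x :: real) \<longlonglongrightarrow> indicator B x"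
proof -
  have As: "A n \<in> sets lebesgue" for n using A by auto
  obtain s where s: "strict_mono s"
    "\<And>x k. convergent (\<lambda>n. vol (A (s n) \<inter> ball x (1 / real (Suc k))))"
    using ball_overlap_convergent[of A] As by blast
  have cauchy: "\<exists>M. \<forall>n\<ge>M. \<forall>m\<ge>M. vol ((A (s n) - A (s m)) \<inter> B) < e"
    if B: "B \<in> lmeasurable" and e: "e > 0" for B e
  proof -
    \<comment> \<open>The scale \<open>r = 1 / (k + 1)\<close> is chosen so small that replacing both sets by their averages costs at
      most \<open>e / 2\<close>.\<close>
    obtain k where k: "(4 * p + 1) / e < real (Suc k)" using reals_Archimedean2 by (metis less_Suc_eq of_nat_less_iff order_less_trans)
    define r where "r = 1 / real (Suc k)"
    have r: "r > 0" by (simp add: r_def)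
    have "4 * p + 1 < e * real (Suc k)" using k e by (simp add: divide_simps mult.commute del: of_nat_Suc)
    then have rp: "4 * p * r < e" unfolding r_def using P(2) by (simp add: divide_simps del: of_nat_Suc)
    define V where "V = vol (ball (0::'a) r)"
    have V: "V > 0" unfolding V_def using content_ball_pos[OF r] by simp
    define f where "f n x = vol (A (s n) \<inter> ball x r)" for n x
    have fm[measurable]: "f n \<in> borel_measurable lebesgue" for n
      unfolding f_def by (rule ball_overlap_real_measurable[OF As])
    have fV: "0 \<le> f n x" "f n x \<le> V" for n x
    proof -
      have "f n x \<le> vol (ball x r)" unfolding f_def using As by (intro measure_mono_fmeasurable) auto
      then show "f n x \<le> V" by (simp add: V_def measure_ball_translate[of x])
    qed (simp add: f_def)
    define F where "F x = lim (\<lambda>n. f n x)" for x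
    have lim: "(\<lambda>n. f n x) \<longlonglongrightarrow> F x" for x
      unfolding F_def f_def r_def by (rule convergent_LIMSEQ_iff[THEN iffD1, OF s(2)])
    have Fm[measurable]: "F \<in> borel_measurable lebesgue" by (rule borel_measurable_LIMSEQ_real[OF lim fm])
    have FV: "0 \<le> F x" "F x \<le> V" for x
      using LIMSEQ_le_const[OF lim] LIMSEQ_le_const2[OF lim] fV by blast+
    have fF: "\<bar>f n x - F x\<bar> \<le> V" for n x using fV[of n x] FV[of x] by linarith
    have Bm[measurable]: "B \<in> sets lebesgue" using B by auto
    have Bi: "integrable lebesgue (\<lambda>x. indicator B x * V)"
      using B by (intro integrable_mult_left integrable_real_indicator) (auto simp: fmeasurable_def)
    have "(\<lambda>n. \<integral>x. indicator B x * \<bar>f n x - F x\<bar> \<partial>lebesgue) \<longlonglongrightarrow> integral\<^sup>L lebesgue (\<lambda>x::'a. 0)"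
    proof (rule integral_dominated_convergence[OF _ _ Bi])
      show "AE x in lebesgue. (\<lambda>n. indicator B x * \<bar>f n x - F x\<bar>) \<longlonglongrightarrow> 0"
      proof (intro always_eventually allI)
        fix x
        have "(\<lambda>n. \<bar>f n x - F x\<bar>) \<longlonglongrightarrow> 0" using lim[of x] by (simp add: LIM_zero tendsto_rabs_zero)
        then show "(\<lambda>n. indicator B x * \<bar>f n x - F x\<bar>) \<longlonglongrightarrow> 0" by (rule tendsto_mult_right_zero)
      qed
      show "AE x in lebesgue. norm (indicator B x * \<bar>f n x - F x\<bar>) \<le> indicator B x * V" for n
        using fF[of n] by (intro always_eventually allI) (auto simp: indicator_def)
    qed auto
    then have "\<forall>\<^sub>F n in sequentially. (\<integral>x. indicator B x * \<bar>f n x - F x\<bar> \<partial>lebesgue) < V * e / 4"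
      using V e by (intro order_tendstoD(2)) auto
    then obtain M where M: "\<And>n. n \<ge> M \<Longrightarrow> (\<integral>x. indicator B x * \<bar>f n x - F x\<bar> \<partial>lebesgue) < V * e / 4"
      by (auto simp: eventually_sequentially)
    have fFi: "integrable lebesgue (\<lambda>x. indicator B x * \<bar>f n x - F x\<bar>)" for n
    proof (rule Bochner_Integration.integrable_bound[OF Bi])
      show "AE x in lebesgue. norm (indicator B x * \<bar>f n x - F x\<bar>) \<le> norm (indicator B x * V)"
        using V fF[of n] by (intro always_eventually allI) (auto simp: indicator_def)
    qed measurable
    have "vol ((A (s n) - A (s m)) \<inter> B) < e" if nm: "n \<ge> M" "m \<ge> M" for n m
    proof -
      have "(\<integral>x. indicator B x * \<bar>f n x - f m x\<bar> \<partial>lebesgue)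
        \<le> (\<integral>x. indicator B x * \<bar>f n x - F x\<bar> + indicator B x * \<bar>f m x - F x\<bar> \<partial>lebesgue)"
        using fFi by (intro integral_mono') (auto simp: indicator_def)
      also have "\<dots> < V * e / 4 + V * e / 4" using fFi M[OF nm(1)] M[OF nm(2)] by simp
      finally have 1: "(\<integral>x. indicator B x * \<bar>f n x - f m x\<bar> \<partial>lebesgue) < V * (e / 2)" by simp
      have "V * vol ((A (s n) - A (s m)) \<inter> B) \<le> 2 * r * V * p + (\<integral>x. indicator B x * \<bar>f n x - f m x\<bar> \<partial>lebesgue)"
        unfolding V_def f_def by (rule measure_Diff_le_ball_overlap[OF A P(1) A P(1) P(2) r B])
      also have "2 * r * V * p = V * (4 * p * r / 2)" by simp
      also have "\<dots> + (\<integral>x. indicator B x * \<bar>f n x - f m x\<bar> \<partial>lebesgue) < V * (4 * p * r / 2) + V * (e/2)"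
        using 1 by simp
      also have "\<dots> < V * (e / 2) + V * (e / 2)" using rp V by (intro add_strict_right_mono mult_strict_left_mono) auto
      also have "\<dots> = V * e" by simp
      finally show ?thesis using V by simp
    qed
    then show ?thesis by blast
  qed
  have "\<forall>j. \<exists>M. \<forall>n\<ge>M. \<forall>m\<ge>M. vol ((A (s n) - A (s m)) \<inter> ball 0 (real j)) < (1/2)^j"
    using cauchy by simp
  from choice[OF this] obtain M where M: "\<And>j n m. n \<ge> M j \<Longrightarrow> m \<ge> M j \<Longrightarrow>
      vol ((A (s n) - A (s m)) \<inter> ball 0 (real j)) < (1/2)^j" by blast
  \<comment> \<open>Indices that increase strictly and are so large that, in the ball of radius \<open>j\<close>, the \<open>j\<close>-th set
    exceeds the next one, and conversely, by less than \<open>(1/2) ^ j\<close> in volume.\<close>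
  define t where "t = rec_nat (M 0) (\<lambda>j x. max (Suc x) (M (Suc j)))"
  have t: "strict_mono t" "t j \<ge> M j" for j
  proof -
    show "strict_mono t" by (rule strict_mono_Suc_iff[THEN iffD2]) (simp add: t_def less_max_iff_disj)
    show "t j \<ge> M j" by (cases j) (simp_all add: t_def)
  qed
  let ?C = "\<lambda>j. A (s (t j))"
  define E where "E j = ((?C j - ?C (Suc j)) \<inter> ball 0 (real j)) \<union> ((?C (Suc j) - ?C j) \<inter> ball 0 (real j))" for j
  have Elm: "(?C i - ?C l) \<inter> ball 0 (real j) \<in> lmeasurable" for i j l
    by (intro fmeasurable_Int_fmeasurable fmeasurable.Diff A fmeasurableD[OF lmeasurable_ball])
  have Em: "E j \<in> lmeasurable" for j unfolding E_def by (intro fmeasurable.Un Elm)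
  have Ele: "vol (E j) \<le> 2 * (1/2)^j" for j
  proof -
    have "t (Suc j) \<ge> M j" using t(2)[of j] strict_monoD[OF t(1), of j "Suc j"] by simp
    then have "vol ((?C j - ?C (Suc j)) \<inter> ball 0 (real j)) < (1/2)^j"
      "vol ((?C (Suc j) - ?C j) \<inter> ball 0 (real j)) < (1/2)^j"
      using M t(2)[of j] by blast+
    then show ?thesis using measure_Un_le[OF fmeasurableD[OF Elm] fmeasurableD[OF Elm], of j "Suc j" j "Suc j" j j] unfolding E_def by linarith
  qed
  have ae: "AE x in lebesgue. \<forall>\<^sub>F j in sequentially. x \<in> space lebesgue - E j"
  proof (rule borel_cantelli_AE1)
    show "E j \<in> sets lebesgue" for j by (rule fmeasurableD[OF Em])
    show "emeasure lebesgue (E j) < \<infinity>" for j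
      unfolding infinity_ennreal_def less_top[symmetric] by (rule fmeasurableD2[OF Em])
    show "summable (\<lambda>j. vol (E j))"
      by (rule summable_comparison_test'[of "\<lambda>j. 2 * (1/2::real)^j" 0]) (use Ele in \<open>auto intro!: summable_mult summable_geometric\<close>)
  qed
  define B where "B = {x. \<exists>J. \<forall>j\<ge>J. x \<in> ?C j}"
  have "B = (\<Union>J. \<Inter>j\<in>{J..}. ?C j)" by (auto simp: B_def)
  then have Bs: "B \<in> sets lebesgue" using As by (auto intro!: sets.countable_UN sets.countable_INT)
  from ae have "AE x in lebesgue. (\<lambda>n. indicator (?C n) x :: real) \<longlonglongrightarrow> indicator B x"
  proof eventually_elim
    case (elim x)
    obtain J where J: "\<And>j. j \<ge> J \<Longrightarrow> x \<notin> E j" using elim by (auto simp: eventually_sequentially)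
    obtain K where K: "norm x < real K" using reals_Archimedean2 by blast
    define L where "L = max J K"
    have step: "x \<in> ?C (Suc j) \<longleftrightarrow> x \<in> ?C j" if "j \<ge> L" for j
    proof -
      have "real K \<le> real j" using that by (simp add: L_def)
      then have "x \<in> ball 0 (real j)" using K by simp
      then show ?thesis using J[of j] that unfolding E_def L_def by auto
    qed
    have const: "x \<in> ?C j \<longleftrightarrow> x \<in> ?C L" if "j \<ge> L" for j
      using that by (induction j rule: dec_induct) (use step in auto)
    have xB: "x \<in> B \<longleftrightarrow> x \<in> ?C L"
    proof
      assume "x \<in> B"
      then obtain J' where "\<forall>j\<ge>J'. x \<in> ?C j" by (auto simp: B_def)
      then have "x \<in> ?C (max J' L)" by simp
      then show "x \<in> ?C L" using const[of "max J' L"] by simp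
    next
      assume "x \<in> ?C L"
      then show "x \<in> B" unfolding B_def using const by blast
    qed
    have "\<forall>\<^sub>F j in sequentially. indicator (?C j) x = (indicator B x :: real)"
      using eventually_ge_at_top[of L]
    proof eventually_elim
      case (elim j)
      have "x \<in> ?C j \<longleftrightarrow> x \<in> B" using const[OF elim] xB by blast
      then show ?case by (simp only: indicator_def)
    qed
    then show ?case by (rule tendsto_eventually)
  qed
  moreover have "strict_mono (\<lambda>j. s (t j))" using strict_mono_o[OF s(1) t(1)] by (simp add: comp_def)
  ultimately show ?thesis using that[of "\<lambda>j. s (t j)" B] Bs by blast
qed

section \<open>The interaction and the energy\<close>

lemma AE_translate:
  fixes P :: "'a::euclidean_space \<Rightarrow> bool"
  assumes "AE z in lebesgue. P z"
  shows "AE y in lebesgue. P (y - x)"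
proof -
  obtain N where N: "N \<in> null_sets lebesgue" "{z. \<not> P z} \<subseteq> N"
    using assms unfolding eventually_ae_filter by auto
  have "negligible ((+) x ` N)" using N(1) by (intro negligible_translation) (simp add: negligible_iff_null_sets)
  then have "(+) x ` N \<in> null_sets lebesgue" by (simp add: negligible_iff_null_sets)
  moreover have "{y. \<not> P (y - x)} \<subseteq> (+) x ` N"
  proof
    fix y assume "y \<in> {y. \<not> P (y - x)}"
    then have "y - x \<in> N" using N(2) by auto
    then show "y \<in> (+) x ` N" by (intro image_eqI[of _ _ "y - x"]) auto
  qed
  ultimately show ?thesis unfolding eventually_ae_filter by auto
qed

locale riesz_energy =
  fixes g :: "'a::euclidean_space \<Rightarrow> real" and \<epsilon> :: real
  assumes dim: "DIM('a) \<ge> 2"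
    and g_measurable: "g \<in> borel_measurable (lebesgue_on (- {0}))"
    and g_admissible: "admissible g"
    and g_decreasing: "radially_decreasing g"
    and \<epsilon>_pos: "\<epsilon> > 0"
begin

lemma kernel_measurable: "(\<lambda>x. ennreal (g x)) \<in> borel_measurable lebesgue"
proof -
  have "(\<lambda>x. if x \<in> - {0} then g x else 0) \<in> borel_measurable lebesgue"
    by (rule borel_measurable_if_I[OF g_measurable]) (auto simp: Compl_in_sets_lebesgue)
  moreover have "(\<lambda>x. g 0 * indicator {0} x) \<in> borel_measurable lebesgue"
    by (intro borel_measurable_times borel_measurable_const borel_measurable_indicator) auto
  ultimately have "(\<lambda>x. (if x \<in> - {0} then g x else 0) + g 0 * indicator {0} x) \<in> borel_measurable lebesgue"
    by (rule borel_measurable_add)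
  also have "(\<lambda>x. (if x \<in> - {0} then g x else 0) + g 0 * indicator {0} x) = g" by auto
  finally show ?thesis by simp
qed

lemma kernel_translate_measurable: "(\<lambda>y. ennreal (g (y - x))) \<in> borel_measurable lebesgue"
proof -
  have "(\<lambda>y. ennreal (g (- x + 1 *\<^sub>R y))) \<in> borel_measurable lebesgue"
    by (rule measurable_compose[OF measurable_affine kernel_measurable]) simp
  then show ?thesis by simp
qed

definition potential :: "'a set \<Rightarrow> 'a \<Rightarrow> ennreal" where
  "potential \<Omega> x = (\<integral>\<^sup>+ y\<in>\<Omega>. ennreal (g (y - x)) \<partial>lebesgue)"

lemma interaction_potential: "interaction g \<Omega> = (\<integral>\<^sup>+ x\<in>\<Omega>. potential \<Omega> x \<partial>lebesgue)"
  by (simp add: interaction_def potential_def)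

text \<open>
  A Lebesgue measurable kernel need not give a measurable function of the pair \<open>(x, y)\<close>, but it agrees almost
  everywhere with a Borel function, and this does not change the inner integral for any \<open>x\<close>.
\<close>

lemma potential_measurable:
  assumes "\<Omega> \<in> sets lebesgue"
  shows "potential \<Omega> \<in> borel_measurable lebesgue"
proof -
  obtain k where k[measurable]: "k \<in> borel_measurable lborel" and keq: "AE x in lborel. ennreal (g x) = k x"
    using completion_ex_borel_measurable[OF kernel_measurable] by blast
  obtain B where B[measurable]: "B \<in> sets borel" and Beq: "AE x in lebesgue. x \<in> \<Omega> \<longleftrightarrow> x \<in> B"
    using lebesgue_borel_version[OF assms] by metis
  have "potential \<Omega> x = (\<integral>\<^sup>+ y. k (y - x) * indicator B y \<partial>lborel)" for x
    unfolding potential_def nn_integral_completion[symmetric, of lborel]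
  proof (rule nn_integral_cong_AE)
    have "AE y in lebesgue. ennreal (g (y - x)) = k (y - x)"
      by (rule AE_translate) (rule AE_completion[OF keq])
    with Beq show "AE y in lebesgue. ennreal (g (y - x)) * indicator \<Omega> y = k (y - x) * indicator B y"
      by eventually_elim (auto simp: indicator_def)
  qed
  moreover have "(\<lambda>x. \<integral>\<^sup>+ y. k (y - x) * indicator B y \<partial>lborel) \<in> borel_measurable borel"
    by (rule lborel.borel_measurable_nn_integral) measurable
  moreover have "potential \<Omega> = (\<lambda>x. \<integral>\<^sup>+ y. k (y - x) * indicator B y \<partial>lborel)" by (rule ext) fact
  ultimately have "potential \<Omega> \<in> borel_measurable borel" by (simp only:)
  then show ?thesis by (intro measurable_completion) (simp only: measurable_lborel2)
qed

lemma potential_mono: "A \<subseteq> B \<Longrightarrow> potential A x \<le> potential B x"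
  unfolding potential_def by (intro nn_integral_mono) (auto simp: indicator_def)

lemma interaction_mono: "A \<subseteq> B \<Longrightarrow> interaction g A \<le> interaction g B"
  unfolding interaction_potential
  by (intro nn_integral_mono) (auto simp: indicator_def intro: potential_mono)

lemma interaction_superadditive:
  assumes "A \<in> sets lebesgue" "B \<in> sets lebesgue" "A \<inter> B = {}"
  shows "interaction g A + interaction g B \<le> interaction g (A \<union> B)"
proof -
  have "interaction g A + interaction g B = (\<integral>\<^sup>+ x. potential A x * indicator A x + potential B x * indicator B x \<partial>lebesgue)"
    unfolding interaction_potential using potential_measurable assms
    by (intro nn_integral_add[symmetric]) auto
  also have "\<dots> \<le> interaction g (A \<union> B)"
    unfolding interaction_potential using assms(3)
    by (intro nn_integral_mono) (auto simp: indicator_def intro: potential_mono)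
  finally show ?thesis .
qed

text \<open>
  The change of variables contributes \<open>c ^ DIM('a)\<close> for each of the two integrals, and the dilation moves
  each difference \<open>y - x\<close> outwards along its ray, where the kernel is smaller. Translations are the case
  \<open>c = 1\<close>.
\<close>

lemma interaction_affine_le:
  assumes A: "A \<in> sets lebesgue" and c: "c \<ge> 1"
  shows "interaction g ((\<lambda>x. t + c *\<^sub>R x) ` A) \<le> ennreal (c ^ (2 * DIM('a))) * interaction g A"
proof -
  let ?T = "\<lambda>x. t + c *\<^sub>R x"
  have c0: "c \<noteq> 0" "c > 0" using c by auto
  have TA: "?T ` A \<in> sets lebesgue" by (rule affine_image_lebesgue[OF A c0(1)])
  have dec: "g (c *\<^sub>R z) \<le> g z" if "z \<noteq> 0" for z
    using g_decreasing c that unfolding radially_decreasing_def by (cases "c = 1") auto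
  have pot: "potential (?T ` A) (?T x) \<le> ennreal (c ^ DIM('a)) * potential A x" for x
  proof -
    have "potential (?T ` A) (?T x) = ennreal (\<bar>c\<bar> ^ DIM('a)) *
        (\<integral>\<^sup>+y. ennreal (g (?T y - ?T x)) * indicator (?T ` A) (?T y) \<partial>lebesgue)"
      unfolding potential_def
      by (rule nn_integral_affine[OF _ c0(1)]) (intro borel_measurable_times_ennreal kernel_translate_measurable borel_measurable_indicator TA)
    also have "\<dots> \<le> ennreal (\<bar>c\<bar> ^ DIM('a)) * potential A x"
      unfolding potential_def
    proof (intro mult_left_mono nn_integral_mono_AE)
      have "AE y in lebesgue. y \<notin> {x}" by (rule AE_not_in) simp
      then show "AE y in lebesgue. ennreal (g (?T y - ?T x)) * indicator (?T ` A) (?T y) \<le> ennreal (g (y - x)) * indicator A y"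
      proof eventually_elim
        case (elim y)
        have "g (c *\<^sub>R (y - x)) \<le> g (y - x)" using elim by (intro dec) auto
        then have "ennreal (g (?T y - ?T x)) \<le> ennreal (g (y - x))" by (intro ennreal_leI) (simp add: scaleR_diff_right)
        then show ?case unfolding indicator_affine_image[OF c0(1)] by (intro mult_right_mono) auto
      qed
    qed auto
    finally show ?thesis using c0 by simp
  qed
  have "interaction g (?T ` A) = ennreal (\<bar>c\<bar> ^ DIM('a)) *
      (\<integral>\<^sup>+x. potential (?T ` A) (?T x) * indicator (?T ` A) (?T x) \<partial>lebesgue)"
    unfolding interaction_potential
    by (rule nn_integral_affine[OF _ c0(1)]) (intro borel_measurable_times_ennreal potential_measurable borel_measurable_indicator TA)
  also have "\<dots> \<le> ennreal (c ^ DIM('a)) * (\<integral>\<^sup>+x. ennreal (c ^ DIM('a)) * (potential A x * indicator A x) \<partial>lebesgue)"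
    unfolding indicator_affine_image[OF c0(1)] mult.assoc[symmetric]
    using c0 by (intro mult_mono nn_integral_mono mult_right_mono pot) auto
  also have "\<dots> = ennreal (c ^ DIM('a)) * (ennreal (c ^ DIM('a)) * interaction g A)"
    unfolding interaction_potential using potential_measurable[OF A] A by (subst nn_integral_cmult) auto
  also have "\<dots> = ennreal (c ^ (2 * DIM('a))) * interaction g A"
    using c0 by (simp add: mult.assoc[symmetric] power_add mult_2 flip: ennreal_mult)
  finally show ?thesis .
qed

lemma interaction_lower_semicontinuous:
  assumes A: "\<And>n. A n \<in> sets lebesgue" "B \<in> sets lebesgue"
    and conv: "AE x in lebesgue. (\<lambda>n. indicator (A n) x :: real) \<longlonglongrightarrow> indicator B x"
    and le: "\<And>n. interaction g (A n) \<le> ennreal (i n)" "i \<longlonglongrightarrow> j"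
  shows "interaction g B \<le> ennreal j"
proof -
  have ind: "f * indicator B x \<le> liminf (\<lambda>n. f' n * indicator (A n) x)"
    if "(\<lambda>n. indicator (A n) x :: real) \<longlonglongrightarrow> indicator B x" "f \<le> liminf f'" for x and f :: ennreal and f'
  proof (cases "x \<in> B")
    case True
    have "\<forall>\<^sub>F n in sequentially. (indicator (A n) x :: real) > 1/2"
      using that(1) True by (intro order_tendstoD(1)) auto
    then have "\<forall>\<^sub>F n in sequentially. f' n \<le> f' n * indicator (A n) x"
      by eventually_elim (auto simp: indicator_def split: if_splits)
    then have "liminf f' \<le> liminf (\<lambda>n. f' n * indicator (A n) x)" by (rule Liminf_mono)
    then show ?thesis using True that(2) by simp
  qed simp
  have pot: "potential B x \<le> liminf (\<lambda>n. potential (A n) x)" for x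
  proof -
    have "potential B x \<le> (\<integral>\<^sup>+y. liminf (\<lambda>n. ennreal (g (y - x)) * indicator (A n) y) \<partial>lebesgue)"
      unfolding potential_def
      by (rule nn_integral_mono_AE) (use conv in eventually_elim, auto intro!: ind simp: Liminf_const)
    also have "\<dots> \<le> liminf (\<lambda>n. potential (A n) x)"
      unfolding potential_def
      by (intro nn_integral_liminf borel_measurable_times_ennreal kernel_translate_measurable borel_measurable_indicator A)
    finally show ?thesis .
  qed
  have "interaction g B \<le> (\<integral>\<^sup>+x. liminf (\<lambda>n. potential (A n) x * indicator (A n) x) \<partial>lebesgue)"
    unfolding interaction_potential
    by (rule nn_integral_mono_AE) (use conv in eventually_elim, intro ind pot)
  also have "\<dots> \<le> liminf (\<lambda>n. interaction g (A n))"
    unfolding interaction_potential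
    by (intro nn_integral_liminf borel_measurable_times_ennreal potential_measurable borel_measurable_indicator A)
  also have "\<dots> \<le> liminf (\<lambda>n. ennreal (i n))" by (intro Liminf_mono always_eventually allI le)
  also have "\<dots> = ennreal j" by (intro lim_imp_Liminf tendsto_ennrealI le) simp
  finally show ?thesis .
qed

abbreviation F :: "'a set \<Rightarrow> ennreal" where "F \<equiv> energy g \<epsilon>"

lemma energy_split:
  assumes "F A \<le> ennreal f" "f \<ge> 0"
  obtains p i where "perimeter A = ennreal p" "p \<ge> 0" "interaction g A = ennreal i" "i \<ge> 0" "p + \<epsilon> * i \<le> f"
proof -
  have "perimeter A \<le> ennreal f" "ennreal \<epsilon> * interaction g A \<le> ennreal f"
    using assms(1) unfolding energy_def by (auto elim: order_trans[rotated])
  then have fin: "perimeter A \<noteq> top" "ennreal \<epsilon> * interaction g A \<noteq> top"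
    by (auto simp: top_unique)
  then have "interaction g A \<noteq> top" using \<epsilon>_pos by (auto simp: ennreal_mult_eq_top_iff)
  then obtain i where i: "interaction g A = ennreal i" "i \<ge> 0" by (cases "interaction g A") auto
  obtain p where p: "perimeter A = ennreal p" "p \<ge> 0" using fin(1) by (cases "perimeter A") auto
  have "ennreal (p + \<epsilon> * i) \<le> ennreal f"
    using assms(1) \<epsilon>_pos p i by (simp add: energy_def ennreal_mult)
  then have "p + \<epsilon> * i \<le> f" using assms(2) ennreal_le_iff by blast
  then show ?thesis using that p i by blast
qed

lemma energy_leI:
  assumes "perimeter A \<le> ennreal p" "interaction g A \<le> ennreal i" "p \<ge> 0" "i \<ge> 0" "p + \<epsilon> * i \<le> f"
  shows "F A \<le> ennreal f"
proof -
  have "F A \<le> ennreal p + ennreal \<epsilon> * ennreal i" unfolding energy_def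
    using assms by (intro add_mono mult_left_mono) auto
  also have "\<dots> = ennreal (p + \<epsilon> * i)" using assms \<epsilon>_pos by (simp add: ennreal_mult)
  also have "\<dots> \<le> ennreal f" using assms(5) by (rule ennreal_leI)
  finally show ?thesis .
qed

lemma perimeter_le_energy: "perimeter A \<le> F A"
  by (simp add: energy_def)

lemma energy_empty: "F {} = 0"
  by (simp add: energy_def perimeter_empty interaction_def)

lemma energy_affine_le:
  assumes A: "A \<in> sets lebesgue" and c: "c \<ge> 1" and f: "F A \<le> ennreal f" "f \<ge> 0"
  shows "F ((\<lambda>x. t + c *\<^sub>R x) ` A) \<le> ennreal (c ^ (2 * DIM('a)) * f)"
proof -
  obtain p i where pi: "perimeter A = ennreal p" "p \<ge> 0" "interaction g A = ennreal i" "i \<ge> 0" "p + \<epsilon> * i \<le> f"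
    using energy_split[OF f] .
  let ?C = "c ^ (2 * DIM('a))"
  have "perimeter ((\<lambda>x. t + c *\<^sub>R x) ` A) \<le> ennreal (c ^ (DIM('a) - 1) * p)"
    using pi c by (intro perimeter_affine_le A) auto
  also have "\<dots> \<le> ennreal (?C * p)"
    using c pi by (intro ennreal_leI mult_right_mono power_increasing) auto
  finally have 1: "perimeter ((\<lambda>x. t + c *\<^sub>R x) ` A) \<le> ennreal (?C * p)" .
  have 2: "interaction g ((\<lambda>x. t + c *\<^sub>R x) ` A) \<le> ennreal (?C * i)"
    using interaction_affine_le[OF A c, of t] pi c by (simp add: ennreal_mult)
  have "?C * p + \<epsilon> * (?C * i) = ?C * (p + \<epsilon> * i)" by (simp add: algebra_simps)
  also have "\<dots> \<le> ?C * f" using pi c by (intro mult_left_mono) auto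
  finally show ?thesis using 1 2 pi c by (intro energy_leI) auto
qed

text \<open>
  Perimeter and interaction are separately lower semicontinuous. Along a subsequence the perimeters
  converge, and then what the energy bound leaves for the interactions converges too.
\<close>

lemma energy_lower_semicontinuous:
  assumes A: "\<And>n. A n \<in> sets lebesgue" "B \<in> sets lebesgue"
    and conv: "AE x in lebesgue. (\<lambda>n. indicator (A n) x :: real) \<longlonglongrightarrow> indicator B x"
    and f: "\<And>n. F (A n) \<le> ennreal (f n)" "\<And>n. f n \<ge> 0" "f \<longlonglongrightarrow> l"
  shows "F B \<le> ennreal l"
proof -
  have "\<exists>p i. perimeter (A n) = ennreal p \<and> p \<ge> 0 \<and> interaction g (A n) = ennreal i \<and> i \<ge> 0 \<and> p + \<epsilon> * i \<le> f n" for n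
    using energy_split[OF f(1,2)] by metis
  then obtain p i where pi: "\<And>n. perimeter (A n) = ennreal (p n)" "\<And>n. p n \<ge> 0" "\<And>n. interaction g (A n) = ennreal (i n)"
    "\<And>n. i n \<ge> 0" "\<And>n. p n + \<epsilon> * i n \<le> f n" by metis
  obtain K where K: "\<And>n. \<bar>f n\<bar> \<le> K" using convergent_imp_Bseq[OF convergentI[OF f(3)]] unfolding Bseq_def by auto
  have "bounded (range p)"
  proof (rule boundedI)
    fix y assume "y \<in> range p"
    then obtain n where n: "y = p n" by auto
    have "0 \<le> \<epsilon> * i n" using pi(4)[of n] \<epsilon>_pos by simp
    then show "norm y \<le> K" using n pi(2,5)[of n] K[of n] by simp
  qed
  from bounded_imp_convergent_subsequence[OF this]
  obtain q r where r: "strict_mono r" "(p \<circ> r) \<longlonglongrightarrow> q" by metis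
  have f': "(\<lambda>n. f (r n)) \<longlonglongrightarrow> l" using LIMSEQ_subseq_LIMSEQ[OF f(3) r(1)] by (simp add: comp_def)
  have p': "(\<lambda>n. p (r n)) \<longlonglongrightarrow> q" using r(2) by (simp add: comp_def)
  have conv': "AE x in lebesgue. (\<lambda>n. indicator (A (r n)) x :: real) \<longlonglongrightarrow> indicator B x"
    using conv by eventually_elim (use LIMSEQ_subseq_LIMSEQ[OF _ r(1)] in \<open>force simp: comp_def\<close>)
  have 1: "perimeter B \<le> ennreal q"
    by (rule perimeter_lower_semicontinuous[OF A(1) A(2) conv' _ pi(2) p']) (simp add: pi(1))
  have 2: "interaction g B \<le> ennreal ((l - q) / \<epsilon>)"
  proof (rule interaction_lower_semicontinuous[OF A(1) A(2) conv'])
    show "(\<lambda>n. (f (r n) - p (r n)) / \<epsilon>) \<longlonglongrightarrow> (l - q) / \<epsilon>"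
      using f' p' \<epsilon>_pos by (intro tendsto_intros) auto
    show "interaction g (A (r n)) \<le> ennreal ((f (r n) - p (r n)) / \<epsilon>)" for n
      unfolding pi(3) using pi(5)[of "r n"] \<epsilon>_pos by (intro ennreal_leI) (simp add: field_simps)
  qed
  have q: "q \<ge> 0" by (rule LIMSEQ_le_const[OF p']) (use pi(2) in auto)
  have "q \<le> l"
  proof (rule LIMSEQ_le[OF p' f'])
    have "p n \<le> f n" for n using pi(4)[of n] pi(5)[of n] \<epsilon>_pos by (smt (verit) mult_nonneg_nonneg)
    then show "\<exists>N. \<forall>n\<ge>N. p (r n) \<le> f (r n)" by blast
  qed
  then show ?thesis using \<epsilon>_pos by (intro energy_leI[OF 1 2 q]) auto
qed

lemma energy_cong_AE:
  assumes "A \<in> sets lebesgue" "B \<in> sets lebesgue" "AE x in lebesgue. x \<in> A \<longleftrightarrow> x \<in> B"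
  shows "F A = F B"
proof -
  have pot: "potential A x = potential B x" for x
    unfolding potential_def
    by (rule nn_integral_cong_AE) (use assms(3) in eventually_elim, auto simp: indicator_def)
  have "interaction g A = interaction g B"
    unfolding interaction_potential pot
    by (rule nn_integral_cong_AE) (use assms(3) in eventually_elim, auto simp: indicator_def)
  then show ?thesis unfolding energy_def using perimeter_cong_AE[OF assms] by simp
qed

lemma energy_Int_halfspace_le:
  assumes A: "A \<in> lmeasurable" and f: "F A \<le> ennreal f" "f \<ge> 0" and e: "norm e = 1"
  shows "F (A \<inter> {x. e \<bullet> x \<le> t}) \<le> ennreal f"
proof -
  obtain p i where pi: "perimeter A = ennreal p" "p \<ge> 0" "interaction g A = ennreal i" "i \<ge> 0" "p + \<epsilon> * i \<le> f"
    using energy_split[OF f] .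
  show ?thesis
  proof (rule energy_leI[OF _ _ pi(2,4,5)])
    show "perimeter (A \<inter> {x. e \<bullet> x \<le> t}) \<le> ennreal p"
      using perimeter_Int_halfspace[OF A _ pi(2) e] pi(1) by simp
    show "interaction g (A \<inter> {x. e \<bullet> x \<le> t}) \<le> ennreal i"
      using interaction_mono[of "A \<inter> {x. e \<bullet> x \<le> t}" A] pi(3) by auto
  qed
qed

lemma energy_cut:
  assumes A: "A \<in> sets lebesgue" and f: "F A \<le> ennreal f" "f \<ge> 0" and ab: "a < b"
  obtains t where "a \<le> t" "t \<le> b" "F (A \<inter> {x. soft_norm x < t}) + F (A - {x. soft_norm x < t})
    \<le> ennreal (f + 4 * vol (A \<inter> {x. a \<le> soft_norm x \<and> soft_norm x < b}) / (b - a))"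
proof -
  let ?M = "vol (A \<inter> {x. a \<le> soft_norm x \<and> soft_norm x < b})"
  obtain p i where pi: "perimeter A = ennreal p" "p \<ge> 0" "interaction g A = ennreal i" "i \<ge> 0" "p + \<epsilon> * i \<le> f"
    using energy_split[OF f] .
  obtain t where t: "t \<in> {a..b}" "perimeter (A \<inter> {x. soft_norm x < t}) + perimeter (A - {x. soft_norm x < t})
      \<le> ennreal (p + 4 * ?M / (b - a))"
    using perimeter_cut[OF A _ pi(2) ab] pi(1) by auto
  let ?B = "A \<inter> {x. soft_norm x < t}" and ?C = "A - {x. soft_norm x < t}"
  have "interaction g ?B + interaction g ?C \<le> interaction g (?B \<union> ?C)"
    using annulus_lmeasurable(1,3)[OF A, of t] by (intro interaction_superadditive) auto
  also have "?B \<union> ?C = A" by auto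
  finally have I: "interaction g ?B + interaction g ?C \<le> ennreal i" using pi(3) by simp
  have "F ?B + F ?C = (perimeter ?B + perimeter ?C) + ennreal \<epsilon> * (interaction g ?B + interaction g ?C)"
    by (simp add: energy_def algebra_simps)
  also have "\<dots> \<le> ennreal (p + 4 * ?M / (b - a)) + ennreal \<epsilon> * ennreal i"
    using t(2) I by (intro add_mono mult_left_mono) auto
  also have "\<dots> = ennreal (p + 4 * ?M / (b - a) + \<epsilon> * i)"
    using pi \<epsilon>_pos ab by (simp add: ennreal_mult)
  also have "\<dots> \<le> ennreal (f + 4 * ?M / (b - a))" using pi(5) by (intro ennreal_leI) simp
  finally show ?thesis using that t(1) by auto
qed

text \<open>
  The cut of the whole space, which has perimeter \<open>0\<close>, by a sphere between the radii \<open>1/2\<close> and \<open>1\<close> yields a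
  ball of finite perimeter, and admissibility bounds its interaction.
\<close>

lemma finite_energy_set: "\<exists>A. A \<in> lmeasurable \<and> vol A > 0 \<and> F A < top"
proof -
  \<comment> \<open>The values of \<^const>\<open>soft_norm\<close> on the spheres of radius \<open>1/2\<close> and \<open>1\<close>.\<close>
  define a b :: real where "a = sqrt (5/4)" and "b = sqrt 2"
  have ab: "a < b" unfolding a_def b_def by (rule real_sqrt_less_mono) simp
  let ?M = "vol (UNIV \<inter> {x::'a. a \<le> soft_norm x \<and> soft_norm x < b})"
  have "\<exists>t\<in>{a..b}. perimeter (UNIV \<inter> {x::'a. soft_norm x < t}) + perimeter (UNIV - {x::'a. soft_norm x < t})
      \<le> ennreal (0 + 4 * ?M / (b - a))"
    by (rule perimeter_cut) (use ab in \<open>auto simp: perimeter_UNIV\<close>)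
  then obtain t where t: "t \<in> {a..b}" "perimeter (UNIV \<inter> {x::'a. soft_norm x < t}) + perimeter (UNIV - {x::'a. soft_norm x < t})
      \<le> ennreal (0 + 4 * ?M / (b - a))" by blast
  let ?B = "UNIV \<inter> {x::'a. soft_norm x < t}"
  have B: "?B \<in> lmeasurable" by (rule annulus_lmeasurable(1)) simp
  have sub: "ball 0 (1/2) \<subseteq> ?B"
  proof
    fix x :: 'a assume "x \<in> ball 0 (1/2)"
    then have "(norm x)\<^sup>2 < (1/2)\<^sup>2" by (intro power_strict_mono) auto
    then have "1 + x \<bullet> x < 5/4" by (simp add: dot_square_norm power2_eq_square)
    then have "soft_norm x < a" unfolding soft_norm_def a_def by (rule real_sqrt_less_mono)
    then show "x \<in> ?B" using t(1) by auto
  qed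
  have sup: "?B \<subseteq> ball 0 1"
  proof
    fix x :: 'a assume "x \<in> ?B"
    then have "soft_norm x < b" using t(1) by auto
    then have "1 + x \<bullet> x < 2" unfolding soft_norm_def b_def using real_sqrt_less_iff by blast
    then have "(norm x)\<^sup>2 < 1\<^sup>2" by (simp add: dot_square_norm)
    then show "x \<in> ball 0 1" using power_less_imp_less_base[of "norm x" 2 1] by simp
  qed
  have "vol (ball (0::'a) (1/2)) \<le> vol ?B"
    using sub B by (intro measure_mono_fmeasurable) auto
  moreover have "0 < vol (ball (0::'a) (1/2))" using content_ball_pos[of "1/2" "0::'a"] by simp
  ultimately have 1: "vol ?B > 0" by linarith
  have "perimeter ?B \<le> ennreal (0 + 4 * ?M / (b - a))"
    using t(2) by (rule order_trans[rotated]) simp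
  then have "perimeter ?B < top" using ennreal_less_top le_less_trans by blast
  moreover have "interaction g ?B < top"
    using interaction_mono[OF sup] g_admissible unfolding admissible_def by (auto simp: less_top le_less_trans)
  ultimately have "F ?B < top" by (simp add: energy_def ennreal_mult_less_top)
  then show ?thesis using 1 B by blast
qed

end

section \<open>Splittings of the volume\<close>

text \<open>
  Taking \<open>b - a = 2 * K * v a powr (1 - p)\<close> in the hypothesis shows that \<open>v\<close> drops to half its value within
  this distance. The distances for successive halvings form a geometric series, because \<open>p < 1\<close>, so
  all halvings are completed at a finite point.
\<close>

lemma powr_vanish:
  fixes v :: "real \<Rightarrow> real"
  assumes v: "\<And>x. 0 \<le> v x" "\<And>a b. a0 \<le> a \<Longrightarrow> a \<le> b \<Longrightarrow> v b \<le> v a"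
    and K: "K > 0" and p: "0 < p" "p < 1"
    and decay: "\<And>a b. a0 \<le> a \<Longrightarrow> a < b \<Longrightarrow> v b powr p * (b - a) \<le> K * v a"
  obtains R where "R \<ge> a0" "v R = 0"
proof -
  have half: "v (a + 2 * K * v a powr (1 - p)) \<le> v a / 2" if a: "a0 \<le> a" "v a > 0" for a
  proof (rule ccontr)
    define L where "L = 2 * K * v a powr (1 - p)"
    have L: "L > 0" using a K by (simp add: L_def)
    assume "\<not> ?thesis"
    then have big: "v a / 2 \<le> v (a + L)" by (simp add: L_def)
    have "(v a / 2) powr p * L \<le> v (a + L) powr p * L"
      using big a L p by (intro mult_right_mono powr_mono2) auto
    also have "\<dots> \<le> K * v a" using decay[of a "a + L"] a L by simp
    also have "(v a / 2) powr p * L = (2 powr (1 - p)) * (K * v a)"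
    proof -
      have "(v a / 2) powr p * L = v a powr p / 2 powr p * (2 * K * v a powr (1 - p))"
        using a by (simp add: L_def powr_divide)
      also have "\<dots> = (2 / 2 powr p) * K * (v a powr p * v a powr (1 - p))" by simp
      also have "v a powr p * v a powr (1 - p) = v a" using a by (simp flip: powr_add)
      also have "2 / 2 powr p = 2 powr (1 - p)" by (simp add: powr_diff)
      finally show ?thesis by simp
    qed
    finally have "2 powr (1 - p) * (K * v a) \<le> 1 * (K * v a)" by simp
    then have "2 powr (1 - p) \<le> 1" using K a by (simp only: mult_le_cancel_right) (auto simp: not_less)
    moreover have "2 powr (1 - p) > (1::real)" using p by (simp add: gr_one_powr)
    ultimately show False by simp
  qed
  define \<rho> where "\<rho> = (1/2::real) powr (1 - p)"
  have \<rho>: "0 < \<rho>" "\<rho> < 1" using p powr_less_mono2[of "1 - p" "1/2" "1::real"] by (auto simp: \<rho>_def)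
  define C where "C = 2 * K * v a0 powr (1 - p)"
  have C: "C \<ge> 0" using K by (simp add: C_def)
  define s where "s k = a0 + C * (\<Sum>i<k. \<rho> ^ i)" for k :: nat
  have s0: "a0 \<le> s k" for k using C \<rho> by (simp add: s_def sum_nonneg)
  have vs: "v (s k) \<le> (1/2)^k * v a0" for k
  proof (induction k)
    case 0
    then show ?case by (simp add: s_def)
  next
    case (Suc k)
    have sS: "s (Suc k) = s k + C * \<rho> ^ k" by (simp add: s_def algebra_simps)
    show ?case
    proof (cases "v (s k) > 0")
      case True
      have "v (s k) powr (1 - p) \<le> ((1/2)^k * v a0) powr (1 - p)"
        using Suc True p by (intro powr_mono2) auto
      also have "\<dots> = \<rho> ^ k * v a0 powr (1 - p)"
        by (simp add: powr_mult v(1) \<rho>_def powr_power flip: powr_realpow)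
          (simp add: powr_powr mult.commute powr_realpow[symmetric])
      finally have "2 * K * v (s k) powr (1 - p) \<le> 2 * K * (\<rho> ^ k * v a0 powr (1 - p))"
        using K by (intro mult_left_mono) auto
      then have "s k + 2 * K * v (s k) powr (1 - p) \<le> s (Suc k)"
        unfolding sS C_def by (simp add: mult_ac)
      then have "v (s (Suc k)) \<le> v (s k + 2 * K * v (s k) powr (1 - p))"
        using s0[of k] K by (intro v(2)) (auto intro: add_increasing2)
      also have "\<dots> \<le> v (s k) / 2" by (rule half[OF s0 True])
      also have "\<dots> \<le> (1/2)^Suc k * v a0" using Suc by simp
      finally show ?thesis .
    next
      case False
      then have "v (s k) = 0" using v(1)[of "s k"] by simp
      moreover have "v (s (Suc k)) \<le> v (s k)" using s0 C \<rho> by (intro v(2)) (auto simp: sS)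
      ultimately show ?thesis using v(1)[of a0] by (metis zero_le_mult_iff zero_le_power order_trans zero_le_divide_1_iff zero_le_numeral)
    qed
  qed
  define R where "R = a0 + C * (1 / (1 - \<rho>))"
  have sR: "s k \<le> R" for k
  proof -
    have "(\<Sum>i<k. \<rho> ^ i) \<le> 1 / (1 - \<rho>)"
      using \<rho> by (simp add: sum_gp_strict divide_right_mono)
    then show ?thesis unfolding s_def R_def using C by (intro add_left_mono mult_left_mono) auto
  qed
  have "v R \<le> 0"
  proof (rule LIMSEQ_le_const)
    show "(\<lambda>k. (1/2)^k * v a0) \<longlonglongrightarrow> 0" by (intro tendsto_mult_left_zero LIMSEQ_realpow_zero) auto
    show "\<exists>N. \<forall>k\<ge>N. v R \<le> (1/2)^k * v a0"
      using v(2)[OF s0 sR] vs order_trans by blast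
  qed
  then have "v R = 0" using v(1)[of R] by simp
  moreover have "R \<ge> a0" using s0[of 0] sR[of 0] by simp
  ultimately show ?thesis using that by blast
qed

text \<open>
  If all members are at most \<open>X\<close>, then \<open>x powr p \<ge> X powr (p - 1) * x\<close> for each of them, and summation gives
  \<open>c * X powr (p - 1) * m \<le> K\<close>.
\<close>

lemma large_piece:
  fixes M :: "real multiset"
  assumes M: "\<And>x. x \<in># M \<Longrightarrow> x \<ge> 0" "\<Sum>\<^sub># M = m" "m > 0"
    and K: "(\<Sum>x\<in>#M. c * x powr p) \<le> K" and c: "c > 0" and p: "0 < p" "p < 1"
  shows "\<exists>x. x \<in># M \<and> K > 0 \<and> x \<ge> (c * m / K) powr (1 / (1 - p))"
proof -
  have ne: "M \<noteq> {#}" using M(2,3) by auto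
  define X where "X = Max (set_mset M)"
  have XM: "X \<in># M" unfolding X_def using ne by (intro Max_in) auto
  have le: "x \<le> X" if "x \<in># M" for x unfolding X_def using that by (intro Max_ge) auto
  have X: "X > 0"
  proof (rule ccontr)
    assume "\<not> X > 0"
    then have "x = 0" if "x \<in># M" for x using le[OF that] M(1)[OF that] by simp
    then have "\<Sum>\<^sub># M = 0" by (metis multiset.map_ident_strong sum_mset.neutral)
    then show False using M by simp
  qed
  have "c * X powr (p - 1) * m = (\<Sum>x\<in>#M. c * X powr (p - 1) * x)"
    using M(2) by (simp add: sum_mset_distrib_left[symmetric])
  also have "\<dots> \<le> (\<Sum>x\<in>#M. c * x powr p)"
  proof (rule sum_mset_mono)
    fix x assume x: "x \<in># M"
    show "c * X powr (p - 1) * x \<le> c * x powr p"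
    proof (cases "x = 0")
      case False
      then have x0: "x > 0" using M(1)[OF x] by simp
      have "X powr (p - 1) \<le> x powr (p - 1)" using p le[OF x] x0 by (intro powr_mono2') auto
      then have "c * X powr (p - 1) * x \<le> c * x powr (p - 1) * x" using c x0 by simp
      also have "\<dots> = c * x powr p" using x0 by (simp add: powr_diff)
      finally show ?thesis .
    qed simp
  qed
  also have "\<dots> \<le> K" by (rule K)
  finally have 1: "c * X powr (p - 1) * m \<le> K" .
  have Kpos: "K > 0" using 1 c X M(3) by (smt (verit) mult_pos_pos powr_gt_zero)
  have "c * m / K \<le> X powr (1 - p)"
  proof -
    have "X powr (p - 1) * X powr (1 - p) = 1" using X by (simp flip: powr_add)
    then have "c * m = (c * X powr (p - 1) * m) * X powr (1 - p)" by (simp add: mult_ac)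
    also have "\<dots> \<le> K * X powr (1 - p)" by (intro mult_right_mono 1) simp
    finally show ?thesis using Kpos by (simp add: pos_divide_le_eq mult.commute)
  qed
  then have "(c * m / K) powr (1 / (1 - p)) \<le> (X powr (1 - p)) powr (1 / (1 - p))"
    using c M(3) Kpos p by (intro powr_mono2) auto
  also have "\<dots> = X" using X p by (simp add: powr_powr)
  finally show ?thesis using XM Kpos by blast
qed

text \<open>
  What the minimal energy satisfies as a function of the volume.
\<close>

locale volume_profile =
  fixes j :: "real \<Rightarrow> real" and c p :: real
  assumes j_0: "j 0 = 0"
    and j_subadditive: "\<And>a b. 0 \<le> a \<Longrightarrow> 0 \<le> b \<Longrightarrow> j (a + b) \<le> j a + j b"
    and j_mono: "\<And>a b. 0 \<le> a \<Longrightarrow> a \<le> b \<Longrightarrow> j a \<le> j b"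
    and j_scale: "\<And>m t. 0 < m \<Longrightarrow> 1 \<le> t \<Longrightarrow> j (t * m) \<le> t\<^sup>2 * j m"
    and j_lower: "\<And>m. 0 \<le> m \<Longrightarrow> c * m powr p \<le> j m"
    and c_pos: "c > 0" and p: "0 < p" "p < 1"
begin

lemma j_nonneg: "0 \<le> m \<Longrightarrow> 0 \<le> j m"
  using j_lower[of m] c_pos by (smt (verit) mult_nonneg_nonneg powr_ge_zero)

lemma j_pos: "0 < m \<Longrightarrow> 0 < j m"
  using j_lower[of m] c_pos by (smt (verit) mult_pos_pos powr_gt_zero)

text \<open>
  Monotonicity and the scaling inequality together make \<open>j\<close> lower semicontinuous: for \<open>x\<^sub>n\<close> close to \<open>x\<close>,
  \<open>j x\<^sub>n \<ge> j (\<theta> * x) \<ge> \<theta>\<^sup>2 * j x\<close> with \<open>\<theta>\<close> close to \<open>1\<close>.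
\<close>

lemma j_limit_lower:
  assumes "x \<ge> 0" "xs \<longlonglongrightarrow> x" "0 < z" "z < 1" "\<And>n. xs n \<ge> 0"
  shows "\<forall>\<^sub>F n in sequentially. z * j x \<le> j (xs n)"
proof (cases "x = 0")
  case True
  then show ?thesis using j_nonneg assms(5) by (simp add: j_0)
next
  case False
  then have x: "x > 0" using assms by simp
  define \<theta> where "\<theta> = sqrt z"
  have \<theta>: "0 < \<theta>" "\<theta> < 1" "\<theta>\<^sup>2 = z" using assms by (auto simp: \<theta>_def)
  have "\<forall>\<^sub>F n in sequentially. xs n > \<theta> * x"
    using assms(2) x \<theta> by (intro order_tendstoD(1)) auto
  then show ?thesis
  proof eventually_elim
    case (elim n)
    have "j (1 / \<theta> * (\<theta> * x)) \<le> (1 / \<theta>)\<^sup>2 * j (\<theta> * x)" using x \<theta> by (intro j_scale) auto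
    moreover have "(1 / \<theta>)\<^sup>2 = 1 / z" using \<theta>(3) by (simp add: power_divide)
    moreover have "1 / \<theta> * (\<theta> * x) = x" using \<theta>(1) by simp
    ultimately have "z * j x \<le> j (\<theta> * x)" using assms(3) by (simp add: field_simps)
    also have "\<dots> \<le> j (xs n)" using x \<theta> elim by (intro j_mono) auto
    finally show ?case .
  qed
qed

lemma j_sum_lower_semicontinuous:
  assumes "xs \<longlonglongrightarrow> x" "ys \<longlonglongrightarrow> y" "bs \<longlonglongrightarrow> b" "\<And>n. xs n \<ge> 0" "\<And>n. ys n \<ge> 0"
    and "\<And>n. j (xs n) + j (ys n) \<le> bs n"
  shows "j x + j y \<le> b"
proof (rule field_le_mult_one_interval)
  fix z :: real assume z: "0 < z" "z < 1"
  have xy: "x \<ge> 0" "y \<ge> 0" using assms LIMSEQ_le_const by blast+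
  have "\<forall>\<^sub>F n in sequentially. z * (j x + j y) \<le> bs n"
    using j_limit_lower[OF xy(1) assms(1) z assms(4)] j_limit_lower[OF xy(2) assms(2) z assms(5)]
    by eventually_elim (use assms(6) in \<open>smt (verit) distrib_left\<close>)
  then show "z * (j x + j y) \<le> b" using tendsto_lowerbound[OF assms(3)] by simp
qed

lemma j_sum_mset:
  "(\<And>x. x \<in># M \<Longrightarrow> x \<ge> 0) \<Longrightarrow> j (\<Sum>\<^sub># M) \<le> (\<Sum>x\<in>#M. j x) \<and> 0 \<le> \<Sum>\<^sub># M"
proof (induction M)
  case (add x M)
  then have "j (x + \<Sum>\<^sub># M) \<le> j x + j (\<Sum>\<^sub># M)" by (intro j_subadditive) auto
  then show ?case using add by auto
qed (simp add: j_0)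

definition indecomposable :: "real \<Rightarrow> bool" where
  "indecomposable m \<longleftrightarrow> m > 0 \<and> (\<forall>a b. a > 0 \<longrightarrow> b > 0 \<longrightarrow> a + b = m \<longrightarrow> j m < j a + j b)"

definition optimal_splitting :: "real \<Rightarrow> real multiset \<Rightarrow> bool" where
  "optimal_splitting m M \<longleftrightarrow> (\<forall>x\<in>#M. x > 0) \<and> \<Sum>\<^sub># M = m \<and> (\<Sum>x\<in>#M. j x) = j m"

text \<open>
  The largest part \<open>X\<close> is bounded below by \<open>large_piece\<close>. A smaller part \<open>x\<close> could be absorbed into \<open>X\<close> by a
  dilation at the cost of at most \<open>3 * (x / X) * j X\<close>; optimality says that this is not less than
  \<open>j x \<ge> c * x powr p\<close>, which fails for small \<open>x\<close>.
\<close>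

lemma optimal_splitting_lower_bound:
  assumes m: "m > 0"
  obtains \<mu> where "\<mu> > 0" "\<And>M x. optimal_splitting m M \<Longrightarrow> x \<in># M \<Longrightarrow> x \<ge> \<mu>"
proof -
  define q where "q = 1 / (1 - p)"
  define \<beta> where "\<beta> = (c * m / j m) powr q"
  define \<mu> where "\<mu> = min \<beta> ((c * \<beta> / (3 * j m)) powr q)"
  have K: "j m > 0" using j_pos m .
  have \<beta>: "\<beta> > 0" using c_pos m K by (simp add: \<beta>_def)
  have "\<mu> > 0" using \<beta> c_pos K by (simp add: \<mu>_def)
  moreover have "x \<ge> \<mu>" if M: "optimal_splitting m M" and x: "x \<in># M" for M x
  proof -
    have M': "\<And>y. y \<in># M \<Longrightarrow> y > 0" "\<Sum>\<^sub># M = m" "(\<Sum>y\<in>#M. j y) = j m"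
      using M by (auto simp: optimal_splitting_def)
    have "(\<Sum>y\<in>#M. c * y powr p) \<le> (\<Sum>y\<in>#M. j y)" using M'(1) by (intro sum_mset_mono j_lower) (auto intro: less_imp_le)
    then obtain X where X: "X \<in># M" "X \<ge> \<beta>"
      using large_piece[OF _ M'(2) m _ c_pos p, of "j m"] M'(1,3) unfolding \<beta>_def q_def by (force intro: less_imp_le)
    show ?thesis
    proof (cases "x \<ge> X")
      case True
      then show ?thesis using X by (simp add: \<mu>_def)
    next
      case False
      have x0: "x > 0" and X0: "X > 0" using M'(1) x X by auto
      obtain R' where R': "M = add_mset X R'" using X(1) by (meson multi_member_split)
      then have "x \<in># R'" using x False by auto
      then obtain R where "R' = add_mset x R" by (meson multi_member_split)
      then have MR: "M = add_mset X (add_mset x R)" using R' by simp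
      have R: "\<And>y. y \<in># R \<Longrightarrow> y \<ge> 0" using M'(1) unfolding MR by (auto intro: less_imp_le)
      have jR: "j (\<Sum>\<^sub># R) \<le> (\<Sum>y\<in>#R. j y)" "0 \<le> \<Sum>\<^sub># R" using j_sum_mset[of R] R by auto
      have "j m \<le> j (X + x) + j (\<Sum>\<^sub># R)"
        using j_subadditive[of "X + x" "\<Sum>\<^sub># R"] jR(2) x0 X0 M'(2) unfolding MR by (auto simp: add.assoc)
      then have "j m \<le> j (X + x) + (\<Sum>y\<in>#R. j y)" using jR(1) by linarith
      then have 1: "j X + j x \<le> j (X + x)" using M'(3) unfolding MR by simp
      have "j ((1 + x / X) * X) \<le> (1 + x / X)\<^sup>2 * j X" using x0 X0 by (intro j_scale) auto
      moreover have "(1 + x / X) * X = X + x" using X0 by (simp add: field_simps)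
      ultimately have 2: "j (X + x) \<le> (1 + x / X)\<^sup>2 * j X" by simp
      have xX: "x / X \<le> 1" "0 < x / X" using False X0 x0 by auto
      then have "(x / X)\<^sup>2 \<le> x / X" unfolding power2_eq_square by (intro mult_left_le) auto
      then have "(1 + x / X)\<^sup>2 \<le> 1 + 3 * (x / X)" by (simp add: power2_sum)
      then have "(1 + x / X)\<^sup>2 * j X \<le> (1 + 3 * (x / X)) * j X" using j_nonneg X0 by (intro mult_right_mono) auto
      then have jx: "j x \<le> 3 * (x / X) * j X" using 1 2 by (simp add: algebra_simps)
      have jX: "j X \<le> j m"
      proof (rule j_mono)
        show "X \<le> m" using M'(2) jR(2) x0 unfolding MR by auto
      qed (use X0 in simp)
      have "3 * (x / X) * j X \<le> 3 * (x / X) * j m" using xX by (intro mult_left_mono jX) auto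
      then have "j x \<le> 3 * (x / X) * j m" using jx by linarith
      then have "c * x powr p \<le> 3 * (x / X) * j m" using j_lower[of x] x0 by simp
      also have "\<dots> = (3 * j m / X) * x powr (1 - p) * x powr p" using x0 by (simp flip: powr_add)
      finally have "c \<le> (3 * j m / X) * x powr (1 - p)" by (rule mult_right_le_imp_le) (use x0 in simp)
      then have "c * X / (3 * j m) \<le> x powr (1 - p)" using K X0 by (simp add: field_simps)
      moreover have "c * \<beta> / (3 * j m) \<le> c * X / (3 * j m)" using X(2) K c_pos by (intro divide_right_mono mult_left_mono) auto
      ultimately have "c * \<beta> / (3 * j m) \<le> x powr (1 - p)" by simp
      then have "(c * \<beta> / (3 * j m)) powr q \<le> (x powr (1 - p)) powr q"
        using c_pos \<beta> K p by (intro powr_mono2) (auto simp: q_def)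
      also have "\<dots> = x" using x0 p by (simp add: powr_powr q_def)
      finally show ?thesis by (simp add: \<mu>_def)
    qed
  qed
  ultimately show ?thesis using that by blast
qed

lemma size_le_sum_mset:
  fixes M :: "real multiset"
  shows "(\<And>x. x \<in># M \<Longrightarrow> x \<ge> \<mu>) \<Longrightarrow> real (size M) * \<mu> \<le> \<Sum>\<^sub># M"
proof (induction M)
  case (add x M)
  then have "real (size M) * \<mu> \<le> \<Sum>\<^sub># M" "\<mu> \<le> x" by auto
  then show ?case by (simp add: algebra_simps)
qed simp

text \<open>
  In an optimal splitting with the largest number of parts, a decomposable part could be replaced by
  two parts.
\<close>

theorem indecomposable_splitting:
  assumes m: "m > 0"
  obtains M where "optimal_splitting m M" "\<And>x. x \<in># M \<Longrightarrow> indecomposable x"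
proof -
  obtain \<mu> where \<mu>: "\<mu> > 0" "\<And>M x. optimal_splitting m M \<Longrightarrow> x \<in># M \<Longrightarrow> x \<ge> \<mu>"
    using optimal_splitting_lower_bound[OF m] by metis
  have bound: "size M \<le> nat \<lceil>m / \<mu>\<rceil>" if M: "optimal_splitting m M" for M
  proof -
    have "real (size M) * \<mu> \<le> m" using size_le_sum_mset[of M \<mu>] \<mu>(2)[OF M] M by (auto simp: optimal_splitting_def)
    then have "real (size M) \<le> m / \<mu>" using \<mu>(1) by (simp add: field_simps)
    then show ?thesis by linarith
  qed
  then have bound': "\<forall>M. optimal_splitting m M \<longrightarrow> size M < Suc (nat \<lceil>m / \<mu>\<rceil>)"
    unfolding less_Suc_eq_le by (intro allI impI)
  have "optimal_splitting m {#m#}" using m by (simp add: optimal_splitting_def)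
  then have "\<exists>M. optimal_splitting m M \<and> (\<forall>M'. optimal_splitting m M' \<longrightarrow> size M' \<le> size M)"
    by (rule ex_has_greatest_nat[OF _ bound'])
  then obtain M where M: "optimal_splitting m M \<and> (\<forall>M'. optimal_splitting m M' \<longrightarrow> size M' \<le> size M)" ..
  have max: "size M' \<le> size M" if "optimal_splitting m M'" for M' by (rule conjunct2[OF M, rule_format, OF that])
  note M = conjunct1[OF M]
  have "indecomposable x" if x: "x \<in># M" for x
    unfolding indecomposable_def
  proof (intro conjI allI impI)
    show x0: "x > 0" using M x by (simp add: optimal_splitting_def)
    fix a b assume ab: "a > 0" "b > 0" "a + b = x"
    show "j x < j a + j b"
    proof (rule ccontr)
      assume "\<not> j x < j a + j b"
      then have eq: "j a + j b = j x" using j_subadditive[of a b] ab by auto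
      obtain R where R: "M = add_mset x R" using x by (meson multi_member_split)
      have "optimal_splitting m (add_mset a (add_mset b R))"
        using M ab eq unfolding R optimal_splitting_def by (auto simp: add.assoc[symmetric])
      then show False using max[of "add_mset a (add_mset b R)"] unfolding R by simp
    qed
  qed
  then show ?thesis using that M by blast
qed

end

section \<open>The minimal energy of lists of sets\<close>

lemma powr_add_le:
  fixes x y p :: real
  assumes "0 \<le> x" "0 \<le> y" "0 < p" "p \<le> 1"
  shows "(x + y) powr p \<le> x powr p + y powr p"
proof (cases "x = 0 \<or> y = 0")
  case False
  then have xy: "x > 0" "y > 0" using assms by auto
  have "(x + y) powr p = x * (x + y) powr (p - 1) + y * (x + y) powr (p - 1)"
  proof -
    have "(x + y) powr p = (x + y) * (x + y) powr (p - 1)" using xy by (simp add: powr_diff)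
    then show ?thesis by (simp only: distrib_right)
  qed
  also have "\<dots> \<le> x * x powr (p - 1) + y * y powr (p - 1)"
    using xy assms by (intro add_mono mult_left_mono powr_mono2') auto
  also have "\<dots> = x powr p + y powr p" using xy by (simp add: powr_diff)
  finally show ?thesis .
qed auto

lemma measure_affine_image:
  fixes A :: "'a::euclidean_space set"
  assumes "c > 0"
  shows "vol ((\<lambda>x. t + c *\<^sub>R x) ` A) = c ^ DIM('a) * vol A"
  using measure_lebesgue_affine[of c t A] assms by (simp add: add.commute)

lemma affine_image_lmeasurable:
  fixes A :: "'a::euclidean_space set"
  assumes "A \<in> lmeasurable" "c > 0"
  shows "(\<lambda>x. t + c *\<^sub>R x) ` A \<in> lmeasurable"
proof -
  have "emeasure lebesgue ((\<lambda>x. t + c *\<^sub>R x) ` A) = ennreal (c ^ DIM('a)) * emeasure lebesgue A"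
    using emeasure_lebesgue_affine[of c t A] assms(2) by (simp add: add.commute)
  also have "\<dots> < \<infinity>" using fmeasurableD2[OF assms(1)] by (simp add: ennreal_mult_less_top less_top)
  finally show ?thesis using assms by (intro fmeasurableI affine_image_lebesgue) auto
qed

lemma measure_le_of_AE_limit:
  fixes A :: "nat \<Rightarrow> 'a::euclidean_space set"
  assumes A: "\<And>n. A n \<in> lmeasurable" "B \<in> sets lebesgue"
    and conv: "AE x in lebesgue. (\<lambda>n. indicator (A n) x :: real) \<longlonglongrightarrow> indicator B x"
    and le: "\<And>n. vol (A n) \<le> m"
  shows "B \<in> lmeasurable" "vol B \<le> m"
proof -
  have m: "m \<ge> 0" using le[of 0] measure_nonneg[of lebesgue "A 0"] by linarith
  have "emeasure lebesgue B = (\<integral>\<^sup>+x. indicator B x \<partial>lebesgue)" using A by simp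
  also have "\<dots> \<le> (\<integral>\<^sup>+x. liminf (\<lambda>n. indicator (A n) x) \<partial>lebesgue)"
  proof (rule nn_integral_mono_AE)
    show "AE x in lebesgue. (indicator B x :: ennreal) \<le> liminf (\<lambda>n. indicator (A n) x)"
      using conv
    proof eventually_elim
      case (elim x)
      have "(\<lambda>n. ennreal (indicator (A n) x)) \<longlonglongrightarrow> ennreal (indicator B x)" using elim by (intro tendsto_ennrealI)
      then have "liminf (\<lambda>n. ennreal (indicator (A n) x)) = ennreal (indicator B x)" by (intro lim_imp_Liminf) auto
      then show ?case by (simp add: ennreal_indicator)
    qed
  qed
  also have "\<dots> \<le> liminf (\<lambda>n. (\<integral>\<^sup>+x. indicator (A n) x \<partial>lebesgue))"
    using fmeasurableD[OF A(1)] by (intro nn_integral_liminf borel_measurable_indicator)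
  also have "\<dots> \<le> liminf (\<lambda>n::nat. ennreal m)"
  proof (intro Liminf_mono always_eventually allI)
    fix n
    have "(\<integral>\<^sup>+x. indicator (A n) x \<partial>lebesgue) = emeasure lebesgue (A n)" using fmeasurableD[OF A(1)] by simp
    also have "\<dots> \<le> ennreal m" unfolding emeasure_eq_measure2[OF A(1)] by (intro ennreal_leI le)
    finally show "(\<integral>\<^sup>+x. indicator (A n) x \<partial>lebesgue) \<le> ennreal m" .
  qed
  also have "\<dots> = ennreal m" by (simp add: Liminf_const)
  finally have e: "emeasure lebesgue B \<le> ennreal m" .
  show B: "B \<in> lmeasurable" using e A(2) by (intro fmeasurableI) (auto simp: less_top[symmetric] top_unique)
  show "vol B \<le> m" using e m unfolding emeasure_eq_measure2[OF B] by (simp add: ennreal_le_iff)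
qed

context riesz_energy begin

text \<open>
  The part of \<open>A\<close> in a half-space has at most the energy of \<open>A\<close>, and its volume depends continuously on the
  position of the bounding hyperplane.
\<close>

lemma energy_subset_of_volume:
  assumes A: "A \<in> lmeasurable" and f: "F A < top" and m: "0 \<le> m" "m \<le> vol A"
  obtains A' where "A' \<in> lmeasurable" "vol A' = m" "F A' \<le> F A" "A' \<subseteq> A"
proof -
  consider "m = 0" | "m = vol A" | "0 < m" "m < vol A" using m by linarith
  then show ?thesis
  proof cases
    case 1
    then show ?thesis using that[of "{}"] by (simp add: energy_empty)
  next
    case 2
    then show ?thesis using that[of A] A by simp
  next
    case 3
    obtain r where r: "F A = ennreal r" "r \<ge> 0" using f by (cases "F A") auto
    obtain e :: 'a where e: "e \<in> Basis" using nonempty_Basis by blast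
    then have e1: "norm e = 1" "e \<noteq> 0" by auto
    have As: "A \<in> sets lebesgue" using A by auto
    define H where "H t = A \<inter> {x. e \<bullet> x \<le> t}" for t
    have Hs: "H t \<in> lmeasurable" for t unfolding H_def using A
      by (metis borel_closed closed_halfspace_le fmeasurable_Int_fmeasurable sets_completionI_sets sets_lborel)
    define v where "v t = vol (H t)" for t
    have cont: "isCont v t" for t
    proof (rule continuous_at_sequentiallyI)
      fix s assume s: "s \<longlonglongrightarrow> t"
      have "negligible {x. e \<bullet> x = t}" using e1 by (intro negligible_hyperplane) auto
      then have ne: "AE x in lebesgue. x \<notin> {x. e \<bullet> x = t}" by (intro AE_not_in) (simp add: negligible_iff_null_sets)
      show "(\<lambda>n. v (s n)) \<longlonglongrightarrow> v t"
        unfolding v_def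
      proof (rule measure_tendsto_AE[OF fmeasurableD[OF Hs] fmeasurableD[OF Hs] A])
        show "H (s n) \<subseteq> A" for n by (auto simp: H_def)
        show "AE x in lebesgue. (\<lambda>n. indicator (H (s n)) x :: real) \<longlonglongrightarrow> indicator (H t) x"
          using ne
        proof eventually_elim
          case (elim x)
          then consider "e \<bullet> x < t" | "e \<bullet> x > t" by (auto simp: neq_iff)
          then have "\<forall>\<^sub>F n in sequentially. indicator (H (s n)) x = (indicator (H t) x :: real)"
          proof cases
            case 1
            have "\<forall>\<^sub>F n in sequentially. e \<bullet> x < s n" using s 1 by (rule order_tendstoD(1))
            then show ?thesis by eventually_elim (use 1 in \<open>auto simp: H_def indicator_def\<close>)
          next
            case 2
            have "\<forall>\<^sub>F n in sequentially. e \<bullet> x > s n" using s 2 by (rule order_tendstoD(2))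
            then show ?thesis by eventually_elim (use 2 in \<open>auto simp: H_def indicator_def\<close>)
          qed
          then show ?case by (rule tendsto_eventually)
        qed
      qed
    qed
    have "(\<lambda>n. v (real n)) \<longlonglongrightarrow> vol A"
      unfolding v_def
    proof (rule measure_tendsto_AE[OF fmeasurableD[OF Hs] As A])
      show "H (real n) \<subseteq> A" for n by (auto simp: H_def)
      show "AE x in lebesgue. (\<lambda>n. indicator (H (real n)) x :: real) \<longlonglongrightarrow> indicator A x"
      proof (rule always_eventually, rule allI, rule tendsto_eventually)
        fix x
        have "\<forall>\<^sub>F n in sequentially. e \<bullet> x \<le> real n"
          using filterlim_real_sequentially by (simp add: filterlim_at_top)
        then show "\<forall>\<^sub>F n in sequentially. indicator (H (real n)) x = (indicator A x :: real)"
          by eventually_elim (auto simp: H_def indicator_def)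
      qed
    qed
    then have "\<forall>\<^sub>F n in sequentially. v (real n) > m" using 3 by (intro order_tendstoD(1))
    then obtain n1 where n1: "v (real n1) > m" by (meson eventually_happens sequentially_bot)
    have "(\<lambda>n. v (- real n)) \<longlonglongrightarrow> vol ({}::'a set)"
      unfolding v_def
    proof (rule measure_tendsto_AE[OF fmeasurableD[OF Hs] _ A])
      show "H (- real n) \<subseteq> A" for n by (auto simp: H_def)
      show "AE x in lebesgue. (\<lambda>n. indicator (H (- real n)) x :: real) \<longlonglongrightarrow> indicator {} x"
      proof (rule always_eventually, rule allI, rule tendsto_eventually)
        fix x
        have "\<forall>\<^sub>F n in sequentially. - (e \<bullet> x) < real n"
          using filterlim_real_sequentially by (simp add: filterlim_at_top_dense)
        then show "\<forall>\<^sub>F n in sequentially. indicator (H (- real n)) x = (indicator {} x :: real)"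
          by eventually_elim (auto simp: H_def indicator_def)
      qed
    qed simp
    then have "\<forall>\<^sub>F n in sequentially. v (- real n) < m" using 3 by (intro order_tendstoD(2)) auto
    then obtain n2 where n2: "v (- real n2) < m" by (meson eventually_happens sequentially_bot)
    have "\<exists>t\<ge>- real n2. t \<le> real n1 \<and> v t = m"
      using n1 n2 cont by (intro IVT) auto
    then obtain t where t: "v t = m" by blast
    have "F (H t) \<le> F A" unfolding H_def r(1) by (rule energy_Int_halfspace_le[OF A _ r(2) e1(1)]) (simp add: r(1))
    then show ?thesis using that[of "H t"] Hs t by (auto simp: v_def H_def)
  qed
qed

text \<open>
  The sets of a list need not be disjoint, so lists can be concatenated and their members changed
  independently.
\<close>

definition pieces :: "real \<Rightarrow> 'a set list \<Rightarrow> bool" where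
  "pieces m As \<longleftrightarrow> set As \<subseteq> lmeasurable \<and> sum_list (map vol As) = m"

abbreviation total :: "'a set list \<Rightarrow> ennreal" where
  "total As \<equiv> sum_list (map F As)"

definition J :: "real \<Rightarrow> ennreal" where
  "J m = (INF As\<in>{As. pieces m As}. total As)"

text \<open>
  All values of \<open>J\<close> at nonnegative volumes turn out to be finite; real values make the limit arguments
  simpler.
\<close>

definition j :: "real \<Rightarrow> real" where "j m = enn2real (J m)"

lemma pieces_nonneg: "pieces m As \<Longrightarrow> m \<ge> 0"
  by (auto simp: pieces_def intro!: sum_list_nonneg)

lemma J_le: "pieces m As \<Longrightarrow> J m \<le> total As"
  unfolding J_def by (rule INF_lower) simp

lemma pieces_append: "pieces a As \<Longrightarrow> pieces b Bs \<Longrightarrow> pieces (a + b) (As @ Bs)"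
  by (auto simp: pieces_def)

lemma pieces_shrink:
  assumes "pieces b As" "0 \<le> a" "a \<le> b" "total As < top"
  shows "\<exists>As'. pieces a As' \<and> total As' \<le> total As"
  using assms
proof (induction As arbitrary: a b)
  case Nil
  then show ?case by (intro exI[of _ "[]"]) (auto simp: pieces_def)
next
  case (Cons A As)
  define b' where "b' = sum_list (map vol As)"
  have A: "A \<in> lmeasurable" and b': "pieces b' As" and b: "b = vol A + b'"
    using Cons.prems(1) by (auto simp: pieces_def b'_def)
  have fin: "F A < top" "total As < top" using Cons.prems(4) by auto
  show ?case
  proof (cases "a \<le> b'")
    case True
    then obtain As' where As': "pieces a As'" "total As' \<le> total As" using Cons.IH[OF b' Cons.prems(2) _ fin(2)] by blast
    have "total As \<le> total (A # As)" by simp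
    then show ?thesis using As' order_trans by blast
  next
    case False
    then have vol: "0 \<le> a - b'" "a - b' \<le> vol A" using Cons.prems(3) b by auto
    obtain A' where A': "A' \<in> lmeasurable" "vol A' = a - b'" "F A' \<le> F A" "A' \<subseteq> A"
      by (rule energy_subset_of_volume[OF A fin(1) vol])
    have "pieces a (A' # As)" using b' A' by (auto simp: pieces_def)
    moreover have "total (A' # As) \<le> total (A # As)" using A'(3) by (simp add: add_right_mono)
    ultimately show ?thesis by blast
  qed
qed

text \<open>
  Each set is dilated by the factor \<open>t powr (1 / DIM('a))\<close>.
\<close>

lemma pieces_dilate:
  assumes "pieces m As" "t \<ge> 1" "total As \<le> ennreal f" "f \<ge> 0"
  shows "\<exists>As'. pieces (t * m) As' \<and> total As' \<le> ennreal (t\<^sup>2 * f)"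
  using assms
proof (induction As arbitrary: m f)
  case Nil
  then show ?case by (intro exI[of _ "[]"]) (auto simp: pieces_def)
next
  case (Cons A As)
  define m' where "m' = sum_list (map vol As)"
  have A: "A \<in> lmeasurable" and m': "pieces m' As" and m: "m = vol A + m'"
    using Cons.prems(1) by (auto simp: pieces_def m'_def)
  have "F A + total As \<le> ennreal f" using Cons.prems(3) by simp
  then have "F A \<noteq> top" "total As \<noteq> top" by (auto simp: top_unique)
  then obtain x y where x: "F A = ennreal x" "x \<ge> 0" and y: "total As = ennreal y" "y \<ge> 0"
    by (cases "F A"; cases "total As") auto
  have "ennreal (x + y) \<le> ennreal f" using Cons.prems(3) x y by simp
  then have xy: "x + y \<le> f" using Cons.prems(4) by (simp add: ennreal_le_iff)
  obtain As' where As': "pieces (t * m') As'" "total As' \<le> ennreal (t\<^sup>2 * y)"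
    using Cons.IH[OF m' Cons.prems(2) _ y(2)] y by auto
  define c where "c = t powr (1 / DIM('a))"
  have c: "c \<ge> 1" using Cons.prems(2) by (simp add: c_def ge_one_powr_ge_zero)
  have cN: "c ^ DIM('a) = t"
    using Cons.prems(2) by (simp add: c_def powr_powr flip: powr_realpow)
  let ?A = "(\<lambda>x. 0 + c *\<^sub>R x) ` A"
  have "F ?A \<le> ennreal (c ^ (2 * DIM('a)) * x)"
    using A by (intro energy_affine_le c x(2)) (auto simp: x(1))
  also have "c ^ (2 * DIM('a)) = t\<^sup>2" by (simp add: cN power_mult mult.commute[of 2])
  finally have FA: "F ?A \<le> ennreal (t\<^sup>2 * x)" .
  have "pieces (t * m) (?A # As')"
    using As'(1) affine_image_lmeasurable[OF A, of c 0] measure_affine_image[of c 0 A] c m cN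
    by (auto simp: pieces_def distrib_left)
  moreover have "total (?A # As') \<le> ennreal (t\<^sup>2 * x) + ennreal (t\<^sup>2 * y)"
    using FA As'(2) by (simp add: add_mono)
  moreover have "ennreal (t\<^sup>2 * x) + ennreal (t\<^sup>2 * y) \<le> ennreal (t\<^sup>2 * f)"
    using x y xy by (simp add: distrib_left[symmetric] mult_left_mono ennreal_leI flip: ennreal_plus)
  ultimately show ?case using order_trans by blast
qed

lemma J_finite: "m \<ge> 0 \<Longrightarrow> J m < top"
proof -
  assume m: "m \<ge> 0"
  obtain A where A: "A \<in> lmeasurable" "vol A > 0" "F A < top" using finite_energy_set by blast
  obtain f where f: "F A = ennreal f" "f \<ge> 0" using A(3) by (cases "F A") auto
  \<comment> \<open>Large enough that the dilated set has volume at least \<open>m\<close>; it is then cut back to volume \<open>m\<close>.\<close>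
  define t where "t = 1 + m / vol A"
  have t: "t \<ge> 1" using m A by (simp add: t_def)
  have tm: "m \<le> t * vol A" using A(2) by (simp add: t_def field_simps)
  obtain As where As: "pieces (t * vol A) As" "total As \<le> ennreal (t\<^sup>2 * f)"
    using pieces_dilate[of "vol A" "[A]" t f] A f t by (auto simp: pieces_def)
  then have fin: "total As < top" by (meson ennreal_less_top le_less_trans)
  obtain As' where "pieces m As'" "total As' \<le> total As" using pieces_shrink[OF As(1) m tm fin] by blast
  then show "J m < top" using J_le fin by (meson le_less_trans)
qed

lemma J_eq: "m \<ge> 0 \<Longrightarrow> J m = ennreal (j m)"
  using J_finite by (simp add: j_def)

lemma j_nonneg: "j m \<ge> 0" by (simp add: j_def)

lemma j_le:
  assumes "pieces m As" "total As \<le> ennreal f" "f \<ge> 0"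
  shows "j m \<le> f"
proof -
  have "ennreal (j m) \<le> ennreal f"
    using J_le[OF assms(1)] assms(2) J_eq[OF pieces_nonneg[OF assms(1)]] by simp
  then show ?thesis using assms(3) by (simp add: ennreal_le_iff)
qed

lemma j_le_energy:
  assumes "A \<in> lmeasurable" "F A \<le> ennreal f" "f \<ge> 0"
  shows "j (vol A) \<le> f"
  using j_le[of "vol A" "[A]" f] assms by (auto simp: pieces_def)

lemma j_approx:
  assumes "m \<ge> 0" "\<delta> > 0"
  obtains As where "pieces m As" "total As \<le> ennreal (j m + \<delta>)"
proof -
  have "J m < ennreal (j m + \<delta>)" unfolding J_eq[OF assms(1)] using assms(2) j_nonneg by (simp add: ennreal_less_iff)
  then obtain As where "As \<in> {As. pieces m As}" "total As < ennreal (j m + \<delta>)"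
    unfolding J_def INF_less_iff by blast
  then show ?thesis using that by (auto intro: less_imp_le)
qed

lemma total_real:
  assumes "total As \<le> ennreal f"
  shows "total As = ennreal (sum_list (map (\<lambda>A. enn2real (F A)) As))" "A \<in> set As \<Longrightarrow> F A = ennreal (enn2real (F A))"
proof -
  have "total As < top \<Longrightarrow> total As = ennreal (sum_list (map (\<lambda>A. enn2real (F A)) As)) \<and> (\<forall>A\<in>set As. F A = ennreal (enn2real (F A)))"
  proof (induction As)
    case (Cons A As)
    then have IH: "F A < top" "total As = ennreal (sum_list (map (\<lambda>A. enn2real (F A)) As))"
      "\<forall>A\<in>set As. F A = ennreal (enn2real (F A))" by auto
    have FA: "F A = ennreal (enn2real (F A))" using IH(1) by simp
    have "0 \<le> sum_list (map (\<lambda>A. enn2real (F A)) As)" by (intro sum_list_nonneg) auto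
    then have "total (A # As) = ennreal (sum_list (map (\<lambda>A. enn2real (F A)) (A # As)))"
      using IH(2) FA ennreal_plus[of "enn2real (F A)" "sum_list (map (\<lambda>A. enn2real (F A)) As)"] by simp
    then show ?case using IH(3) FA by simp
  qed simp
  moreover have "total As < top" using assms ennreal_less_top le_less_trans by blast
  ultimately show "total As = ennreal (sum_list (map (\<lambda>A. enn2real (F A)) As))" "A \<in> set As \<Longrightarrow> F A = ennreal (enn2real (F A))" by auto
qed

section \<open>The minimal energy as a volume profile\<close>

lemma energy_isoperimetric:
  obtains c :: real where "c > 0"
    "\<And>A f. A \<in> lmeasurable \<Longrightarrow> F A \<le> ennreal f \<Longrightarrow> f \<ge> 0 \<Longrightarrow> c * vol A powr (1 - 1 / DIM('a)) \<le> f"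
proof -
  obtain c :: real where c: "c > 0"
    "\<And>(A :: 'a set) P. A \<in> lmeasurable \<Longrightarrow> perimeter A \<le> ennreal P \<Longrightarrow> P \<ge> 0 \<Longrightarrow>
      c * vol A powr (1 - 1 / DIM('a)) \<le> P"
    by (rule isoperimetric_inequality) (rule that)
  show ?thesis
  proof (rule that[OF c(1)])
    fix A f assume A: "A \<in> lmeasurable" "F A \<le> ennreal f" "f \<ge> 0"
    have "perimeter A \<le> ennreal f" using perimeter_le_energy A(2) by (rule order_trans)
    then show "c * vol A powr (1 - 1 / DIM('a)) \<le> f" by (rule c(2)[OF A(1) _ A(3)])
  qed
qed

text \<open>
  Some constant of the isoperimetric inequality, fixed so that it can serve as a parameter of the
  sublocale below.
\<close>

definition iso_const :: real where
  "iso_const = (SOME c. c > 0 \<and> (\<forall>A f. A \<in> lmeasurable \<longrightarrow> F A \<le> ennreal f \<longrightarrow> f \<ge> 0 \<longrightarrow>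
     c * vol A powr (1 - 1 / DIM('a)) \<le> f))"

lemma iso_const: "iso_const > 0" "A \<in> lmeasurable \<Longrightarrow> F A \<le> ennreal f \<Longrightarrow> f \<ge> 0 \<Longrightarrow> iso_const * vol A powr (1 - 1 / DIM('a)) \<le> f"
proof -
  have "\<exists>c. c > 0 \<and> (\<forall>A f. A \<in> lmeasurable \<longrightarrow> F A \<le> ennreal f \<longrightarrow> f \<ge> 0 \<longrightarrow>
     c * vol A powr (1 - 1 / DIM('a)) \<le> f)"
    by (rule energy_isoperimetric) blast
  then have "iso_const > 0 \<and> (\<forall>A f. A \<in> lmeasurable \<longrightarrow> F A \<le> ennreal f \<longrightarrow> f \<ge> 0 \<longrightarrow>
     iso_const * vol A powr (1 - 1 / DIM('a)) \<le> f)" unfolding iso_const_def by (rule someI_ex)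
  then show "iso_const > 0" "A \<in> lmeasurable \<Longrightarrow> F A \<le> ennreal f \<Longrightarrow> f \<ge> 0 \<Longrightarrow> iso_const * vol A powr (1 - 1 / DIM('a)) \<le> f" by auto
qed

lemma exponent_bounds: "0 < (1 - 1 / DIM('a))" "(1 - 1 / DIM('a)) < 1"
proof -
  have "real DIM('a) \<ge> 2" using dim by simp
  then show "0 < (1 - 1 / DIM('a))" by simp
  show "(1 - 1 / DIM('a)) < 1" by simp
qed

lemma pieces_isoperimetric:
  assumes "pieces m As" "total As \<le> ennreal f" "f \<ge> 0"
  shows "(\<Sum>A\<leftarrow>As. iso_const * vol A powr (1 - 1 / DIM('a))) \<le> f"
    and "iso_const * m powr (1 - 1 / DIM('a)) \<le> (\<Sum>A\<leftarrow>As. iso_const * vol A powr (1 - 1 / DIM('a)))"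
proof -
  note tr = total_real[OF assms(2)]
  have "(\<Sum>A\<leftarrow>As. iso_const * vol A powr (1 - 1 / DIM('a))) \<le> (\<Sum>A\<leftarrow>As. enn2real (F A))"
  proof (rule sum_list_mono)
    fix A assume A: "A \<in> set As"
    have "A \<in> lmeasurable" using A assms(1) by (auto simp: pieces_def)
    then show "iso_const * vol A powr (1 - 1 / DIM('a)) \<le> enn2real (F A)"
      using tr(2)[OF A] by (intro iso_const(2)) auto
  qed
  also have "\<dots> \<le> f"
  proof -
    have "ennreal (\<Sum>A\<leftarrow>As. enn2real (F A)) \<le> ennreal f" using tr(1) assms(2) by simp
    then show ?thesis using assms(3) by (simp add: ennreal_le_iff)
  qed
  finally show "(\<Sum>A\<leftarrow>As. iso_const * vol A powr (1 - 1 / DIM('a))) \<le> f" .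
  have "iso_const * (\<Sum>A\<leftarrow>Bs. vol A) powr (1 - 1 / DIM('a)) \<le> (\<Sum>A\<leftarrow>Bs. iso_const * vol A powr (1 - 1 / DIM('a)))" for Bs :: "'a set list"
  proof (induction Bs)
    case (Cons B Bs)
    have "0 \<le> (\<Sum>A\<leftarrow>Bs. vol A)" by (intro sum_list_nonneg) auto
    then have "(vol B + (\<Sum>A\<leftarrow>Bs. vol A)) powr (1 - 1 / DIM('a))
      \<le> vol B powr (1 - 1 / DIM('a)) + (\<Sum>A\<leftarrow>Bs. vol A) powr (1 - 1 / DIM('a))"
      using exponent_bounds by (intro powr_add_le) auto
    then have "iso_const * (vol B + (\<Sum>A\<leftarrow>Bs. vol A)) powr (1 - 1 / DIM('a))
      \<le> iso_const * (vol B powr (1 - 1 / DIM('a)) + (\<Sum>A\<leftarrow>Bs. vol A) powr (1 - 1 / DIM('a)))"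
      using iso_const(1) by (intro mult_left_mono) auto
    then show ?case using Cons by (simp add: distrib_left)
  qed simp
  then show "iso_const * m powr (1 - 1 / DIM('a)) \<le> (\<Sum>A\<leftarrow>As. iso_const * vol A powr (1 - 1 / DIM('a)))"
    using assms(1) unfolding pieces_def by blast
qed

sublocale vp: volume_profile j iso_const "1 - 1 / DIM('a)"
proof
  show "j 0 = 0"
    using j_le[of 0 "[]" 0] j_nonneg[of 0] by (simp add: pieces_def)
  show "j (a + b) \<le> j a + j b" if ab: "0 \<le> a" "0 \<le> b" for a b
  proof (rule field_le_epsilon)
    fix e :: real assume e: "e > 0"
    obtain As where As: "pieces a As" "total As \<le> ennreal (j a + e/2)" using j_approx[OF ab(1), of "e/2"] e by auto
    obtain Bs where Bs: "pieces b Bs" "total Bs \<le> ennreal (j b + e/2)" using j_approx[OF ab(2), of "e/2"] e by auto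
    have "total (As @ Bs) \<le> ennreal (j a + e/2) + ennreal (j b + e/2)" using As Bs by (simp add: add_mono)
    also have "\<dots> = ennreal ((j a + e/2) + (j b + e/2))"
      using e j_nonneg[of a] j_nonneg[of b] by (intro ennreal_plus[symmetric]) auto
    also have "(j a + e/2) + (j b + e/2) = j a + j b + e" by simp
    finally show "j (a + b) \<le> j a + j b + e"
      using e j_nonneg[of a] j_nonneg[of b] by (intro j_le[OF pieces_append[OF As(1) Bs(1)]]) auto
  qed
  show "j a \<le> j b" if ab: "0 \<le> a" "a \<le> b" for a b
  proof (rule field_le_epsilon)
    fix e :: real assume e: "e > 0"
    obtain Bs where Bs: "pieces b Bs" "total Bs \<le> ennreal (j b + e)" using j_approx[of b e] ab e by auto
    have "total Bs < top" using Bs(2) ennreal_less_top le_less_trans by blast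
    then obtain As where As: "pieces a As" "total As \<le> total Bs" using pieces_shrink[OF Bs(1) ab] by blast
    show "j a \<le> j b + e" using e j_nonneg[of b] by (intro j_le[OF As(1) order_trans[OF As(2) Bs(2)]]) auto
  qed
  show "j (t * m) \<le> t\<^sup>2 * j m" if mt: "0 < m" "1 \<le> t" for m t
  proof (rule field_le_epsilon)
    fix e :: real assume e: "e > 0"
    have t0: "t\<^sup>2 > 0" using mt by simp
    have e': "e / t\<^sup>2 > 0" using e t0 by simp
    obtain As where As: "pieces m As" "total As \<le> ennreal (j m + e / t\<^sup>2)" using j_approx[of m "e / t\<^sup>2"] mt e' by auto
    have nn: "j m + e / t\<^sup>2 \<ge> 0" using e' j_nonneg[of m] by simp
    obtain Bs where Bs: "pieces (t * m) Bs" "total Bs \<le> ennreal (t\<^sup>2 * (j m + e / t\<^sup>2))"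
      using pieces_dilate[OF As(1) mt(2) As(2) nn] by blast
    have eq: "t\<^sup>2 * (j m + e / t\<^sup>2) = t\<^sup>2 * j m + e" using t0 by (simp add: distrib_left)
    show "j (t * m) \<le> t\<^sup>2 * j m + e" using Bs nn t0 unfolding eq[symmetric] by (intro j_le[OF Bs]) auto
  qed
  show "iso_const * m powr (1 - 1 / DIM('a)) \<le> j m" if m: "0 \<le> m" for m
  proof (rule field_le_epsilon)
    fix e :: real assume e: "e > 0"
    obtain As where As: "pieces m As" "total As \<le> ennreal (j m + e)" using j_approx[OF m e] by auto
    have nn: "j m + e \<ge> 0" using e j_nonneg[of m] by simp
    show "iso_const * m powr (1 - 1 / DIM('a)) \<le> j m + e" using pieces_isoperimetric[OF As nn] by linarith
  qed
qed (use iso_const(1) exponent_bounds in auto)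

text \<open>
  Separates the largest set of a nearly optimal list from the others, whose energy is at least \<open>j\<close> of the
  remaining volume.
\<close>

lemma large_piece_of_splitting:
  assumes As: "pieces m As" "total As \<le> ennreal f" and m: "m > 0" and f: "f \<ge> 0"
  obtains A x where "A \<in> lmeasurable" "F A \<le> ennreal x" "x \<ge> 0" "vol A \<le> m"
    "(iso_const * m / f) powr (1 / (1 - (1 - 1 / DIM('a)))) \<le> vol A" "x + j (m - vol A) \<le> f"
proof -
  define M where "M = mset (map vol As)"
  have "\<exists>x. x \<in># M \<and> f > 0 \<and> x \<ge> (iso_const * m / f) powr (1 / (1 - (1 - 1 / DIM('a))))"
  proof (rule large_piece[OF _ _ m _ iso_const(1) exponent_bounds])
    show "\<Sum>\<^sub># M = m" unfolding M_def sum_mset_sum_list using As(1) by (simp add: pieces_def)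
    have "(\<Sum>x\<in>#M. iso_const * x powr (1 - 1 / DIM('a))) = (\<Sum>A\<leftarrow>As. iso_const * vol A powr (1 - 1 / DIM('a)))"
      by (simp only: M_def mset_map[symmetric] sum_mset_sum_list map_map comp_def)
    then show "(\<Sum>x\<in>#M. iso_const * x powr (1 - 1 / DIM('a))) \<le> f" using pieces_isoperimetric(1)[OF As f] by simp
  qed (auto simp: M_def)
  then obtain A where A: "A \<in> set As" "(iso_const * m / f) powr (1 / (1 - (1 - 1 / DIM('a)))) \<le> vol A"
    by (auto simp: M_def)
  then obtain xs ys where xy: "As = xs @ A # ys" by (meson split_list)
  have Alm: "A \<in> lmeasurable" using A(1) As(1) by (auto simp: pieces_def)
  have rest: "pieces (m - vol A) (xs @ ys)" using As(1) unfolding xy pieces_def by auto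
  note tr = total_real[OF As(2)]
  define x where "x = enn2real (F A)"
  define y where "y = (\<Sum>A\<leftarrow>xs @ ys. enn2real (F A))"
  have y: "y \<ge> 0" unfolding y_def by (intro sum_list_nonneg) auto
  have Fx: "F A = ennreal x" "x \<ge> 0" using tr(2)[OF A(1)] by (simp_all add: x_def)
  have le: "total As \<le> ennreal f" by (rule As(2))
  have split: "total As = F A + total (xs @ ys)" unfolding xy by (simp add: ac_simps)
  then have "total (xs @ ys) \<le> ennreal f" using le by (metis add_increasing order_trans le_add2 le_iff_add add.commute)
  then have ty: "total (xs @ ys) = ennreal y" unfolding y_def by (rule total_real(1))
  have "ennreal (x + y) \<le> ennreal f" using le Fx y unfolding split ty by simp
  then have "x + y \<le> f" using f by (simp add: ennreal_le_iff)
  moreover have "j (m - vol A) \<le> y" using ty y by (intro j_le[OF rest]) auto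
  ultimately have "x + j (m - vol A) \<le> f" by linarith
  then show ?thesis using that[OF Alm _ Fx(2) _ A(2)] Fx(1) pieces_nonneg[OF rest] by auto
qed

lemma indecomposable_split:
  assumes "vp.indecomposable m" "0 \<le> a" "a \<le> m" "j a + j (m - a) \<le> j m"
  shows "a = 0 \<or> a = m"
proof (rule ccontr)
  assume "\<not> ?thesis"
  then have "a > 0" "m - a > 0" "a + (m - a) = m" using assms(2,3) by auto
  then have "j m < j a + j (m - a)" using assms(1) unfolding vp.indecomposable_def by blast
  then show False using assms(4) by simp
qed

section \<open>Minimisers for indecomposable volumes\<close>

text \<open>
  The largest sets of nearly optimal lists have volumes bounded below. By lower semicontinuity a limit
  \<open>l\<close> of these volumes satisfies \<open>j l + j (m - l) \<le> j m\<close>, so \<open>l = m\<close>.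
\<close>

lemma minimising_sequence:
  assumes m: "vp.indecomposable m"
  obtains A x where "\<And>n. A n \<in> lmeasurable" "\<And>n. F (A n) \<le> ennreal (x n)" "\<And>n. x n \<ge> 0"
    "x \<longlonglongrightarrow> j m" "(\<lambda>n. vol (A n)) \<longlonglongrightarrow> m" "\<And>n. vol (A n) \<le> m"
    "\<And>n. x n \<le> j m + 1"
proof -
  have m0: "m > 0" using m by (simp add: vp.indecomposable_def)
  define \<beta> where "\<beta> = (iso_const * m / (j m + 1)) powr (1 / (1 - (1 - 1 / DIM('a))))"
  have jm: "j m \<ge> 0" by (rule j_nonneg)
  have \<beta>: "\<beta> > 0" using m0 iso_const(1) jm by (simp add: \<beta>_def)
  have ex: "\<exists>A x. A \<in> lmeasurable \<and> F A \<le> ennreal x \<and> x \<ge> 0 \<and> vol A \<le> m \<and>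
    \<beta> \<le> vol A \<and> x + j (m - vol A) \<le> j m + 1 / real (Suc n)" for n
  proof -
    let ?f = "j m + 1 / real (Suc n)"
    have f: "?f > 0" using jm by (simp add: add_nonneg_pos)
    obtain As where As: "pieces m As" "total As \<le> ennreal ?f" using j_approx[of m "1 / real (Suc n)"] m0 by auto
    obtain A x where Ax: "A \<in> lmeasurable" "F A \<le> ennreal x" "x \<ge> 0" "vol A \<le> m"
      "(iso_const * m / ?f) powr (1 / (1 - (1 - 1 / DIM('a)))) \<le> vol A" "x + j (m - vol A) \<le> ?f"
      by (rule large_piece_of_splitting[OF As m0 less_imp_le[OF f]])
    have "1 / real (Suc n) \<le> 1" "j m + 1 > 0" using jm by simp_all
    then have "iso_const * m / (j m + 1) \<le> iso_const * m / ?f" using f m0 iso_const(1) by (intro divide_left_mono mult_pos_pos) auto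
    then have "\<beta> \<le> (iso_const * m / ?f) powr (1 / (1 - (1 - 1 / DIM('a))))" unfolding \<beta>_def using exponent_bounds m0 iso_const(1) jm by (intro powr_mono2) auto
    then show ?thesis using Ax by (intro exI[of _ A] exI[of _ x]) auto
  qed
  then obtain A x where Ax: "\<And>n. A n \<in> lmeasurable" "\<And>n. F (A n) \<le> ennreal (x n)" "\<And>n. x n \<ge> 0"
    "\<And>n. vol (A n) \<le> m" "\<And>n. \<beta> \<le> vol (A n)"
    "\<And>n. x n + j (m - vol (A n)) \<le> j m + 1 / real (Suc n)" by metis
  have "bounded (range (\<lambda>n. vol (A n)))"
    by (rule boundedI[of _ m]) (use Ax(4) in auto)
  from bounded_imp_convergent_subsequence[OF this]
  obtain l r where r: "strict_mono r" "((\<lambda>n. vol (A n)) \<circ> r) \<longlonglongrightarrow> l" by metis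
  have lim: "(\<lambda>n. vol (A (r n))) \<longlonglongrightarrow> l" using r(2) by (simp add: comp_def)
  have err: "(\<lambda>n. j m + 1 / real (Suc (r n))) \<longlonglongrightarrow> j m + 0"
    using LIMSEQ_subseq_LIMSEQ[OF LIMSEQ_Suc[OF lim_const_over_n[of "1::real"]] r(1)] by (intro tendsto_intros) (simp add: comp_def)
  have l: "\<beta> \<le> l" "l \<le> m" using LIMSEQ_le_const[OF lim] LIMSEQ_le_const2[OF lim] Ax(4,5) by blast+
  have jx: "j (vol (A n)) \<le> x n" for n by (rule j_le_energy[OF Ax(1,2,3)])
  have "j l + j (m - l) \<le> j m + 0"
  proof (rule vp.j_sum_lower_semicontinuous[OF lim tendsto_diff[OF tendsto_const lim] err])
    show "0 \<le> m - vol (A (r n))" for n using Ax(4)[of "r n"] by simp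
    show "j (vol (A (r n))) + j (m - vol (A (r n))) \<le> j m + 1 / real (Suc (r n))" for n
      using Ax(6)[of "r n"] jx[of "r n"] by linarith
  qed simp
  then have "l = 0 \<or> l = m" using l \<beta> by (intro indecomposable_split[OF m]) auto
  then have lm: "l = m" using l \<beta> by auto
  define y where "y n = j m + 1 / real (Suc (r n))" for n
  have xy: "x (r n) \<le> y n" for n
    using Ax(6)[of "r n"] j_nonneg[of "m - vol (A (r n))"] unfolding y_def by linarith
  show ?thesis
  proof (rule that[of "\<lambda>n. A (r n)" y])
    show "F (A (r n)) \<le> ennreal (y n)" for n using Ax(2) ennreal_leI[OF xy] by (rule order_trans)
    show "0 \<le> y n" for n using Ax(3) xy by (rule order_trans)
    show "y \<longlonglongrightarrow> j m" unfolding y_def using err by simp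
    show "(\<lambda>n. vol (A (r n))) \<longlonglongrightarrow> m" using lim unfolding lm .
    have "1 / real (Suc (r n)) \<le> 1" for n by simp
    then show "y n \<le> j m + 1" for n unfolding y_def by (rule add_left_mono)
  qed (use Ax in auto)
qed

text \<open>
  Compactness gives a limit set; that it keeps the whole volume follows from indecomposability once the
  sequence has been cut by spheres of growing radius.
\<close>

theorem indecomposable_attained:
  assumes m: "vp.indecomposable m"
  obtains B where "B \<in> lmeasurable" "vol B = m" "F B \<le> ennreal (j m)"
proof -
  have m0: "m > 0" using m by (simp add: vp.indecomposable_def)
  have jm: "j m \<ge> 0" by (rule j_nonneg)
  obtain A x where A: "\<And>n. A n \<in> lmeasurable" "\<And>n. F (A n) \<le> ennreal (x n)" "\<And>n. x n \<ge> 0"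
    "x \<longlonglongrightarrow> j m" "(\<lambda>n. vol (A n)) \<longlonglongrightarrow> m" "\<And>n. vol (A n) \<le> m"
    "\<And>n. x n \<le> j m + 1"
    by (rule minimising_sequence[OF m]) (rule that)
  define K where "K = j m + 1"
  have K: "K > 0" using jm by (simp add: K_def)
  have PA: "perimeter (A n) \<le> ennreal K" for n
  proof -
    have "perimeter (A n) \<le> ennreal (x n)" using perimeter_le_energy A(2) by (rule order_trans)
    also have "\<dots> \<le> ennreal K" unfolding K_def by (rule ennreal_leI[OF A(7)])
    finally show ?thesis .
  qed
  \<comment> \<open>Sets of perimeter at most \<open>K\<close> and volume more than \<open>m / 2\<close> concentrate in balls of this radius.\<close>
  define r where "r = m / (8 * K)"
  have r: "r > 0" using m0 K by (simp add: r_def)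
  define V where "V = vol (ball (0::'a) r)"
  have V: "V > 0" unfolding V_def using content_ball_pos[OF r] by simp
  have "\<forall>\<^sub>F n in sequentially. vol (A n) > m / 2"
    using A(5) m0 by (intro order_tendstoD(1)) auto
  then obtain n0 where n0: "\<And>n. n \<ge> n0 \<Longrightarrow> vol (A n) > m / 2" by (auto simp: eventually_sequentially)
  have "\<exists>c. vol (A (n + n0) \<inter> ball c r) > V / 2" for n
  proof -
    have "2 * r * K < vol (A (n + n0))" using n0[of "n + n0"] K m0 by (simp add: r_def)
    then show ?thesis unfolding V_def
      using concentration[OF A(1) PA less_imp_le[OF K] r] by metis
  qed
  then obtain c where c: "\<And>n. vol (A (n + n0) \<inter> ball (c n) r) > V / 2" by metis
  define B where "B n = (\<lambda>x. - c n + 1 *\<^sub>R x) ` A (n + n0)" for n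
  have Blm: "B n \<in> lmeasurable" for n unfolding B_def by (rule affine_image_lmeasurable[OF A(1)]) simp
  have Bm: "vol (B n) = vol (A (n + n0))" for n
    unfolding B_def using measure_affine_image[of 1 "- c n" "A (n + n0)"] by simp
  have BF: "F (B n) \<le> ennreal (x (n + n0))" for n
    unfolding B_def using energy_affine_le[OF fmeasurableD[OF A(1)] order.refl A(2,3), of "- c n"] by simp
  have BP: "perimeter (B n) \<le> ennreal K" for n
  proof -
    have "perimeter (B n) \<le> ennreal (x (n + n0))" using perimeter_le_energy BF by (rule order_trans)
    also have "\<dots> \<le> ennreal K" unfolding K_def by (rule ennreal_leI[OF A(7)])
    finally show ?thesis .
  qed
  have Bc: "vol (B n \<inter> ball 0 r) > V / 2" for n
  proof -
    have "B n \<inter> ball 0 r = (\<lambda>x. - c n + 1 *\<^sub>R x) ` (A (n + n0) \<inter> ball (c n) r)"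
    proof
      show "B n \<inter> ball 0 r \<subseteq> (\<lambda>x. - c n + 1 *\<^sub>R x) ` (A (n + n0) \<inter> ball (c n) r)"
        by (auto simp: B_def dist_norm norm_minus_commute)
      show "(\<lambda>x. - c n + 1 *\<^sub>R x) ` (A (n + n0) \<inter> ball (c n) r) \<subseteq> B n \<inter> ball 0 r"
        by (auto simp: B_def dist_norm norm_minus_commute)
    qed
    then show ?thesis using measure_affine_image[of 1 "- c n" "A (n + n0) \<inter> ball (c n) r"] c[of n] by simp
  qed
  obtain s :: "nat \<Rightarrow> nat" and E where s: "strict_mono s" "E \<in> sets lebesgue"
    "AE x in lebesgue. (\<lambda>n. indicator (B (s n)) x :: real) \<longlonglongrightarrow> indicator E x"
    by (rule perimeter_compactness[OF Blm BP less_imp_le[OF K]])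
  have Bs: "B n \<in> sets lebesgue" for n using Blm by auto
  have mBs: "vol (B n) \<le> m" for n unfolding Bm by (rule A(6))
  note E = measure_le_of_AE_limit[OF Blm s(2,3) mBs]
  have trunc: "(\<lambda>n. vol (B (s n) \<inter> D)) \<longlonglongrightarrow> vol (E \<inter> D)" if D: "D \<in> lmeasurable" for D
  proof (rule measure_tendsto_AE[OF _ _ D])
    show "AE x in lebesgue. (\<lambda>n. indicator (B (s n) \<inter> D) x :: real) \<longlonglongrightarrow> indicator (E \<inter> D) x"
      using s(3)
    proof eventually_elim
      case (elim x)
      then have "(\<lambda>n. indicator (B (s n)) x * indicator D x :: real) \<longlonglongrightarrow> indicator E x * indicator D x"
        by (intro tendsto_intros)
      then show ?case by (simp add: indicator_inter_arith)
    qed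
  qed (use Bs s(2) D in auto)
  have E0: "vol E > 0"
  proof -
    have "V / 2 \<le> vol (E \<inter> ball 0 r)"
      using LIMSEQ_le_const[OF trunc[OF lmeasurable_ball]] Bc by (meson less_imp_le)
    also have "\<dots> \<le> vol E" using E(1) by (intro measure_mono_fmeasurable) auto
    finally show ?thesis using V by linarith
  qed
  define xs where "xs n = x (s n + n0)" for n
  have xs: "xs \<longlonglongrightarrow> j m"
  proof -
    have "strict_mono (\<lambda>n. s n + n0)" using s(1) by (simp add: strict_mono_def)
    then show ?thesis using LIMSEQ_subseq_LIMSEQ[OF A(4), of "\<lambda>n. s n + n0"] unfolding xs_def comp_def by simp
  qed
  have mlim: "(\<lambda>n. vol (B (s n))) \<longlonglongrightarrow> m"
  proof -
    have "strict_mono (\<lambda>n. s n + n0)" using s(1) by (simp add: strict_mono_def)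
    then show ?thesis using LIMSEQ_subseq_LIMSEQ[OF A(5), of "\<lambda>n. s n + n0"] unfolding Bm comp_def by simp
  qed
  let ?u = "\<lambda>t. {x::'a. soft_norm x < t}"
  have ulm: "?u t \<in> lmeasurable" for t using annulus_lmeasurable(1)[of UNIV t] by simp
  \<comment> \<open>For each \<open>k\<close> a late member of the sequence is cut at a radius between \<open>k + 1\<close> and \<open>2 * (k + 1)\<close>. Its
    inner part has nearly the volume of the limit set, and the cut costs at most \<open>4 * m / (k + 1)\<close>.\<close>
  have "\<exists>n t. n \<ge> k \<and> real (Suc k) \<le> t \<and> t \<le> 2 * real (Suc k)
      \<and> F (B (s n) \<inter> ?u t) + F (B (s n) - ?u t) \<le> ennreal (xs n + 4 * m / real (Suc k))
      \<and> vol (E \<inter> ?u (real (Suc k))) - 1 / real (Suc k) \<le> vol (B (s n) \<inter> ?u t)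
      \<and> vol (B (s n) \<inter> ?u t) \<le> vol E + 1 / real (Suc k)" for k
  proof -
    define h where "h = 1 / real (Suc k)"
    have h: "h > 0" by (simp add: h_def)
    have "\<forall>\<^sub>F n in sequentially. vol (B (s n) \<inter> ?u (real (Suc k))) > vol (E \<inter> ?u (real (Suc k))) - h"
      using trunc[OF ulm] h by (intro order_tendstoD(1)) auto
    moreover have "\<forall>\<^sub>F n in sequentially. vol (B (s n) \<inter> ?u (2 * real (Suc k))) < vol (E \<inter> ?u (2 * real (Suc k))) + h"
      using trunc[OF ulm] h by (intro order_tendstoD(2)) auto
    moreover have "\<forall>\<^sub>F n in sequentially. n \<ge> k" by (rule eventually_ge_at_top)
    ultimately have "\<forall>\<^sub>F n in sequentially. n \<ge> k
        \<and> vol (B (s n) \<inter> ?u (real (Suc k))) > vol (E \<inter> ?u (real (Suc k))) - h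
        \<and> vol (B (s n) \<inter> ?u (2 * real (Suc k))) < vol (E \<inter> ?u (2 * real (Suc k))) + h"
      by eventually_elim blast
    from eventually_happens'[OF sequentially_bot this] obtain n where n: "n \<ge> k"
      "vol (B (s n) \<inter> ?u (real (Suc k))) > vol (E \<inter> ?u (real (Suc k))) - h"
      "vol (B (s n) \<inter> ?u (2 * real (Suc k))) < vol (E \<inter> ?u (2 * real (Suc k))) + h"
      by blast
    let ?C = "B (s n)"
    have FC: "F ?C \<le> ennreal (xs n)" unfolding xs_def by (rule BF)
    have xs0: "xs n \<ge> 0" unfolding xs_def by (rule A(3))
    have lt: "real (Suc k) < 2 * real (Suc k)" by simp
    obtain t where t: "real (Suc k) \<le> t" "t \<le> 2 * real (Suc k)"
      "F (?C \<inter> ?u t) + F (?C - ?u t) \<le> ennreal (xs n + 4 * vol (?C \<inter> {x. real (Suc k) \<le> soft_norm x \<and> soft_norm x < 2 * real (Suc k)}) / (2 * real (Suc k) - real (Suc k)))"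
      by (rule energy_cut[OF Bs FC xs0 lt])
    have "vol (?C \<inter> {x. real (Suc k) \<le> soft_norm x \<and> soft_norm x < 2 * real (Suc k)}) \<le> vol ?C"
      using annulus_lmeasurable(2)[OF Bs] by (intro measure_mono_fmeasurable Blm) auto
    then have "4 * vol (?C \<inter> {x. real (Suc k) \<le> soft_norm x \<and> soft_norm x < 2 * real (Suc k)}) \<le> 4 * m"
      using mBs[of "s n"] by linarith
    then have "4 * vol (?C \<inter> {x. real (Suc k) \<le> soft_norm x \<and> soft_norm x < 2 * real (Suc k)}) / (2 * real (Suc k) - real (Suc k))
      \<le> 4 * m / real (Suc k)" by (simp add: divide_right_mono)
    then have 1: "F (?C \<inter> ?u t) + F (?C - ?u t) \<le> ennreal (xs n + 4 * m / real (Suc k))"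
      by (intro order_trans[OF t(3)] ennreal_leI add_left_mono)
    have mono: "vol (S \<inter> ?u a) \<le> vol (S \<inter> ?u b)" if "S \<in> sets lebesgue" "a \<le> b" for S a b
      using annulus_lmeasurable(1)[OF that(1)] that(2) by (intro measure_mono_fmeasurable) (auto intro: less_le_trans)
    have 2: "vol (E \<inter> ?u (real (Suc k))) - h \<le> vol (?C \<inter> ?u t)"
      using n(2) mono[OF Bs t(1), of "s n"] by linarith
    have "vol (E \<inter> ?u (2 * real (Suc k))) \<le> vol E"
      using annulus_lmeasurable(1)[OF s(2)] E(1) by (intro measure_mono_fmeasurable) auto
    then have 3: "vol (?C \<inter> ?u t) \<le> vol E + h"
      using n(3) mono[OF Bs t(2), of "s n"] by linarith
    show ?thesis using n(1) t(1,2) 1 2 3 unfolding h_def by blast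
  qed
  then obtain n t where nt: "\<And>k. n k \<ge> k"
      "\<And>k. F (B (s (n k)) \<inter> ?u (t k)) + F (B (s (n k)) - ?u (t k)) \<le> ennreal (xs (n k) + 4 * m / real (Suc k))"
      "\<And>k. vol (E \<inter> ?u (real (Suc k))) - 1 / real (Suc k) \<le> vol (B (s (n k)) \<inter> ?u (t k))"
      "\<And>k. vol (B (s (n k)) \<inter> ?u (t k)) \<le> vol E + 1 / real (Suc k)" by metis
  define y where "y k = vol (B (s (n k)) \<inter> ?u (t k))" for k
  define z where "z k = vol (B (s (n k)) - ?u (t k))" for k
  have yz: "y k + z k = vol (B (s (n k)))" for k
  proof -
    have eq: "B (s (n k)) - ?u (t k) = B (s (n k)) - B (s (n k)) \<inter> ?u (t k)" by auto
    show ?thesis unfolding y_def z_def eq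
      by (subst measurable_measure_Diff[OF Blm fmeasurableD[OF annulus_lmeasurable(1)[OF Bs]]]) auto
  qed
  have nlim: "filterlim n at_top sequentially"
    using filterlim_at_top_mono[OF filterlim_ident[of sequentially]] nt(1) by (simp add: always_eventually)
  have inv: "(\<lambda>k. 1 / real (Suc k)) \<longlonglongrightarrow> 0" by (rule LIMSEQ_Suc[OF lim_const_over_n])
  have ylim: "y \<longlonglongrightarrow> vol E"
  proof (rule tendsto_sandwich)
    show "\<forall>\<^sub>F k in sequentially. vol (E \<inter> ?u (real (Suc k))) - 1 / real (Suc k) \<le> y k"
      "\<forall>\<^sub>F k in sequentially. y k \<le> vol E + 1 / real (Suc k)"
      using nt(3,4) unfolding y_def by (simp_all add: always_eventually)
    have "filterlim (\<lambda>k. real (Suc k)) at_top sequentially"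
      by (rule filterlim_compose[OF filterlim_real_sequentially filterlim_Suc])
    from tendsto_diff[OF measure_truncation_tendsto[OF E(1) this] inv]
    show "(\<lambda>k. vol (E \<inter> ?u (real (Suc k))) - 1 / real (Suc k)) \<longlonglongrightarrow> vol E" by simp
    from tendsto_add[OF tendsto_const inv, of "vol E"]
    show "(\<lambda>k. vol E + 1 / real (Suc k)) \<longlonglongrightarrow> vol E" by simp
  qed
  have zlim: "z \<longlonglongrightarrow> m - vol E"
  proof -
    have "(\<lambda>k. vol (B (s (n k)))) \<longlonglongrightarrow> m"
      using filterlim_compose[OF mlim nlim] .
    then have "(\<lambda>k. vol (B (s (n k))) - y k) \<longlonglongrightarrow> m - vol E"
      using ylim by (rule tendsto_diff)
    moreover have "(\<lambda>k. vol (B (s (n k))) - y k) = z" using yz by (auto simp: fun_eq_iff algebra_simps)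
    ultimately show ?thesis by simp
  qed
  have blim: "(\<lambda>k. xs (n k) + 4 * m / real (Suc k)) \<longlonglongrightarrow> j m + 0"
    using filterlim_compose[OF xs nlim] LIMSEQ_Suc[OF lim_const_over_n[of "4 * m"]] by (rule tendsto_add)
  have "j (vol E) + j (m - vol E) \<le> j m + 0"
  proof (rule vp.j_sum_lower_semicontinuous[OF ylim zlim blim])
    show "0 \<le> y k" "0 \<le> z k" for k by (simp_all add: y_def z_def)
    show "j (y k) + j (z k) \<le> xs (n k) + 4 * m / real (Suc k)" for k
    proof -
      let ?f = "xs (n k) + 4 * m / real (Suc k)"
      let ?C = "B (s (n k))"
      have f: "?f \<ge> 0" using A(3) m0 by (simp add: xs_def)
      have le: "F (?C \<inter> ?u (t k)) + F (?C - ?u (t k)) \<le> ennreal ?f" by (rule nt(2))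
      then have "F (?C \<inter> ?u (t k)) \<noteq> top" "F (?C - ?u (t k)) \<noteq> top" by (auto simp: top_unique)
      then obtain p q where pq: "F (?C \<inter> ?u (t k)) = ennreal p" "p \<ge> 0" "F (?C - ?u (t k)) = ennreal q" "q \<ge> 0"
        by (cases "F (?C \<inter> ?u (t k))"; cases "F (?C - ?u (t k))") auto
      have "ennreal (p + q) \<le> ennreal ?f" using le pq by simp
      then have "p + q \<le> ?f" using f by (simp add: ennreal_le_iff)
      moreover have "j (y k) \<le> p" unfolding y_def
        using pq annulus_lmeasurable(1)[OF Bs] by (intro j_le_energy) auto
      moreover have "j (z k) \<le> q" unfolding z_def
        using pq annulus_lmeasurable(3)[OF Bs] by (intro j_le_energy fmeasurableI2[OF Blm]) auto
      ultimately show ?thesis by linarith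
    qed
  qed
  then have "vol E = m"
    using indecomposable_split[OF m _ E(2)] E0 by auto
  moreover have "F E \<le> ennreal (j m)"
    by (rule energy_lower_semicontinuous[OF Bs s(2,3) _ _ xs]) (use BF A(3) in \<open>auto simp: xs_def\<close>)
  ultimately show ?thesis using that E(1) by blast
qed

section \<open>Boundedness of minimisers\<close>

text \<open>
  With \<open>w\<close> the volume of \<open>A\<close> outside a sphere, the part inside has energy at least \<open>(1 - w / m)\<^sup>2 * j m\<close> by
  dilation and the part outside has energy at least a constant times \<open>w powr (1 - 1 / N)\<close>. Minimality
  therefore bounds this power by the cost of the cut plus a term linear in \<open>w\<close>, and for small \<open>w\<close> the
  linear term is absorbed by the power. What remains is the hypothesis of \<open>powr_vanish\<close>.
\<close>

theorem minimiser_bounded: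
  assumes A: "A \<in> lmeasurable" "vol A = m" "m > 0" "F A \<le> ennreal (j m)"
  obtains R where "vol (A - {x. soft_norm x < R}) = 0"
proof -
  let ?u = "\<lambda>t. {x::'a. soft_norm x < t}"
  let ?p = "1 - 1 / DIM('a)"
  have As: "A \<in> sets lebesgue" using A by auto
  have jm: "j m > 0" by (rule vp.j_pos[OF A(3)])
  define v where "v t = vol (A - ?u t)" for t
  have ulm: "A - ?u t \<in> lmeasurable" for t using annulus_lmeasurable(3)[OF As] by (intro fmeasurableI2[OF A(1)]) auto
  have v_eq: "v t = m - vol (A \<inter> ?u t)" for t
  proof -
    have "A - ?u t = A - A \<inter> ?u t" by auto
    then show ?thesis unfolding v_def A(2)[symmetric]
      using measurable_measure_Diff[OF A(1) fmeasurableD[OF annulus_lmeasurable(1)[OF As]]] by auto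
  qed
  have v_nonneg: "v t \<ge> 0" for t by (simp add: v_def)
  have v_mono: "v b \<le> v a" if "a \<le> b" for a b
    unfolding v_def using that ulm by (intro measure_mono_fmeasurable) auto
  have v_lim: "(\<lambda>n. v (real n)) \<longlonglongrightarrow> 0"
    unfolding v_eq using tendsto_diff[OF tendsto_const measure_truncation_tendsto[OF A(1) filterlim_real_sequentially], of m] A(2) by simp
  \<comment> \<open>Below this volume the linear term \<open>2 * (w / m) * j m\<close> is at most half of the isoperimetric term.\<close>
  define \<kappa> where "\<kappa> = min (m / 2) ((iso_const * m / (4 * j m)) powr (1 / (1 - ?p)))"
  have \<kappa>: "\<kappa> > 0" using A(3) iso_const(1) jm by (simp add: \<kappa>_def)
  have "\<forall>\<^sub>F n in sequentially. v (real n) < \<kappa>" using v_lim \<kappa> by (rule order_tendstoD(2))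
  then obtain n0 where n0: "v (real n0) < \<kappa>" by (meson eventually_happens sequentially_bot)
  define a0 where "a0 = real n0"
  have decay: "v b powr ?p * (b - a) \<le> (8 / iso_const) * v a" if ab: "a0 \<le> a" "a < b" for a b
  proof -
    obtain t where t: "a \<le> t" "t \<le> b" "F (A \<inter> ?u t) + F (A - ?u t)
      \<le> ennreal (j m + 4 * vol (A \<inter> {x. a \<le> soft_norm x \<and> soft_norm x < b}) / (b - a))"
      by (rule energy_cut[OF As A(4) less_imp_le[OF jm] ab(2)])
    let ?M = "vol (A \<inter> {x. a \<le> soft_norm x \<and> soft_norm x < b})"
    have Mv: "?M \<le> v a" unfolding v_def
      using ulm annulus_lmeasurable(2)[OF As] by (intro measure_mono_fmeasurable) auto
    let ?f = "j m + 4 * ?M / (b - a)"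
    have f: "?f \<ge> 0" using jm ab by simp
    have "F (A \<inter> ?u t) \<noteq> top" "F (A - ?u t) \<noteq> top" using t(3) by (auto simp: top_unique)
    then obtain p q where pq: "F (A \<inter> ?u t) = ennreal p" "p \<ge> 0" "F (A - ?u t) = ennreal q" "q \<ge> 0"
      by (cases "F (A \<inter> ?u t)"; cases "F (A - ?u t)") auto
    have "ennreal (p + q) \<le> ennreal ?f" using t(3) pq by simp
    then have pq_le: "p + q \<le> ?f" using f by (simp add: ennreal_le_iff)
    define w where "w = v t"
    have w0: "w \<ge> 0" by (simp add: w_def v_def)
    have w\<kappa>: "w < \<kappa>" unfolding w_def using v_mono[of a0 t] t(1) ab(1) n0 unfolding a0_def by linarith
    then have wm: "w < m" "w \<le> m / 2" using A(3) by (auto simp: \<kappa>_def)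
    have mt: "vol (A \<inter> ?u t) = m - w" using v_eq[of t] by (simp add: w_def)
    have jp: "j (m - w) \<le> p"
      using j_le_energy[OF annulus_lmeasurable(1)[OF As] _ pq(2), of t] pq(1) mt by simp
    have isoq: "iso_const * w powr ?p \<le> q"
      using iso_const(2)[OF ulm _ pq(4), of t] pq(3) by (simp add: w_def v_def)
    have scale: "(1 - w / m)\<^sup>2 * j m \<le> j (m - w)"
    proof -
      define \<tau> where "\<tau> = m / (m - w)"
      have \<tau>: "\<tau> \<ge> 1" "\<tau> * (m - w) = m" "(1 - w / m) * \<tau> = 1" using wm w0 A(3) by (auto simp: \<tau>_def field_simps)
      have "j m \<le> \<tau>\<^sup>2 * j (m - w)" using vp.j_scale[OF _ \<tau>(1), of "m - w"] wm \<tau>(2) by simp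
      then have "(1 - w / m)\<^sup>2 * j m \<le> (1 - w / m)\<^sup>2 * (\<tau>\<^sup>2 * j (m - w))" by (intro mult_left_mono) auto
      also have "\<dots> = ((1 - w / m) * \<tau>)\<^sup>2 * j (m - w)" by (simp add: power_mult_distrib)
      finally show ?thesis using \<tau>(3) by simp
    qed
    have "(1 - w / m)\<^sup>2 \<ge> 1 - 2 * (w / m)" by (simp add: power2_diff)
    then have "(1 - 2 * (w / m)) * j m \<le> (1 - w / m)\<^sup>2 * j m" using jm by (intro mult_right_mono) auto
    then have main: "iso_const * w powr ?p \<le> 2 * (w / m) * j m + 4 * ?M / (b - a)"
      using scale jp isoq pq_le by (simp add: algebra_simps)
    have absorb: "2 * (w / m) * j m \<le> (iso_const / 2) * w powr ?p"
    proof (cases "w = 0")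
      case False
      then have w: "w > 0" using w0 by simp
      have "w powr (1 - ?p) \<le> ((iso_const * m / (4 * j m)) powr (1 / (1 - ?p))) powr (1 - ?p)"
        using w\<kappa> w exponent_bounds by (intro powr_mono2) (auto simp: \<kappa>_def)
      also have "\<dots> = iso_const * m / (4 * j m)" using iso_const(1) A(3) jm exponent_bounds by (subst powr_powr) simp
      finally have "w powr (1 - ?p) \<le> iso_const * m / (4 * j m)" .
      then have "w powr (1 - ?p) * w powr ?p \<le> iso_const * m / (4 * j m) * w powr ?p" by (intro mult_right_mono) auto
      moreover have "w powr (1 - ?p) * w powr ?p = w" using w by (simp flip: powr_add)
      ultimately have "w \<le> iso_const * m / (4 * j m) * w powr ?p" by simp
      then have "w * (2 * j m / m) \<le> iso_const * m / (4 * j m) * w powr ?p * (2 * j m / m)"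
        using jm A(3) by (intro mult_right_mono) auto
      also have "\<dots> = (iso_const / 2) * w powr ?p" using jm A(3) by simp
      finally show ?thesis by (simp add: mult_ac)
    qed simp
    have "(iso_const / 2) * w powr ?p \<le> 4 * ?M / (b - a)" using main absorb by linarith
    also have "\<dots> \<le> 4 * v a / (b - a)" using Mv ab by (intro divide_right_mono) auto
    finally have "(iso_const / 2) * w powr ?p \<le> 4 * v a / (b - a)" .
    moreover have "v b powr ?p \<le> w powr ?p"
      unfolding w_def using v_mono[OF t(2)] exponent_bounds by (intro powr_mono2) (auto simp: v_nonneg)
    ultimately have "(iso_const / 2) * v b powr ?p \<le> 4 * v a / (b - a)"
      using iso_const(1) by (meson mult_left_mono order_trans half_gt_zero less_imp_le)
    then have "(iso_const / 2) * v b powr ?p * (b - a) \<le> 4 * v a" using ab by (simp add: pos_le_divide_eq)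
    then show ?thesis using iso_const(1) by (simp add: field_simps)
  qed
  have K: "8 / iso_const > 0" using iso_const(1) by simp
  obtain R where "R \<ge> a0" "v R = 0"
    by (rule powr_vanish[OF v_nonneg v_mono K exponent_bounds decay])
  then show ?thesis using that by (simp add: v_def)
qed

lemma bounded_minimiser:
  assumes m: "vp.indecomposable m"
  obtains A \<rho> where "A \<in> lmeasurable" "vol A = m" "F A \<le> ennreal (j m)" "A \<subseteq> ball 0 \<rho>"
proof -
  obtain B where B: "B \<in> lmeasurable" "vol B = m" "F B \<le> ennreal (j m)"
    by (rule indecomposable_attained[OF m])
  have m0: "m > 0" using m by (simp add: vp.indecomposable_def)
  obtain R where R: "vol (B - {x. soft_norm x < R}) = 0"
    by (rule minimiser_bounded[OF B(1,2) m0 B(3)])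
  let ?A = "B \<inter> {x. soft_norm x < R}"
  have Bs: "B \<in> sets lebesgue" using B by auto
  have A: "?A \<in> lmeasurable" by (rule annulus_lmeasurable(1)[OF Bs])
  have D: "B - {x. soft_norm x < R} \<in> lmeasurable"
    using annulus_lmeasurable(3)[OF Bs] by (intro fmeasurableI2[OF B(1)]) auto
  then have "B - {x. soft_norm x < R} \<in> null_sets lebesgue"
    using R by (intro null_setsI fmeasurableD) (auto simp: emeasure_eq_measure2)
  then have "AE x in lebesgue. x \<notin> B - {x. soft_norm x < R}" by (rule AE_not_in)
  then have ae: "AE x in lebesgue. x \<in> ?A \<longleftrightarrow> x \<in> B" by eventually_elim auto
  show ?thesis
  proof (rule that[OF A])
    show "vol ?A = m"
      using emeasure_eq_AE[OF ae fmeasurableD[OF A] Bs] B(2) by (simp add: measure_def)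
    show "F ?A \<le> ennreal (j m)" using energy_cong_AE[OF fmeasurableD[OF A] Bs ae] B(3) by simp
    show "?A \<subseteq> ball 0 R" by (auto intro: le_less_trans[OF norm_le_soft_norm])
  qed
qed

section \<open>Minimisers of the generalised energy\<close>

lemma gen_energy_le:
  assumes "is_partition H D \<Omega>" "H \<ge> 1"
  shows "gen_energy g \<epsilon> \<Omega> \<le> (\<Sum>i\<in>{1..H}. F (D i))"
proof -
  have "gen_energy g \<epsilon> \<Omega> \<le> gen_energy_pieces g \<epsilon> H \<Omega>"
    unfolding gen_energy_def by (rule INF_lower) (use assms in auto)
  also have "\<dots> \<le> (\<Sum>i\<in>{1..H}. F (D i))"
    unfolding gen_energy_pieces_def by (rule INF_lower) (use assms in auto)
  finally show ?thesis .
qed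

lemma gen_energy_le_energy:
  assumes "\<Omega> \<in> sets lebesgue"
  shows "gen_energy g \<epsilon> \<Omega> \<le> F \<Omega>"
  using gen_energy_le[of 1 "\<lambda>_. \<Omega>" \<Omega>] assms by (simp add: is_partition_def disjoint_family_on_def)

text \<open>
  A partition of \<open>\<Omega>\<close> is a list of sets with the volume of \<open>\<Omega>\<close>.
\<close>

lemma j_le_gen_energy:
  assumes \<Omega>: "\<Omega> \<in> volume_class (ennreal m)" and m: "m \<ge> 0"
  shows "ennreal (j m) \<le> gen_energy g \<epsilon> \<Omega>"
  unfolding gen_energy_def gen_energy_pieces_def
proof (intro INF_greatest)
  fix H :: nat and D :: "nat \<Rightarrow> 'a set" assume "D \<in> {D. is_partition H D \<Omega>}"
  then have D: "\<And>i. i \<in> {1..H} \<Longrightarrow> D i \<in> sets lebesgue" "\<Omega> = (\<Union>i\<in>{1..H}. D i)" "disjoint_family_on D {1..H}"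
    by (auto simp: is_partition_def)
  have \<Omega>m: "\<Omega> \<in> sets lebesgue" "emeasure lebesgue \<Omega> = ennreal m" using \<Omega> by (auto simp: volume_class_def)
  then have \<Omega>lm: "\<Omega> \<in> lmeasurable" by (intro fmeasurableI) auto
  have Dlm: "D i \<in> lmeasurable" if "i \<in> {1..H}" for i
    by (rule fmeasurableI2[OF \<Omega>lm _ D(1)[OF that]]) (use D(2) that in auto)
  have "vol (\<Union>i\<in>{1..H}. D i) = (\<Sum>i\<in>{1..H}. vol (D i))"
  proof (rule measure_finite_Union)
    show "D ` {1..H} \<subseteq> sets lebesgue" using D(1) by auto
    show "emeasure lebesgue (D i) \<noteq> \<infinity>" if "i \<in> {1..H}" for i using fmeasurableD2[OF Dlm[OF that]] by simp
  qed (use D(3) in auto)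
  moreover have "vol \<Omega> = m" using \<Omega>m(2) m by (simp add: measure_def)
  ultimately have sum: "(\<Sum>i\<in>{1..H}. vol (D i)) = m" using D(2) by simp
  let ?L = "map D [1..<Suc H]"
  have eq: "sum_list (map h [1..<Suc H]) = (\<Sum>i\<in>{1..H}. h i)" for h :: "nat \<Rightarrow> 'b::comm_monoid_add"
    by (simp add: sum_list_distinct_conv_sum_set atLeastLessThanSuc_atLeastAtMost del: upt_Suc)
  have set: "set [1..<Suc H] = {1..H}" by (simp only: set_upt atLeastLessThanSuc_atLeastAtMost)
  have "pieces m ?L"
    unfolding pieces_def
  proof
    show "set ?L \<subseteq> lmeasurable" using Dlm unfolding set_map set by blast
    show "sum_list (map vol ?L) = m" unfolding map_map eq comp_def by (rule sum)
  qed
  then have "J m \<le> total ?L" by (rule J_le)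
  also have "total ?L = (\<Sum>i\<in>{1..H}. F (D i))" unfolding map_map eq comp_def ..
  finally show "ennreal (j m) \<le> (\<Sum>i\<in>{1..H}. F (D i))" using J_eq[OF m] by simp
qed

text \<open>
  Bounded minimisers for the parts of an indecomposable splitting, translated apart.
\<close>

theorem optimal_partition_exists:
  assumes m: "m > 0"
  obtains E H D where "E \<in> volume_class (ennreal m)" "H \<ge> 1" "is_partition H D E"
    "(\<Sum>i\<in>{1..H}. F (D i)) \<le> ennreal (j m)"
    "\<And>i. i \<in> {1..H} \<Longrightarrow> D i \<in> lmeasurable" "\<And>i. i \<in> {1..H} \<Longrightarrow> F (D i) \<le> ennreal (j (vol (D i)))"
proof -
  obtain M where M: "vp.optimal_splitting m M" "\<And>x. x \<in># M \<Longrightarrow> vp.indecomposable x"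
    by (rule vp.indecomposable_splitting[OF m]) (rule that)
  obtain L where L: "mset L = M" using ex_mset by blast
  have sumL: "sum_list L = m" "(\<Sum>x\<leftarrow>L. j x) = j m"
    using M(1) unfolding vp.optimal_splitting_def L[symmetric] by (simp_all add: sum_mset_sum_list flip: mset_map)
  have "\<forall>x\<in>set L. \<exists>A \<rho>. A \<in> lmeasurable \<and> vol A = x \<and> F A \<le> ennreal (j x) \<and> A \<subseteq> ball 0 \<rho>"
  proof
    fix x assume "x \<in> set L"
    then have "vp.indecomposable x" using M(2) L by auto
    then show "\<exists>A \<rho>. A \<in> lmeasurable \<and> vol A = x \<and> F A \<le> ennreal (j x) \<and> A \<subseteq> ball 0 \<rho>"
      by (rule bounded_minimiser) blast
  qed
  then obtain A \<rho> where A: "\<And>x. x \<in> set L \<Longrightarrow> A x \<in> lmeasurable" "\<And>x. x \<in> set L \<Longrightarrow> vol (A x) = x"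
    "\<And>x. x \<in> set L \<Longrightarrow> F (A x) \<le> ennreal (j x)" "\<And>x. x \<in> set L \<Longrightarrow> A x \<subseteq> ball 0 (\<rho> x)"
    by metis
  define R where "R = (\<Sum>x\<in>set L. \<bar>\<rho> x\<bar>)"
  have AR: "A x \<subseteq> ball 0 R" if "x \<in> set L" for x
  proof -
    have "\<rho> x \<le> \<bar>\<rho> x\<bar>" by simp
    also have "\<dots> \<le> R" unfolding R_def using that by (intro member_le_sum) auto
    finally show ?thesis using A(4)[OF that] subset_ball by blast
  qed
  obtain e :: 'a where "e \<in> Basis" using nonempty_Basis by blast
  then have e: "norm e = 1" by simp
  \<comment> \<open>All minimisers lie in the ball of radius \<open>R\<close>, so translates by multiples of \<open>2 * R\<close> along a unit
    vector are disjoint. Pieces are numbered from \<open>1\<close>, list entries from \<open>0\<close>.\<close>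
  define D where "D i = (\<lambda>y. (2 * R * real i) *\<^sub>R e + 1 *\<^sub>R y) ` A (L ! (i - 1))" for i
  define H where "H = length L"
  have nth: "L ! (i - 1) \<in> set L" if "i \<in> {1..H}" for i
    using that unfolding H_def by (intro nth_mem) auto
  have Dlm: "D i \<in> lmeasurable" if "i \<in> {1..H}" for i
    unfolding D_def by (rule affine_image_lmeasurable[OF A(1)[OF nth[OF that]]]) simp
  have Dm: "vol (D i) = L ! (i - 1)" if "i \<in> {1..H}" for i
    unfolding D_def using measure_affine_image[of 1 _ "A (L ! (i - 1))"] A(2)[OF nth[OF that]] by simp
  have DF: "F (D i) \<le> ennreal (j (L ! (i - 1)))" if "i \<in> {1..H}" for i
    unfolding D_def
    using energy_affine_le[OF fmeasurableD[OF A(1)[OF nth[OF that]]] order.refl A(3)[OF nth[OF that]] j_nonneg] by simp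
  have "D i \<inter> D l = {}" if il: "i \<in> {1..H}" "l \<in> {1..H}" "i \<noteq> l" for i l
  proof (rule ccontr)
    assume "D i \<inter> D l \<noteq> {}"
    then obtain a b where ab: "a \<in> A (L ! (i - 1))" "b \<in> A (L ! (l - 1))"
      "(2 * R * real i) *\<^sub>R e + a = (2 * R * real l) *\<^sub>R e + b" by (auto simp: D_def)
    have n: "norm a < R" "norm b < R" using ab AR[OF nth[OF il(1)]] AR[OF nth[OF il(2)]] by auto
    have R0: "R > 0" using n(1) norm_ge_zero[of a] by linarith
    have "b - a = (2 * R * (real i - real l)) *\<^sub>R e" using ab(3) by (simp add: algebra_simps)
    then have "norm (b - a) = 2 * R * \<bar>real i - real l\<bar>" using e R0 by (simp add: abs_mult)
    moreover have "\<bar>real i - real l\<bar> \<ge> 1" using il(3) by linarith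
    then have "2 * R * \<bar>real i - real l\<bar> \<ge> 2 * R * 1" using R0 by (intro mult_left_mono) auto
    moreover have "norm (b - a) < 2 * R" using norm_triangle_ineq4[of b a] n by linarith
    ultimately show False by linarith
  qed
  then have disj: "disjoint_family_on D {1..H}" by (auto simp: disjoint_family_on_def)
  define E where "E = (\<Union>i\<in>{1..H}. D i)"
  have Elm: "E \<in> lmeasurable" unfolding E_def using Dlm by (intro fmeasurable.finite_UN) auto
  have idx: "(\<Sum>i\<in>{1..H}. h (L ! (i - 1))) = sum_list (map h L)" for h :: "real \<Rightarrow> 'b::comm_monoid_add"
  proof -
    have "(\<Sum>i\<in>{1..H}. h (L ! (i - 1))) = (\<Sum>k<H. h (L ! k))"
      using sum.atLeast1_atMost_eq[of "\<lambda>i. h (L ! (i - 1))" H] by simp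
    then show ?thesis unfolding H_def by (simp add: sum_list_sum_nth atLeast0LessThan)
  qed
  have "vol E = (\<Sum>i\<in>{1..H}. vol (D i))"
    unfolding E_def
  proof (rule measure_finite_Union[OF _ _ disj])
    show "D ` {1..H} \<subseteq> sets lebesgue" using Dlm by auto
    show "emeasure lebesgue (D i) \<noteq> \<infinity>" if "i \<in> {1..H}" for i using fmeasurableD2[OF Dlm[OF that]] by simp
  qed simp
  also have "\<dots> = (\<Sum>i\<in>{1..H}. L ! (i - 1))" using Dm by (intro sum.cong) auto
  also have "\<dots> = m" using idx[of "\<lambda>x. x"] sumL(1) by simp
  finally have "E \<in> volume_class (ennreal m)"
    using Elm by (auto simp: volume_class_def emeasure_eq_measure2)
  moreover have "H \<ge> 1"
  proof -
    have "L \<noteq> []" using sumL(1) m by auto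
    then show ?thesis unfolding H_def by (simp add: Suc_le_eq)
  qed
  moreover have "is_partition H D E" using Dlm disj by (auto simp: is_partition_def E_def)
  moreover have "(\<Sum>i\<in>{1..H}. F (D i)) \<le> ennreal (j m)"
  proof -
    have "(\<Sum>i\<in>{1..H}. F (D i)) \<le> (\<Sum>i\<in>{1..H}. ennreal (j (L ! (i - 1))))" by (intro sum_mono DF)
    also have "\<dots> = ennreal (\<Sum>i\<in>{1..H}. j (L ! (i - 1)))" by (intro sum_ennreal j_nonneg)
    also have "(\<Sum>i\<in>{1..H}. j (L ! (i - 1))) = j m" using idx[of j] sumL(2) by simp
    finally show ?thesis .
  qed
  moreover have "F (D i) \<le> ennreal (j (vol (D i)))" if "i \<in> {1..H}" for i
    using DF[OF that] Dm[OF that] by simp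
  ultimately show ?thesis using that Dlm by blast
qed

end

theorem proposition1p2:
  fixes g :: "real ^ 'n \<Rightarrow> real" and \<epsilon> :: real
  assumes "CARD('n) \<ge> 2"
    and "g \<in> borel_measurable (lebesgue_on (- {0}))"
    and "\<And>x. x \<noteq> 0 \<Longrightarrow> g x > 0"
    and "admissible g"
    and "radially_decreasing g"
    and "\<epsilon> > 0"
  shows "\<exists>(E :: (real ^ 'n) set) (H :: nat) (D :: nat \<Rightarrow> (real ^ 'n) set).
    E \<in> unit_class \<and> H \<ge> 1 \<and> is_partition H D E \<and>
    gen_energy g \<epsilon> E = (\<Sum>i\<in>{1..H}. energy g \<epsilon> (D i)) \<and>
    (\<Sum>i\<in>{1..H}. energy g \<epsilon> (D i)) = (INF \<Omega>\<in>unit_class. gen_energy g \<epsilon> \<Omega>) \<and>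
    (\<forall>i\<in>{1..H}.
       is_arg_min (energy g \<epsilon>) (\<lambda>\<Omega>. \<Omega> \<in> volume_class (emeasure lebesgue (D i))) (D i) \<and>
       is_arg_min (gen_energy g \<epsilon>) (\<lambda>\<Omega>. \<Omega> \<in> volume_class (emeasure lebesgue (D i))) (D i) \<and>
       gen_energy g \<epsilon> (D i) = energy g \<epsilon> (D i) \<and>
       energy g \<epsilon> (D i) = (INF \<Omega>\<in>volume_class (emeasure lebesgue (D i)). gen_energy g \<epsilon> \<Omega>))"
proof -
  interpret riesz_energy g \<epsilon>
    using assms by unfold_locales auto
  define m where "m = vol (ball (0 :: real ^ 'n) 1)"
  have m: "m > 0" unfolding m_def using content_ball_pos[of 1 "0 :: real ^ 'n"] by simp
  have uc: "(unit_class :: (real ^ 'n) set set) = volume_class (ennreal m)"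
    unfolding unit_class_def m_def by (simp only: emeasure_eq_measure2[OF lmeasurable_ball])
  obtain E H D where E: "E \<in> volume_class (ennreal m)" "H \<ge> 1" "is_partition H D E"
    "(\<Sum>i\<in>{1..H}. F (D i)) \<le> ennreal (j m)"
    "\<And>i. i \<in> {1..H} \<Longrightarrow> D i \<in> lmeasurable" "\<And>i. i \<in> {1..H} \<Longrightarrow> F (D i) \<le> ennreal (j (vol (D i)))"
    by (rule optimal_partition_exists[OF m]) (rule that)
  have lower: "ennreal (j m) \<le> gen_energy g \<epsilon> \<Omega>" if "\<Omega> \<in> volume_class (ennreal m)" for \<Omega>
    by (rule j_le_gen_energy[OF that less_imp_le[OF m]])
  have up: "gen_energy g \<epsilon> E \<le> (\<Sum>i\<in>{1..H}. F (D i))" by (rule gen_energy_le[OF E(3,2)])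
  have eq1: "gen_energy g \<epsilon> E = (\<Sum>i\<in>{1..H}. F (D i))"
    using up E(4) lower[OF E(1)] by (meson antisym order_trans)
  have eq2: "(\<Sum>i\<in>{1..H}. F (D i)) = (INF \<Omega>\<in>volume_class (ennreal m). gen_energy g \<epsilon> \<Omega>)"
  proof (rule antisym)
    show "(\<Sum>i\<in>{1..H}. F (D i)) \<le> (INF \<Omega>\<in>volume_class (ennreal m). gen_energy g \<epsilon> \<Omega>)"
      by (rule INF_greatest) (rule order_trans[OF E(4) lower])
    show "(INF \<Omega>\<in>volume_class (ennreal m). gen_energy g \<epsilon> \<Omega>) \<le> (\<Sum>i\<in>{1..H}. F (D i))"
      unfolding eq1[symmetric] by (rule INF_lower[OF E(1)])
  qed
  have pieces: "is_arg_min F (\<lambda>\<Omega>. \<Omega> \<in> volume_class (emeasure lebesgue (D i))) (D i) \<and>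
       is_arg_min (gen_energy g \<epsilon>) (\<lambda>\<Omega>. \<Omega> \<in> volume_class (emeasure lebesgue (D i))) (D i) \<and>
       gen_energy g \<epsilon> (D i) = F (D i) \<and>
       F (D i) = (INF \<Omega>\<in>volume_class (emeasure lebesgue (D i)). gen_energy g \<epsilon> \<Omega>)"
    if i: "i \<in> {1..H}" for i
  proof -
    let ?C = "volume_class (emeasure lebesgue (D i))"
    have Ds: "D i \<in> sets lebesgue" by (rule fmeasurableD[OF E(5)[OF i]])
    have DC: "D i \<in> ?C" using Ds by (simp add: volume_class_def)
    have low: "F (D i) \<le> gen_energy g \<epsilon> \<Omega>" if "\<Omega> \<in> ?C" for \<Omega>
    proof -
      have "\<Omega> \<in> volume_class (ennreal (vol (D i)))"
        using that by (simp only: emeasure_eq_measure2[OF E(5)[OF i]])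
      from j_le_gen_energy[OF this] have "ennreal (j (vol (D i))) \<le> gen_energy g \<epsilon> \<Omega>" by simp
      with E(6)[OF i] show ?thesis by (rule order_trans)
    qed
    have gD: "gen_energy g \<epsilon> (D i) = F (D i)"
      using gen_energy_le_energy[OF Ds] low[OF DC] by (rule antisym)
    have lowF: "F (D i) \<le> F \<Omega>" if "\<Omega> \<in> ?C" for \<Omega>
      using low[OF that] gen_energy_le_energy[of \<Omega>] that by (auto simp: volume_class_def intro: order_trans)
    have "F (D i) = (INF \<Omega>\<in>?C. gen_energy g \<epsilon> \<Omega>)"
    proof (rule antisym)
      show "F (D i) \<le> (INF \<Omega>\<in>?C. gen_energy g \<epsilon> \<Omega>)" by (rule INF_greatest) (rule low)
      show "(INF \<Omega>\<in>?C. gen_energy g \<epsilon> \<Omega>) \<le> F (D i)" unfolding gD[symmetric] by (rule INF_lower[OF DC])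
    qed
    then show ?thesis using DC low lowF gD unfolding is_arg_min_def by (simp add: not_less)
  qed
  show ?thesis
    unfolding uc using E(1,2,3) eq1 eq2 pieces by blast
qed

end
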